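(* The canonical line bundle $\bigwedge^{16}T^{*\prime}(\mathbb{X}_{\mathbb{O}})^{\mathbb{C}}$ (the bundle of holomorphic $16$-forms) of the complex manifold $\mathbb{X}_{\mathbb{O}}$ admits a nowhere vanishing global holomorphic section $\Omega_{\mathbb{O}}$ obtained by glueing the following local sections: for each of the $24$ off-diagonal coordinate functions $a\in\{z_i,w_i,y_i,v_i,x_i,u_i\}_{i=1}^4$, on the coordinate neighborhood $O_a=\{A\in\mathbb{X}_{\mathbb{O}} : a\neq 0\}$ the section is $$\frac{1}{a^{5}}\,\cdot(\text{exterior product of the differentials of the }16\text{ coordinates of the chart }P_a),$$ where the $16$ coordinates of each chart are suitably ordered. In particular, on $O_{z_1}$, $$\Omega_{\mathbb{O}}=\frac{1}{z_1^{5}}\,d\xi_2\wedge dz_1\wedge dz_2\wedge dz_3\wedge dw_1\wedge dw_2\wedge dw_3\wedge dw_4\wedge dy_2\wedge dy_4\wedge dv_1\wedge dv_3\wedge dx_3\wedge dx_4\wedge du_2\wedge du_4 .$$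
   Context: $\mathbb{H}$ denotes the quaternions with basis $\mathbf 1,\mathbf i,\mathbf j,\mathbf k$; $\mathbb{O}=\mathbb{H}\oplus\mathbb{H}\mathbf e_4$ the octonions with basis $\mathbf e_0=\mathbf 1,\mathbf e_1=\mathbf i,\mathbf e_2=\mathbf j,\mathbf e_3=\mathbf k$, $\mathbf e_{i+4}=\mathbf e_i\mathbf e_4$ $(i=0,\dots,3)$, with product $(a+b\mathbf e_4)(c+d\mathbf e_4)=ac-\theta(d)b+(da+b\theta(c))\mathbf e_4$, where $\theta(\sum h_i\mathbf e_i)=h_0\mathbf e_0-\sum_{i\ge1}h_i\mathbf e_i$. Product and $\theta$ are extended complex-linearly to $\mathbb{C}\otimes_{\mathbb{R}}\mathbb{O}$. $\mathcal{J}(3)^{\mathbb{C}}$ is the $27$-dimensional complex space of matrices $A=\begin{pmatrix}\xi_1&z&\theta(y)\\ \theta(z)&\xi_2&x\\ y&\theta(x)&\xi_3\end{pmatrix}$ with $\xi_i\in\mathbb{C}$, $x,y,z\in\mathbb{C}\otimes_{\mathbb{R}}\mathbb{O}$. $\mathbb{X}_{\mathbb{O}}=\{A\in\mathcal{J}(3)^{\mathbb{C}} : A\ne0,\ A^2=0\}$, a complex manifold of complex dimension $16$ (on which $\xi_1+\xi_2+\xi_3=0$ holds). Coordinates: identify $\mathbb{C}\otimes_{\mathbb{R}}\mathbb{H}$ with the $2\times2$ complex matrices by $h_0\mathbf 1+h_1\mathbf i+h_2\mathbf j+h_3\mathbf k\mapsto\begin{pmatrix}h_0+\sqrt{-1}h_1&h_2+\sqrt{-1}h_3\\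 -h_2+\sqrt{-1}h_3&h_0-\sqrt{-1}h_1\end{pmatrix}$; on matrices $\theta\begin{pmatrix}p&q\\ r&s\end{pmatrix}=\begin{pmatrix}s&-q\\ -r&p\end{pmatrix}$. Write $z=Z+W\mathbf e_4$, $y=Y+V\mathbf e_4$, $x=X+U\mathbf e_4$ with $Z=\begin{pmatrix}z_1&z_2\\ z_3&z_4\end{pmatrix}$ and similarly $W=(w_i)$, $Y=(y_i)$, $V=(v_i)$, $X=(x_i)$, $U=(u_i)$. Then $(\xi_1,\xi_2,\xi_3,z_i,w_i,y_i,v_i,x_i,u_i)$ are linear coordinates on $\mathcal{J}(3)^{\mathbb{C}}\cong\mathbb{C}^{27}$. On $\mathbb{X}_{\mathbb{O}}$ the following equations hold: $\xi_1\theta(X)=YZ-\theta(W)V$, $-\xi_1U=WY+V\theta(Z)$, $\xi_2\theta(Y)=ZX-\theta(U)W$, $-\xi_2V=UZ+W\theta(X)$, $\xi_3\theta(Z)=XY-\theta(V)U$, $-\xi_3W=VX+U\theta(Y)$, $\xi_1^2+\det Z+\det W+\det Y+\det V=0$, $\xi_2^2+\det Z+\det W+\det X+\det U=0$, $\xi_3^2+\det Y+\det V+\det X+\det U=0$. Charts: for an off-diagonal coordinate $a$, there are exactly ten coordinates $b$ such that the monomial $ab$ occurs in these equations (one of them is a diagonal coordinate: $\xi_3$ if $a\in\{z_i,w_i\}$, $\xi_2$ if $a\in\{y_i,v_i\}$, $\xi_1$ if $a\in\{x_i,u_i\}$). On $O_a$ these ten are solved in terms of the others, and one of the two remaining $\xi$'s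 (a fixed choice) is eliminated by $\xi_1+\xi_2+\xi_3=0$; the remaining $16$ coordinates (including $a$) form the chart $P_a$ on $O_a$. For $a=z_1$ the dependent variables are $x_1,x_2,u_1,u_3,y_1,y_3,v_2,v_4,z_4,\xi_3,\xi_1$ and $P_{z_1}=(\xi_2,z_1,z_2,z_3,w_1,w_2,w_3,w_4,y_2,y_4,v_1,v_3,x_3,x_4,u_2,u_4)$. *)

theory Defs
  imports "HOL-Analysis.Analysis"
begin

section \<open>Complexified quaternions and octonions\<close>

text \<open>Components are complex coefficients with respect to the bases
  1, i, j, k and 1, i, j, k, e4, ..., e7; the pair (a, b) of complexified quaternions
  stands for a + b e4. All operations are complex (bi)linear; in particular the conjugation
  does not conjugate the complex coefficients.\<close>

type_synonym cquat = "complex \<times> complex \<times> complex \<times> complex"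
type_synonym coct = "cquat \<times> cquat"

fun qmul :: "cquat \<Rightarrow> cquat \<Rightarrow> cquat" where
  "qmul (a0, a1, a2, a3) (b0, b1, b2, b3) =
    (a0 * b0 - a1 * b1 - a2 * b2 - a3 * b3,
     a0 * b1 + a1 * b0 + a2 * b3 - a3 * b2,
     a0 * b2 - a1 * b3 + a2 * b0 + a3 * b1,
     a0 * b3 + a1 * b2 - a2 * b1 + a3 * b0)"

fun qconj :: "cquat \<Rightarrow> cquat" where
  "qconj (h0, h1, h2, h3) = (h0, - h1, - h2, - h3)"

fun omul :: "coct \<Rightarrow> coct \<Rightarrow> coct" where
  "omul (a, b) (c, d) = (qmul a c - qmul (qconj d) b, qmul d a + qmul b (qconj c))"

fun oconj :: "coct \<Rightarrow> coct" where
  "oconj (a, b) = (qconj a, - b)"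

definition ocplx :: "complex \<Rightarrow> coct" where
  "ocplx c = ((c, 0, 0, 0), (0, 0, 0, 0))"


section \<open>The complexified Jordan algebra and its coordinates\<close>

definition omat_mul :: "coct^3^3 \<Rightarrow> coct^3^3 \<Rightarrow> coct^3^3" where
  "omat_mul A B = (\<chi> i j. \<Sum>k\<in>UNIV. omul (A $ i $ k) (B $ k $ j))"

definition jmat :: "complex \<Rightarrow> complex \<Rightarrow> complex \<Rightarrow> coct \<Rightarrow> coct \<Rightarrow> coct \<Rightarrow> coct^3^3" where
  "jmat \<xi>1 \<xi>2 \<xi>3 x y z = vector
     [vector [ocplx \<xi>1, z, oconj y],
      vector [oconj z, ocplx \<xi>2, x],
      vector [y, oconj x, ocplx \<xi>3]]"

definition J3C :: "(coct^3^3) set" where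
  "J3C = {A. \<exists>\<xi>1 \<xi>2 \<xi>3 x y z. A = jmat \<xi>1 \<xi>2 \<xi>3 x y z}"

datatype coord =
    Xi1 | Xi2 | Xi3
  | Z1 | Z2 | Z3 | Z4 | W1 | W2 | W3 | W4
  | Y1 | Y2 | Y3 | Y4 | V1 | V2 | V3 | V4
  | X1 | X2 | X3 | X4 | U1 | U2 | U3 | U4

lemma UNIV_coord:
  "UNIV = {Xi1, Xi2, Xi3, Z1, Z2, Z3, Z4, W1, W2, W3, W4, Y1, Y2, Y3, Y4,
           V1, V2, V3, V4, X1, X2, X3, X4, U1, U2, U3, U4}"
  using coord.exhaust by blast

instance coord :: finite
  by standard (simp add: UNIV_coord)

definition diag_coords :: "coord set" where
  "diag_coords = {Xi1, Xi2, Xi3}"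

definition offdiag_coords :: "coord set" where
  "offdiag_coords = - diag_coords"

text \<open>The isomorphism of the complexified quaternions with the 2x2 complex matrices, and its
  inverse in terms of the matrix entries p, q (first row) and r, s (second row).\<close>

fun quat_mat :: "cquat \<Rightarrow> complex^2^2" where
  "quat_mat (h0, h1, h2, h3) = vector
     [vector [h0 + \<i> * h1, h2 + \<i> * h3],
      vector [- h2 + \<i> * h3, h0 - \<i> * h1]]"

definition mat2 :: "complex \<Rightarrow> complex \<Rightarrow> complex \<Rightarrow> complex \<Rightarrow> complex^2^2" where
  "mat2 p q r s = vector [vector [p, q], vector [r, s]]"

definition quat_of_entries :: "complex \<Rightarrow> complex \<Rightarrow> complex \<Rightarrow> complex \<Rightarrow> cquat" where
  "quat_of_entries p q r s = ((p + s) / 2, (p - s) / (2 * \<i>), (q - r) / 2, (q + r) / (2 * \<i>))"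

definition theta2 :: "complex^2^2 \<Rightarrow> complex^2^2" where
  "theta2 M = mat2 (M $ 2 $ 2) (- (M $ 1 $ 2)) (- (M $ 2 $ 1)) (M $ 1 $ 1)"

lemma quat_mat_of_entries: "quat_mat (quat_of_entries p q r s) = mat2 p q r s"
  by (simp add: quat_of_entries_def mat2_def field_simps)

lemma quat_of_entries_mat:
  "quat_of_entries (quat_mat h $ 1 $ 1) (quat_mat h $ 1 $ 2) (quat_mat h $ 2 $ 1) (quat_mat h $ 2 $ 2) = h"
  by (cases h) (simp add: quat_of_entries_def field_simps)

lemma quat_mat_mul: "quat_mat (qmul g h) = quat_mat g ** quat_mat h"
  by (cases g; cases h)
    (simp add: vec_eq_iff forall_2 matrix_matrix_mult_def sum_2 algebra_simps)

lemma quat_mat_conj: "quat_mat (qconj h) = theta2 (quat_mat h)"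
  by (cases h) (simp add: theta2_def mat2_def)

text \<open>The linear identification of the 27-dimensional coordinate space with the Jordan algebra.\<close>

definition jordan :: "complex^coord \<Rightarrow> coct^3^3" where
  "jordan p = jmat (p $ Xi1) (p $ Xi2) (p $ Xi3)
     (quat_of_entries (p $ X1) (p $ X2) (p $ X3) (p $ X4),
      quat_of_entries (p $ U1) (p $ U2) (p $ U3) (p $ U4))
     (quat_of_entries (p $ Y1) (p $ Y2) (p $ Y3) (p $ Y4),
      quat_of_entries (p $ V1) (p $ V2) (p $ V3) (p $ V4))
     (quat_of_entries (p $ Z1) (p $ Z2) (p $ Z3) (p $ Z4),
      quat_of_entries (p $ W1) (p $ W2) (p $ W3) (p $ W4))"

lemma vector_3_eq_iff:
  "(vector [a, b, c] :: ('a::zero)^3) = vector [a', b', c'] \<longleftrightarrow> a = a' \<and> b = b' \<and> c = c'"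
  by (auto simp: vec_eq_iff forall_3)

lemma quat_of_entries_inject:
  "quat_of_entries p q r s = quat_of_entries p' q' r' s' \<longleftrightarrow> p = p' \<and> q = q' \<and> r = r' \<and> s = s'"
proof
  assume "quat_of_entries p q r s = quat_of_entries p' q' r' s'"
  then have "mat2 p q r s = mat2 p' q' r' s'"
    by (metis quat_mat_of_entries)
  then show "p = p' \<and> q = q' \<and> r = r' \<and> s = s'"
    by (auto simp: mat2_def vec_eq_iff forall_2)
qed simp

lemma bij_betw_jordan: "bij_betw jordan UNIV J3C"
proof (rule bij_betw_imageI)
  show "inj_on jordan UNIV"
  proof (rule inj_onI)
    fix p q :: "complex^coord"
    assume "jordan p = jordan q"
    then have "\<forall>c\<in>UNIV. p $ c = q $ c"
      unfolding UNIV_coord jordan_def jmat_def vector_3_eq_iff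
      by (simp add: quat_of_entries_inject ocplx_def)
    then show "p = q" by (simp add: vec_eq_iff)
  qed
  show "jordan ` UNIV = J3C"
  proof
    show "jordan ` UNIV \<subseteq> J3C" unfolding J3C_def jordan_def by blast
    show "J3C \<subseteq> jordan ` UNIV"
    proof
      fix A assume "A \<in> J3C"
      then obtain a b c x u y v z w where A: "A = jmat a b c (x, u) (y, v) (z, w)"
        unfolding J3C_def by auto
      define e where "e h k = quat_mat h $ fst k $ snd k" for h :: cquat and k :: "2 \<times> 2"
      define p :: "complex^coord" where
        "p = (\<chi> t. case t of Xi1 \<Rightarrow> a | Xi2 \<Rightarrow> b | Xi3 \<Rightarrow> c
          | Z1 \<Rightarrow> e z (1,1) | Z2 \<Rightarrow> e z (1,2) | Z3 \<Rightarrow> e z (2,1) | Z4 \<Rightarrow> e z (2,2)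
          | W1 \<Rightarrow> e w (1,1) | W2 \<Rightarrow> e w (1,2) | W3 \<Rightarrow> e w (2,1) | W4 \<Rightarrow> e w (2,2)
          | Y1 \<Rightarrow> e y (1,1) | Y2 \<Rightarrow> e y (1,2) | Y3 \<Rightarrow> e y (2,1) | Y4 \<Rightarrow> e y (2,2)
          | V1 \<Rightarrow> e v (1,1) | V2 \<Rightarrow> e v (1,2) | V3 \<Rightarrow> e v (2,1) | V4 \<Rightarrow> e v (2,2)
          | X1 \<Rightarrow> e x (1,1) | X2 \<Rightarrow> e x (1,2) | X3 \<Rightarrow> e x (2,1) | X4 \<Rightarrow> e x (2,2)
          | U1 \<Rightarrow> e u (1,1) | U2 \<Rightarrow> e u (1,2) | U3 \<Rightarrow> e u (2,1) | U4 \<Rightarrow> e u (2,2))"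
      have "jordan p = A"
        unfolding A jordan_def p_def by (simp add: e_def quat_of_entries_mat)
      then show "A \<in> jordan ` UNIV" by blast
    qed
  qed
qed

text \<open>The manifold of nonzero A in the Jordan algebra with A A = 0, in coordinates.\<close>

definition XO :: "(complex^coord) set" where
  "XO = jordan -` {A \<in> J3C. A \<noteq> 0 \<and> omat_mul A A = 0}"

definition O_nbhd :: "coord \<Rightarrow> (complex^coord) set" where
  "O_nbhd a = {p \<in> XO. p $ a \<noteq> 0}"


section \<open>The defining quadratic equations and the coordinate sets\<close>

definition Zm where "Zm (p :: complex^coord) = mat2 (p $ Z1) (p $ Z2) (p $ Z3) (p $ Z4)"
definition Wm where "Wm (p :: complex^coord) = mat2 (p $ W1) (p $ W2) (p $ W3) (p $ W4)"
definition Ym where "Ym (p :: complex^coord) = mat2 (p $ Y1) (p $ Y2) (p $ Y3) (p $ Y4)"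
definition Vm where "Vm (p :: complex^coord) = mat2 (p $ V1) (p $ V2) (p $ V3) (p $ V4)"
definition Xm where "Xm (p :: complex^coord) = mat2 (p $ X1) (p $ X2) (p $ X3) (p $ X4)"
definition Um where "Um (p :: complex^coord) = mat2 (p $ U1) (p $ U2) (p $ U3) (p $ U4)"

text \<open>Each equation is represented by the quadratic form (left-hand side minus right-hand side)
  whose vanishing it expresses; the matrix equations contribute their four entries.\<close>

definition matrix_eqs :: "(complex^coord \<Rightarrow> complex^2^2) set" where
  "matrix_eqs =
    {\<lambda>p. mat (p $ Xi1) ** theta2 (Xm p) - (Ym p ** Zm p - theta2 (Wm p) ** Vm p),
     \<lambda>p. - (mat (p $ Xi1) ** Um p) - (Wm p ** Ym p + Vm p ** theta2 (Zm p)),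
     \<lambda>p. mat (p $ Xi2) ** theta2 (Ym p) - (Zm p ** Xm p - theta2 (Um p) ** Wm p),
     \<lambda>p. - (mat (p $ Xi2) ** Vm p) - (Um p ** Zm p + Wm p ** theta2 (Xm p)),
     \<lambda>p. mat (p $ Xi3) ** theta2 (Zm p) - (Xm p ** Ym p - theta2 (Vm p) ** Um p),
     \<lambda>p. - (mat (p $ Xi3) ** Wm p) - (Vm p ** Xm p + Um p ** theta2 (Ym p))}"

definition scalar_eqs :: "(complex^coord \<Rightarrow> complex) set" where
  "scalar_eqs =
    {\<lambda>p. (p $ Xi1)\<^sup>2 + det (Zm p) + det (Wm p) + det (Ym p) + det (Vm p),
     \<lambda>p. (p $ Xi2)\<^sup>2 + det (Zm p) + det (Wm p) + det (Xm p) + det (Um p),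
     \<lambda>p. (p $ Xi3)\<^sup>2 + det (Ym p) + det (Vm p) + det (Xm p) + det (Um p)}"

definition XO_eqs :: "(complex^coord \<Rightarrow> complex) set" where
  "XO_eqs = scalar_eqs \<union> {q. \<exists>M\<in>matrix_eqs. \<exists>i j. q = (\<lambda>p. M p $ i $ j)}"

text \<open>For a quadratic form q and distinct coordinates a, b, the number
  q (e_a + e_b) - q (e_a) - q (e_b) is the coefficient of the monomial a b in q
  (for a = b it is twice that coefficient).\<close>

definition monomial_coeff :: "(complex^coord \<Rightarrow> complex) \<Rightarrow> coord \<Rightarrow> coord \<Rightarrow> complex" where
  "monomial_coeff q a b = q (axis a 1 + axis b 1) - q (axis a 1) - q (axis b 1)"

definition partners :: "coord \<Rightarrow> coord set" where
  "partners a = {b. \<exists>q\<in>XO_eqs. monomial_coeff q a b \<noteq> 0}"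

lemma mem_partners_iff:
  "b \<in> partners a \<longleftrightarrow>
     (\<exists>q\<in>scalar_eqs. monomial_coeff q a b \<noteq> 0) \<or>
     (\<exists>M\<in>matrix_eqs. \<exists>i j. monomial_coeff (\<lambda>p. M p $ i $ j) a b \<noteq> 0)"
  unfolding partners_def XO_eqs_def by blast

lemma ex_index_2: "(\<exists>i::2. Q i) \<longleftrightarrow> Q 1 \<or> Q 2"
  by (metis exhaust_2)

lemma mat2_nth [simp]:
  "mat2 p q r s $ 1 $ 1 = p" "mat2 p q r s $ 1 $ 2 = q"
  "mat2 p q r s $ 2 $ 1 = r" "mat2 p q r s $ 2 $ 2 = s"
  by (simp_all add: mat2_def)

lemma matrix_mul_nth_2:
  "((A :: complex^2^2) ** B) $ i $ j = A $ i $ 1 * B $ 1 $ j + A $ i $ 2 * B $ 2 $ j"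
  by (simp add: matrix_matrix_mult_def sum_2)

lemma mat_nth_2:
  "(mat c :: complex^2^2) $ 1 $ 1 = c" "(mat c :: complex^2^2) $ 1 $ 2 = 0"
  "(mat c :: complex^2^2) $ 2 $ 1 = 0" "(mat c :: complex^2^2) $ 2 $ 2 = c"
  by (simp_all add: mat_def)

lemma axis_nth: "axis a (1 :: complex) $ c = (if c = a then 1 else 0)"
  by (simp add: axis_def)

lemma partners_Z1: "partners Z1 = {X1, X2, U1, U3, Y1, Y3, V2, V4, Z4, Xi3}"
proof (rule set_eqI)
  fix b
  have "b \<in> partners Z1 \<longleftrightarrow>
      (\<exists>c\<in>{X1, X2, U1, U3, Y1, Y3, V2, V4, Z4, Xi3}. axis b (1 :: complex) $ c \<noteq> 0)"
    unfolding mem_partners_iff scalar_eqs_def matrix_eqs_def ex_index_2 bex_simps monomial_coeff_def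
    by (simp add: det_2 matrix_mul_nth_2 mat_nth_2 theta2_def axis_nth [where a = Z1]
        Zm_def Wm_def Ym_def Vm_def Xm_def Um_def power2_eq_square algebra_simps) argo
  then show "b \<in> partners Z1 \<longleftrightarrow> b \<in> {X1, X2, U1, U3, Y1, Y3, V2, V4, Z4, Xi3}"
    by (auto simp: axis_nth)
qed

text \<open>The coordinates left on the chart at a when the diagonal coordinate e is the one eliminated
  by means of the trace relation.\<close>

definition chart_coords :: "coord \<Rightarrow> coord \<Rightarrow> coord set" where
  "chart_coords e a = UNIV - partners a - {e}"

lemma chart_coords_Z1:
  "chart_coords Xi1 Z1 = {Xi2, Z1, Z2, Z3, W1, W2, W3, W4, Y2, Y4, V1, V3, X3, X4, U2, U4}"
  unfolding chart_coords_def partners_Z1 UNIV_coord by auto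


section \<open>Holomorphic functions of several variables and complex submanifolds\<close>

definition holo_on :: "(complex^'k \<Rightarrow> complex) \<Rightarrow> (complex^'k) set \<Rightarrow> bool" where
  "holo_on f U \<longleftrightarrow>
    (\<forall>x\<in>U. \<exists>L. (f has_derivative L) (at x) \<and> (\<forall>c v. L (c *s v) = c * L v))"

text \<open>Holomorphic parametrizations, i.e. inverses of holomorphic charts, of a subset M of
  complex n-space with its induced topology.\<close>

definition holo_param ::
  "(complex^'n) set \<Rightarrow> (complex^'k) set \<Rightarrow> (complex^'k \<Rightarrow> complex^'n) \<Rightarrow> bool" where
  "holo_param M U \<phi> \<longleftrightarrow>
     open U \<and> (\<forall>i. holo_on (\<lambda>u. \<phi> u $ i) U) \<and>
     openin (top_of_set M) (\<phi> ` U) \<and> (\<exists>\<psi>. homeomorphism U (\<phi> ` U) \<phi> \<psi>) \<and>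
     (\<forall>u\<in>U. inj (frechet_derivative \<phi> (at u)))"

definition complex_submanifold :: "'k::finite itself \<Rightarrow> (complex^'n) set \<Rightarrow> bool" where
  "complex_submanifold _ M \<longleftrightarrow>
     (\<forall>p\<in>M. \<exists>(U :: (complex^'k) set) \<phi>. holo_param M U \<phi> \<and> p \<in> \<phi> ` U)"

definition holo_chart ::
  "(complex^'n) set \<Rightarrow> (complex^'n) set \<Rightarrow> (complex^'n \<Rightarrow> complex^'k) \<Rightarrow> bool" where
  "holo_chart M N \<psi> \<longleftrightarrow>
     (\<exists>U \<phi>. holo_param M U \<phi> \<and> \<phi> ` U = N \<and> (\<forall>u\<in>U. \<psi> (\<phi> u) = u))"

text \<open>The holomorphic tangent space, as the set of velocities of holomorphic curves.\<close>

definition tangent_space :: "(complex^'n) set \<Rightarrow> complex^'n \<Rightarrow> (complex^'n) set" where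
  "tangent_space M p =
    {w. \<exists>r>0. \<exists>\<gamma>. \<gamma> 0 = p \<and> (\<forall>t\<in>ball 0 r. \<gamma> t \<in> M) \<and>
          (\<forall>i. (\<lambda>t. \<gamma> t $ i) holomorphic_on ball 0 r \<and> deriv (\<lambda>t. \<gamma> t $ i) 0 = w $ i)}"


section \<open>Sections of the canonical bundle\<close>

text \<open>A form of degree CARD('k) takes a family of vectors indexed by 'k. Only its values on
  families of tangent vectors are relevant.\<close>

definition alternating_form :: "(complex^'n) set \<Rightarrow> (('k \<Rightarrow> complex^'n) \<Rightarrow> complex) \<Rightarrow> bool" where
  "alternating_form T \<omega> \<longleftrightarrow>
     (\<forall>v i x y. range v \<subseteq> T \<longrightarrow> x \<in> T \<longrightarrow> y \<in> T \<longrightarrow>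
        \<omega> (v(i := x + y)) = \<omega> (v(i := x)) + \<omega> (v(i := y))) \<and>
     (\<forall>v i x c. range v \<subseteq> T \<longrightarrow> x \<in> T \<longrightarrow> \<omega> (v(i := c *s x)) = c * \<omega> (v(i := x))) \<and>
     (\<forall>v i j. range v \<subseteq> T \<longrightarrow> i \<noteq> j \<longrightarrow> v i = v j \<longrightarrow> \<omega> v = 0)"

text \<open>A holomorphic section of the bundle of holomorphic forms of top degree CARD('k) on a complex
  submanifold M of that dimension: in each local coordinate system u the coefficient of
  du_1 ... du_k is holomorphic.\<close>

definition holo_canonical_section ::
  "(complex^'n) set \<Rightarrow> (complex^'n \<Rightarrow> ('k::finite \<Rightarrow> complex^'n) \<Rightarrow> complex) \<Rightarrow> bool" where
  "holo_canonical_section M \<Omega> \<longleftrightarrow>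
     (\<forall>p\<in>M. alternating_form (tangent_space M p) (\<Omega> p)) \<and>
     (\<forall>(U :: (complex^'k) set) \<phi>. holo_param M U \<phi> \<longrightarrow>
        holo_on (\<lambda>u. \<Omega> (\<phi> u) (\<lambda>j. frechet_derivative \<phi> (at u) (axis j 1))) U)"

definition nowhere_vanishing ::
  "(complex^'n) set \<Rightarrow> (complex^'n \<Rightarrow> ('k \<Rightarrow> complex^'n) \<Rightarrow> complex) \<Rightarrow> bool" where
  "nowhere_vanishing M \<Omega> \<longleftrightarrow>
     (\<forall>p\<in>M. \<exists>v. range v \<subseteq> tangent_space M p \<and> \<Omega> p v \<noteq> 0)"

text \<open>The exterior product of the differentials of the coordinate functions c i, in the order
  of the index i, evaluated on a family v of vectors.\<close>

definition wedge_differentials :: "('k::finite \<Rightarrow> 'n) \<Rightarrow> ('k \<Rightarrow> complex^'n) \<Rightarrow> complex" where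
  "wedge_differentials c v = det ((\<chi> i j. v j $ c i) :: complex^'k^'k)"

end

theory Submission
  imports Defs "HOL-Complex_Analysis.Cauchy_Integral_Formula"
begin

text \<open>
  The geometry behind the proof is that of the 27 lines on a cubic surface. The determinant
  N of the Jordan algebra is a cubic form in the 27 linear coordinates and a signed sum of 45
  monomials; matching coordinates with lines, these monomials are the tritangent planes. Call
  two coordinates adjacent if their product divides a monomial of N, and call the three
  factors of a monomial a triad. Then every coordinate has ten neighbours, two adjacent
  coordinates lie in a unique triad, and a coordinate outside a triad is adjacent to exactly
  one of its members. For the charts and for the comparison of the local forms these facts
  suffice, together with one cubic identity, where the signs of the monomials matter.

  The equations of the manifold. The square of A is \<open>tr(A) A\<close> plus a vector whose entries are,
  up to signs and linear combinations, the 27 partial derivatives of N. Hence A is square-zero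
  and nonzero iff it is a nonzero point of trace 0 on the cone on which all 27 quadrics vanish
  (\<open>XO_iff\<close>).

  The charts. Suppose that \<open>a\<close> is nonzero and let \<open>{a, b, c}\<close> be a triad. The derivative of N
  along \<open>c\<close> is \<open>a b\<close> up to sign plus monomials in coordinates not adjacent to \<open>a\<close>, so it determines
  \<open>b\<close> by the 17 coordinates that are not adjacent to \<open>a\<close>. If these ten quadrics vanish then so
  do the other 17 (\<open>quads_vanish\<close>). The trace relation eliminates one more coordinate, and the
  remaining 16 parametrize the open set where \<open>a\<close> is nonzero (\<open>chart_parametrization\<close>).

  The forms. On the cone, of dimension 17, consider the wedge product of the differentials of
  the 17 coordinates not adjacent to \<open>a\<close>, divided by the fifth power of \<open>a\<close>. For two
  non-adjacent coordinates \<open>a\<close> and \<open>b\<close> the two systems of coordinates have 12 members in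
  common. The five others correspond to each other, and corresponding differentials differ by
  the factor \<open>b / a\<close>, a sign and a combination of the common ones. So the
  two forms agree up to a sign that does not depend on the point (\<open>wedge_transition\<close>); this is
  the origin of the exponent 5. For adjacent \<open>a\<close> and \<open>b\<close>, both nonzero at a point, one of the
  quadrics shows that some coordinate adjacent to neither of them is nonzero at that point as
  well, and one compares via this coordinate (\<open>skew_go_between\<close>). All signs are made equal by
  evaluating the forms at one point of the cone with 27 nonzero coordinates
  (\<open>coherent_orientations\<close>). Contraction with a vector of trace 1 turns the forms of degree 17 into
  the forms of degree 16 of the theorem (\<open>wedge_trace\<close>).

  Holomorphy. In an arbitrary local parametrization the coefficient of the resulting section is
  the inverse fifth power of a coordinate times a determinant of partial derivatives. It is holomorphic since
  the partial derivatives of a complex differentiable function of several variables are again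
  complex differentiable (\<open>holo_on_frechet_derivative\<close>).
\<close>

section \<open>The cubic form and its 27 partial derivatives\<close>

text \<open>An entry \<open>(s, b, c)\<close> in the row of \<open>a\<close> stands for the monomial \<open>s a b c\<close> of the determinant
  N of the Jordan algebra, so that the row of \<open>a\<close> is the partial derivative of N along \<open>a\<close>.\<close>

primrec gradient_terms :: "coord \<Rightarrow> (int \<times> coord \<times> coord) list" where
  "gradient_terms Xi1 = [(1, Xi2, Xi3), (-1, X1, X4), (1, X2, X3), (-1, U1, U4), (1, U2, U3)]"
| "gradient_terms Xi2 = [(1, Xi1, Xi3), (-1, Y1, Y4), (1, Y2, Y3), (-1, V1, V4), (1, V2, V3)]"
| "gradient_terms Xi3 = [(1, Xi1, Xi2), (-1, Z1, Z4), (1, Z2, Z3), (-1, W1, W4), (1, W2, W3)]"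
| "gradient_terms Z1 = [(-1, Xi3, Z4), (1, Y1, X1), (1, Y3, X2), (1, V2, U3), (-1, V4, U1)]"
| "gradient_terms Z2 = [(1, Xi3, Z3), (1, Y1, X3), (1, Y3, X4), (-1, V1, U3), (1, V3, U1)]"
| "gradient_terms Z3 = [(1, Xi3, Z2), (1, Y2, X1), (1, Y4, X2), (1, V2, U4), (-1, V4, U2)]"
| "gradient_terms Z4 = [(-1, Xi3, Z1), (1, Y2, X3), (1, Y4, X4), (-1, V1, U4), (1, V3, U2)]"
| "gradient_terms W1 = [(-1, Xi3, W4), (-1, Y1, U4), (1, Y2, U3), (-1, V3, X2), (-1, V4, X4)]"
| "gradient_terms W2 = [(1, Xi3, W3), (-1, Y3, U4), (1, Y4, U3), (1, V3, X1), (1, V4, X3)]"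
| "gradient_terms W3 = [(1, Xi3, W2), (1, Y1, U2), (-1, Y2, U1), (1, V1, X2), (1, V2, X4)]"
| "gradient_terms W4 = [(-1, Xi3, W1), (1, Y3, U2), (-1, Y4, U1), (-1, V1, X1), (-1, V2, X3)]"
| "gradient_terms Y1 = [(-1, Xi2, Y4), (1, Z1, X1), (1, Z2, X3), (-1, W1, U4), (1, W3, U2)]"
| "gradient_terms Y2 = [(1, Xi2, Y3), (1, Z3, X1), (1, Z4, X3), (1, W1, U3), (-1, W3, U1)]"
| "gradient_terms Y3 = [(1, Xi2, Y2), (1, Z1, X2), (1, Z2, X4), (-1, W2, U4), (1, W4, U2)]"
| "gradient_terms Y4 = [(-1, Xi2, Y1), (1, Z3, X2), (1, Z4, X4), (1, W2, U3), (-1, W4, U1)]"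
| "gradient_terms V1 = [(-1, Xi2, V4), (-1, Z2, U3), (-1, Z4, U4), (1, W3, X2), (-1, W4, X1)]"
| "gradient_terms V2 = [(1, Xi2, V3), (1, Z1, U3), (1, Z3, U4), (1, W3, X4), (-1, W4, X3)]"
| "gradient_terms V3 = [(1, Xi2, V2), (1, Z2, U1), (1, Z4, U2), (-1, W1, X2), (1, W2, X1)]"
| "gradient_terms V4 = [(-1, Xi2, V1), (-1, Z1, U1), (-1, Z3, U2), (-1, W1, X4), (1, W2, X3)]"
| "gradient_terms X1 = [(-1, Xi1, X4), (1, Z1, Y1), (1, Z3, Y2), (1, W2, V3), (-1, W4, V1)]"
| "gradient_terms X2 = [(1, Xi1, X3), (1, Z1, Y3), (1, Z3, Y4), (-1, W1, V3), (1, W3, V1)]"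
| "gradient_terms X3 = [(1, Xi1, X2), (1, Z2, Y1), (1, Z4, Y2), (1, W2, V4), (-1, W4, V2)]"
| "gradient_terms X4 = [(-1, Xi1, X1), (1, Z2, Y3), (1, Z4, Y4), (-1, W1, V4), (1, W3, V2)]"
| "gradient_terms U1 = [(-1, Xi1, U4), (-1, Z1, V4), (1, Z2, V3), (-1, W3, Y2), (-1, W4, Y4)]"
| "gradient_terms U2 = [(1, Xi1, U3), (-1, Z3, V4), (1, Z4, V3), (1, W3, Y1), (1, W4, Y3)]"
| "gradient_terms U3 = [(1, Xi1, U2), (1, Z1, V2), (-1, Z2, V1), (1, W1, Y2), (1, W2, Y4)]"
| "gradient_terms U4 = [(-1, Xi1, U1), (1, Z3, V2), (-1, Z4, V1), (-1, W1, Y1), (-1, W2, Y3)]"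

text \<open>Both orders of every pair of factors are listed, so that a bilinear expression summed over
  this list is symmetric.\<close>

definition cubic_terms :: "coord \<Rightarrow> (int \<times> coord \<times> coord) list" where
  "cubic_terms a = gradient_terms a @ map (\<lambda>(s, b, c). (s, c, b)) (gradient_terms a)"

definition nbrs :: "coord \<Rightarrow> coord list" where
  "nbrs a = map (\<lambda>(s, b, c). b) (cubic_terms a)"

definition coord_list :: "coord list" where
  "coord_list = [Xi1, Xi2, Xi3, Z1, Z2, Z3, Z4, W1, W2, W3, W4, Y1, Y2, Y3, Y4,
           V1, V2, V3, V4, X1, X2, X3, X4, U1, U2, U3, U4]"

lemma set_coord_list: "set coord_list = UNIV"
  by (simp add: coord_list_def UNIV_coord)

lemma distinct_coord_list: "distinct coord_list"
  by (simp add: coord_list_def)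

lemma card_coord: "CARD(coord) = 27"
  using distinct_card[OF distinct_coord_list] by (simp add: set_coord_list) (simp add: coord_list_def)

lemma sum_coord: "(\<Sum>c\<in>UNIV. f c) = (\<Sum>c\<leftarrow>coord_list. f c)"
  by (metis distinct_coord_list set_coord_list sum_list_distinct_conv_sum_set)

definition triad :: "coord \<Rightarrow> coord \<Rightarrow> coord \<Rightarrow> bool" where
  "triad a b c \<longleftrightarrow> (\<exists>s. (s, b, c) \<in> set (cubic_terms a))"

definition cubic_coeff :: "coord \<Rightarrow> coord \<Rightarrow> coord \<Rightarrow> complex" where
  "cubic_coeff a b c = (\<Sum>(s, f, g)\<leftarrow>cubic_terms a. if f = b \<and> g = c then of_int s else 0)"

definition adj :: "coord \<Rightarrow> coord \<Rightarrow> bool" where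
  "adj a b \<longleftrightarrow> (\<exists>c. triad a b c)"

lemma terms_swap:
  assumes "(s, b, c) \<in> set (cubic_terms a)" shows "(s, c, b) \<in> set (cubic_terms a)"
  using assms by (force simp: cubic_terms_def)

text \<open>This is the symmetry of third derivatives: the 27 rows come from a single cubic form.\<close>

lemma terms_rotate:
  assumes "(s, b, c) \<in> set (cubic_terms a)" shows "(s, a, c) \<in> set (cubic_terms b)"
proof -
  have "list_all (\<lambda>a. list_all (\<lambda>(s, b, c). (s, a, c) \<in> set (cubic_terms b)) (cubic_terms a)) coord_list"
    by code_simp
  with assms show ?thesis by (auto simp: list_all_iff set_coord_list)
qed

lemma terms_functional: "distinct (a # map (\<lambda>(s, b, c). b) (cubic_terms a))"
  and terms_sign: "(s, b, c) \<in> set (cubic_terms a) \<Longrightarrow> s = 1 \<or> s = -1"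
proof -
  have *: "list_all (\<lambda>a. distinct (a # map (\<lambda>(s, b, c). b) (cubic_terms a)) \<and>
      list_all (\<lambda>(s, b, c). s = 1 \<or> s = -1) (cubic_terms a)) coord_list"
    by code_simp
  then show "distinct (a # map (\<lambda>(s, b, c). b) (cubic_terms a))"
    by (auto simp: list_all_iff set_coord_list)
  from * show "(s, b, c) \<in> set (cubic_terms a) \<Longrightarrow> s = 1 \<or> s = -1"
    by (fastforce simp: list_all_iff set_coord_list)
qed

lemma triad_swap: "triad a b c \<Longrightarrow> triad a c b"
  and triad_rotate: "triad a b c \<Longrightarrow> triad b a c"
  unfolding triad_def using terms_swap terms_rotate by blast+

lemma adj_iff: "adj a b \<longleftrightarrow> b \<in> set (nbrs a)"
  by (force simp: adj_def triad_def nbrs_def image_iff)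

lemma adj_sym: "adj a b \<Longrightarrow> adj b a"
  unfolding adj_def using triad_rotate by blast

lemma not_adj_self: "\<not> adj a a"
  using terms_functional[of a] by (auto simp: adj_iff nbrs_def)

lemma triad_adj: "triad a b c \<Longrightarrow> adj a b" "triad a b c \<Longrightarrow> adj a c" "triad a b c \<Longrightarrow> adj b c"
  unfolding adj_def using triad_rotate triad_swap by blast+

lemma triad_distinct: "triad a b c \<Longrightarrow> a \<noteq> b \<and> a \<noteq> c \<and> b \<noteq> c"
  using triad_adj not_adj_self by metis

lemma terms_unique:
  assumes "(s, b, c) \<in> set (cubic_terms a)" "(s', b, c') \<in> set (cubic_terms a)"
  shows "s = s' \<and> c = c'"
proof -
  have "inj_on (\<lambda>(s, b, c). b) (set (cubic_terms a))"
    using terms_functional[of a] by (simp add: distinct_map)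
  from inj_onD[OF this _ assms] show ?thesis by simp
qed

lemma triad_unique: "triad a b c \<Longrightarrow> triad a b c' \<Longrightarrow> c = c'"
  unfolding triad_def using terms_unique by blast

lemma distinct_terms: "distinct (cubic_terms a)"
  using terms_functional[of a] by (simp add: distinct_map)

lemma cubic_coeff_eq:
  assumes "(s, b, c) \<in> set (cubic_terms a)" shows "cubic_coeff a b c = of_int s"
proof -
  have "cubic_coeff a b c = (\<Sum>x\<in>set (cubic_terms a). case x of (s, f, g) \<Rightarrow> if f = b \<and> g = c then of_int s else 0)"
    unfolding cubic_coeff_def by (simp add: sum_list_distinct_conv_sum_set distinct_terms)
  also have "\<dots> = (\<Sum>x\<in>set (cubic_terms a). if x = (s, b, c) then of_int s else 0)"
    by (rule sum.cong) (use terms_unique assms in \<open>auto split: prod.splits\<close>)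
  also have "\<dots> = of_int s" using assms by simp
  finally show ?thesis .
qed

lemma cubic_coeff_rotate: "triad a b c \<Longrightarrow> cubic_coeff b a c = cubic_coeff a b c"
  and cubic_coeff_swap: "triad a b c \<Longrightarrow> cubic_coeff a c b = cubic_coeff a b c"
  unfolding triad_def using cubic_coeff_eq terms_swap terms_rotate by metis+

lemma cubic_coeff_square: "triad a b c \<Longrightarrow> cubic_coeff a b c * cubic_coeff a b c = 1"
  unfolding triad_def using cubic_coeff_eq terms_sign by fastforce

lemma card_adj: "card {b. adj a b} = 10"
proof -
  have "{b. adj a b} = set (nbrs a)" by (auto simp: adj_iff)
  moreover have "card (set (nbrs a)) = length (nbrs a)"
    using terms_functional[of a] by (intro distinct_card) (simp add: nbrs_def)
  moreover have "length (nbrs a) = 10"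
    by (cases a) (simp_all add: nbrs_def cubic_terms_def)
  ultimately show ?thesis by simp
qed

lemma card_not_adj: "card {c. \<not> adj a c} = 17"
proof -
  have "{c. \<not> adj a c} = UNIV - {c. adj a c}" by auto
  then show ?thesis using card_Diff_subset[of "{c. adj a c}" UNIV] by (simp add: card_adj card_coord)
qed

text \<open>Two adjacent coordinates have only the third member of their triad as a common neighbour,
  like two intersecting lines on a cubic surface. This is checked on the table.\<close>

lemma adj_triad_nodes:
  assumes "triad a b c"
  shows "set (filter (\<lambda>x. x \<notin> {b, c}) (nbrs a)) \<inter> set (filter (\<lambda>x. x \<notin> {a, c}) (nbrs b)) = {}"
proof -
  have *: "list_all (\<lambda>a. list_all (\<lambda>(s, b, c). distinct (removeAll b (removeAll c (nbrs a)) @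
      removeAll a (removeAll c (nbrs b)))) (cubic_terms a)) coord_list"
    by code_simp
  from assms obtain s where "(s, b, c) \<in> set (cubic_terms a)" by (auto simp: triad_def)
  with * have "distinct (removeAll b (removeAll c (nbrs a)) @ removeAll a (removeAll c (nbrs b)))"
    by (fastforce simp: list_all_iff set_coord_list)
  then show ?thesis by auto
qed

lemma adj_triad_at_most:
  assumes "triad a b c" "h \<noteq> c" "adj h a" "adj h b" shows False
  using adj_triad_nodes[OF assms(1)] assms(2-4) not_adj_self adj_sym
  by (auto simp flip: adj_iff)

text \<open>By the preceding disjointness the members of a triad have \<open>3 * 8\<close> further neighbours, and
  these together with the triad exhaust the 27 coordinates.\<close>

lemma adj_triad_at_least:
  assumes "triad a b c" "h \<noteq> a" "h \<noteq> b" "h \<noteq> c" shows "adj h a \<or> adj h b \<or> adj h c"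
proof -
  define S where "S x = {y. adj x y} - {a, b, c}" for x
  have t: "triad b c a" "triad a c b" using assms(1) triad_rotate triad_swap by blast+
  have d: "a \<noteq> b" "a \<noteq> c" "b \<noteq> c" using triad_distinct[OF assms(1)] by auto
  have "card (S x) = 8" if "x \<in> {a, b, c}" for x
  proof -
    have "adj a b" "adj b a" "adj a c" "adj c a" "adj b c" "adj c b"
      using triad_adj[OF assms(1)] adj_sym by blast+
    then have "{y. adj x y} \<inter> {a, b, c} = {a, b, c} - {x}"
      using that not_adj_self by auto
    moreover have "card ({a, b, c} - {x}) = 2" using that d by auto
    ultimately show ?thesis
      unfolding S_def using card_adj[of x] card_Diff_subset_Int[of "{y. adj x y}" "{a, b, c}"] by simp
  qed
  then have "card (S a) = 8" "card (S b) = 8" "card (S c) = 8" by auto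
  moreover have "S a \<inter> S b = {}" "(S a \<union> S b) \<inter> S c = {}"
    using adj_triad_at_most[OF assms(1)] adj_triad_at_most[OF t(1)] adj_triad_at_most[OF t(2)] adj_sym
    unfolding S_def by blast+
  ultimately have "card (S a \<union> S b \<union> S c) = 24"
    by (simp add: card_Un_disjoint)
  moreover have "S a \<union> S b \<union> S c \<subseteq> UNIV - {a, b, c}" unfolding S_def by auto
  moreover have "card (UNIV - {a, b, c}) = 24" using d by (simp add: card_Diff_subset card_coord)
  ultimately have "S a \<union> S b \<union> S c = UNIV - {a, b, c}" by (metis card_subset_eq finite)
  then have "h \<in> S a \<union> S b \<union> S c" using assms(2-4) by auto
  then show ?thesis using adj_sym by (auto simp: S_def)
qed

text \<open>Up to sign, the entries of the matrix equations are quadrics of the table, and the scalar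
  equations are sums of two of them plus products of diagonal coordinates. So both sides record
  the same products with an off-diagonal factor.\<close>

lemma partners_eq:
  assumes "a \<in> offdiag_coords"
  shows "partners a = {b. adj a b}"
proof -
  have ax: "\<And>c. axis a (1 :: complex) $ c = (if c = a then 1 else 0)" by (simp add: axis_nth)
  have a: "a \<noteq> Xi1" "a \<noteq> Xi2" "a \<noteq> Xi3"
    using assms by (auto simp: offdiag_coords_def diag_coords_def)
  have "b \<in> partners a \<longleftrightarrow> (\<exists>c\<in>set (nbrs a). axis b (1 :: complex) $ c \<noteq> 0)" for b
    using ax a unfolding mem_partners_iff scalar_eqs_def matrix_eqs_def ex_index_2 bex_simps monomial_coeff_def
    by (cases a; simp add: det_2 matrix_mul_nth_2 mat_nth_2 theta2_def nbrs_def cubic_terms_def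
        Zm_def Wm_def Ym_def Vm_def Xm_def Um_def power2_eq_square algebra_simps; argo)
  then show ?thesis by (simp add: axis_nth adj_iff set_eq_iff)
qed

section \<open>The 27 quadrics\<close>

definition polar_form :: "coord \<Rightarrow> complex^coord \<Rightarrow> complex^coord \<Rightarrow> complex" where
  "polar_form a p w = (\<Sum>(s, b, c)\<leftarrow>cubic_terms a. of_int s * p $ b * w $ c)"

definition quad :: "coord \<Rightarrow> complex^coord \<Rightarrow> complex" where
  "quad a p = (\<Sum>(s, b, c)\<leftarrow>gradient_terms a. of_int s * p $ b * p $ c)"

lemma polar_sum: "polar_form a p w = (\<Sum>(b, c) | triad a b c. cubic_coeff a b c * p $ b * w $ c)"
proof -
  have "polar_form a p w = (\<Sum>(s, b, c)\<in>set (cubic_terms a). cubic_coeff a b c * p $ b * w $ c)"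
    unfolding polar_form_def
    by (subst sum_list_distinct_conv_sum_set[OF distinct_terms])
       (auto intro!: sum.cong simp: cubic_coeff_eq)
  also have "\<dots> = (\<Sum>(b, c) | triad a b c. cubic_coeff a b c * p $ b * w $ c)"
  proof -
    have "{(b, c). triad a b c} = snd ` set (cubic_terms a)" by (force simp: triad_def)
    moreover have "inj_on snd (set (cubic_terms a))" by (auto simp: inj_on_def dest: terms_unique)
    ultimately show ?thesis by (simp add: sum.reindex case_prod_unfold)
  qed
  finally show ?thesis .
qed

lemma quad_polar: "quad a p = polar_form a p p / 2"
  unfolding quad_def polar_form_def cubic_terms_def
  by (simp add: o_def case_prod_unfold mult.commute mult.left_commute)

lemma polar_sym: "polar_form a p w = polar_form a w p"
  unfolding polar_form_def cubic_terms_def by (simp add: o_def case_prod_unfold ac_simps)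

text \<open>In terms of the quadratic map \<open>x\<^sup>#\<close> of a cubic Jordan algebra and its polarization this is the
  identity \<open>x\<^sup># \<times> (x \<times> y) = N(x) y + T(x\<^sup>#, y) x\<close>, read off at the coordinate \<open>a\<close>; the last
  sum is \<open>3 N(x)\<close> by Euler's relation.\<close>

lemma cubic_identity:
  "3 * (\<Sum>(s, b, c)\<leftarrow>cubic_terms a. of_int s * quad b x * polar_form c x y) =
   3 * (x $ a * (\<Sum>d\<leftarrow>coord_list. quad d x * y $ d)) + y $ a * (\<Sum>c\<leftarrow>coord_list. x $ c * quad c x)"
  by (induct a; simp add: cubic_terms_def polar_form_def quad_def coord_list_def; algebra)

text \<open>On the left of the cubic identity only quadrics at neighbours of \<open>a\<close> occur. Taking for \<open>y\<close> the
  basis vectors gives first the vanishing of all quadrics except the one at \<open>a\<close>. Then Euler's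
  relation has only one term left, and comparing coefficients gives the last quadric too.\<close>

lemma quads_vanish:
  fixes x :: "complex^coord"
  assumes xa: "x $ a \<noteq> 0" and q: "\<And>b. adj a b \<Longrightarrow> quad b x = 0"
  shows "quad c x = 0"
proof -
  \<comment> \<open>Three times the cubic form, by Euler's relation.\<close>
  define S where "S = (\<Sum>c\<in>UNIV. x $ c * quad c x)"
  have main: "3 * x $ a * quad d x + (if d = a then S else 0) = 0" for d
  proof -
    have "(\<Sum>(s, b, c)\<leftarrow>cubic_terms a. of_int s * quad b x * polar_form c x (axis d 1)) = 0"
      by (subst sum_list_distinct_conv_sum_set[OF distinct_terms], rule sum.neutral)
         (use q in \<open>force simp: adj_iff nbrs_def\<close>)
    with cubic_identity[where a = a and x = x and y = "axis d 1"]
    have "3 * (x $ a * (\<Sum>c\<in>UNIV. quad c x * axis d 1 $ c)) + axis d 1 $ a * S = 0"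
      by (simp flip: sum_coord add: S_def)
    moreover have "(\<Sum>c\<in>UNIV. quad c x * axis d 1 $ c) = quad d x"
      by (simp add: axis_nth if_distrib[of "(*) _"] cong: if_cong)
    ultimately show ?thesis by (auto simp: axis_nth mult.assoc)
  qed
  then have other: "quad d x = 0" if "d \<noteq> a" for d
    using main[of d] xa that by simp
  have "S = x $ a * quad a x"
    unfolding S_def by (subst sum.remove[of _ a]) (auto simp: other)
  with main[of a] xa have "quad a x = 0" by simp
  with other show ?thesis by metis
qed

section \<open>Charts of the cone\<close>

lemma sum_remove_pair:
  fixes f :: "'a \<Rightarrow> 'b::comm_monoid_add"
  assumes "finite S" "u \<in> S" "v \<in> S" "u \<noteq> v"
  shows "sum f S = f u + (f v + sum f (S - {u, v}))"
proof -
  have "S - {u} - {v} = S - {u, v}" by auto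
  then show ?thesis
    using assms sum.remove[of S u f] sum.remove[of "S - {u}" v f] by simp
qed

lemma quad_sum: "quad a p = (\<Sum>(b, c) | triad a b c. cubic_coeff a b c * p $ b * p $ c) / 2"
  by (simp add: quad_polar polar_sum)

text \<open>A quadric is affine in each coordinate; the slope in \<open>b\<close> is, up to the sign of the triad, the
  third coordinate \<open>a\<close>.\<close>

lemma quad_diff:
  fixes x y :: "complex^coord"
  assumes t: "triad a b c" and eq: "\<And>g. adj c g \<Longrightarrow> g \<noteq> b \<Longrightarrow> x $ g = y $ g"
  shows "quad c x - quad c y = cubic_coeff a b c * x $ a * (x $ b - y $ b)"
proof -
  define S where "S = {(f, g). triad c f g} - {(a, b), (b, a)}"
  have ts: "triad c a b" "triad c b a" using t triad_swap triad_rotate by blast+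
  have ccs: "cubic_coeff c a b = cubic_coeff a b c" "cubic_coeff c b a = cubic_coeff a b c"
    using t ts by (metis cubic_coeff_rotate cubic_coeff_swap)+
  have ne: "a \<noteq> b" using triad_distinct[OF t] by simp
  have q: "quad c p = cubic_coeff a b c * p $ a * p $ b +
      (\<Sum>(f, g)\<in>S. cubic_coeff c f g * p $ f * p $ g) / 2" for p :: "complex^coord"
    unfolding quad_sum S_def
    by (subst sum_remove_pair[where u = "(a, b)" and v = "(b, a)"]) (use ts ne in \<open>auto simp: ccs field_simps\<close>)
  have "(\<Sum>(f, g)\<in>S. cubic_coeff c f g * x $ f * x $ g) = (\<Sum>(f, g)\<in>S. cubic_coeff c f g * y $ f * y $ g)"
  proof (rule sum.cong)
    fix z assume "z \<in> S"
    then obtain f g where z: "z = (f, g)" "triad c f g" "(f, g) \<noteq> (a, b)" "(f, g) \<noteq> (b, a)"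
      by (auto simp: S_def)
    with ts have "f \<noteq> b" "g \<noteq> b" using triad_unique triad_swap by blast+
    with z eq triad_adj have "x $ f = y $ f" "x $ g = y $ g" by metis+
    with z show "(case z of (f, g) \<Rightarrow> cubic_coeff c f g * x $ f * x $ g) =
        (case z of (f, g) \<Rightarrow> cubic_coeff c f g * y $ f * y $ g)"
      by simp
  qed simp
  moreover have "x $ a = y $ a"
    using eq[of a] ne triad_adj[OF ts(1)] by simp
  ultimately show ?thesis by (simp add: q algebra_simps)
qed

text \<open>The quadric at \<open>c\<close> can thus be solved for \<open>b\<close>: its remaining variables are not adjacent to
  \<open>a\<close>.\<close>

lemma not_adj_if_same_quad:
  assumes "triad a b c" "adj c g" "g \<noteq> b" shows "\<not> adj a g"
  using assms adj_triad_at_most[of a c b g] triad_swap adj_sym by blast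

text \<open>Each coordinate \<open>b\<close> adjacent to \<open>a\<close> is changed such that the quadric at the third member \<open>c\<close> of
  its triad vanishes; for all other \<open>b\<close> the sum is empty.\<close>

definition cone_retract :: "coord \<Rightarrow> complex^coord \<Rightarrow> complex^coord" where
  "cone_retract a x = (\<chi> b. x $ b - (\<Sum>c | triad a b c. cubic_coeff a b c * quad c x) / x $ a)"

lemma cone_retract_not_adj: "\<not> adj a b \<Longrightarrow> cone_retract a x $ b = x $ b"
proof -
  assume "\<not> adj a b"
  then have "(\<Sum>c | triad a b c. cubic_coeff a b c * quad c x) = 0"
    by (intro sum.neutral) (simp add: adj_def)
  then show ?thesis by (simp add: cone_retract_def)
qed

lemma cone_retract_triad:
  assumes "triad a b c" shows "cone_retract a x $ b = x $ b - cubic_coeff a b c * quad c x / x $ a"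
proof -
  have "{c. triad a b c} = {c}" using assms triad_unique by auto
  then show ?thesis by (simp add: cone_retract_def)
qed

lemma cone_retract_id: "(\<And>c. quad c x = 0) \<Longrightarrow> cone_retract a x = x"
  by (simp add: cone_retract_def vec_eq_iff)

lemma quad_cone_retract:
  assumes "x $ a \<noteq> 0" shows "quad c (cone_retract a x) = 0"
proof (rule quads_vanish)
  show "cone_retract a x $ a \<noteq> 0" using assms by (simp add: cone_retract_not_adj not_adj_self)
  fix c assume "adj a c"
  then obtain b where t: "triad a b c" using adj_def triad_swap by blast
  have "quad c (cone_retract a x) - quad c x = cubic_coeff a b c * cone_retract a x $ a * (cone_retract a x $ b - x $ b)"
    by (rule quad_diff[OF t]) (use not_adj_if_same_quad[OF t] in \<open>simp add: cone_retract_not_adj\<close>)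
  also have "\<dots> = - (cubic_coeff a b c * cubic_coeff a b c * quad c x)"
    using assms by (simp add: cone_retract_triad[OF t] cone_retract_not_adj not_adj_self)
  finally show "quad c (cone_retract a x) = 0" by (simp add: cubic_coeff_square[OF t])
qed

lemma cone_retract_cong_at:
  assumes t: "triad a b c" and x: "x $ a \<noteq> 0" and eq: "\<And>g. adj c g \<Longrightarrow> g \<noteq> b \<Longrightarrow> x $ g = y $ g"
  shows "cone_retract a x $ b = cone_retract a y $ b"
proof -
  have "x $ a = y $ a" using eq[of a] t triad_adj adj_sym triad_distinct by metis
  moreover have "quad c x = quad c y + cubic_coeff a b c * x $ a * (x $ b - y $ b)"
    using quad_diff[OF t eq] by (simp add: algebra_simps)
  ultimately have "cone_retract a x $ b =
      x $ b - cubic_coeff a b c * (quad c y + cubic_coeff a b c * x $ a * (x $ b - y $ b)) / x $ a"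
    "cone_retract a y $ b = y $ b - cubic_coeff a b c * quad c y / x $ a"
    by (simp_all only: cone_retract_triad[OF t])
  moreover have "cubic_coeff a b c * (quad c y + cubic_coeff a b c * x $ a * (x $ b - y $ b)) / x $ a =
      cubic_coeff a b c * quad c y / x $ a + (cubic_coeff a b c * cubic_coeff a b c) * (x $ b - y $ b)"
    using x by (simp add: field_simps)
  ultimately show ?thesis by (simp add: cubic_coeff_square[OF t])
qed

lemma cone_retract_cong:
  assumes x: "x $ a \<noteq> 0" and eq: "\<And>g. \<not> adj a g \<Longrightarrow> x $ g = y $ g"
  shows "cone_retract a x = cone_retract a y"
proof -
  have "cone_retract a x $ b = cone_retract a y $ b" for b
  proof (cases "adj a b")
    case True
    then obtain c where t: "triad a b c" by (auto simp: adj_def)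
    show ?thesis by (rule cone_retract_cong_at[OF t x]) (use not_adj_if_same_quad[OF t] eq in blast)
  qed (simp add: cone_retract_not_adj eq)
  then show ?thesis by (simp add: vec_eq_iff)
qed

section \<open>The trace relation\<close>

definition trace3 :: "complex^coord \<Rightarrow> complex" where
  "trace3 p = (\<Sum>d\<in>diag_coords. p $ d)"

lemma diag_triad: "triad Xi1 Xi2 Xi3"
  by (force simp: triad_def cubic_terms_def)

text \<open>The three diagonal coordinates form a triad. So an off-diagonal coordinate is adjacent to
  exactly one of them, and either of the two others may be eliminated.\<close>

lemma diag_split:
  assumes "a \<in> offdiag_coords" "e \<in> diag_coords" "\<not> adj a e"
  obtains d m where "diag_coords = {e, d, m}" "triad e d m" "adj a m" "\<not> adj a d"
proof -
  have t: "triad Xi1 Xi2 Xi3" "triad Xi1 Xi3 Xi2" "triad Xi2 Xi1 Xi3" "triad Xi2 Xi3 Xi1"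
    "triad Xi3 Xi1 Xi2" "triad Xi3 Xi2 Xi1"
    using diag_triad triad_rotate triad_swap by blast+
  have a: "a \<notin> {Xi1, Xi2, Xi3}" using assms(1) by (simp add: offdiag_coords_def diag_coords_def)
  have "\<exists>d m. diag_coords = {e, d, m} \<and> triad e d m \<and> adj a m"
    using assms(2,3) adj_triad_at_least[OF diag_triad, of a] a t
    by (auto simp: diag_coords_def insert_commute)
  then obtain d m where dm: "diag_coords = {e, d, m}" "triad e d m" "adj a m" by blast
  moreover have "\<not> adj a d"
    using adj_triad_at_most[of d m e a] dm a triad_rotate triad_swap assms(2)
    by (metis diag_coords_def)
  ultimately show ?thesis using that by blast
qed

text \<open>The eliminated coordinate \<open>e\<close> does not enter the formulas for the other two diagonal
  coordinates. Hence the trace relation can be solved for \<open>e\<close> explicitly.\<close>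

lemma cone_retract_diag_cong:
  assumes ae: "a \<in> offdiag_coords" "e \<in> diag_coords" "\<not> adj a e" and d: "d \<in> diag_coords - {e}"
    and x: "x $ a \<noteq> 0" and eq: "\<And>g. \<not> adj a g \<Longrightarrow> g \<noteq> e \<Longrightarrow> x $ g = y $ g"
  shows "cone_retract a x $ d = cone_retract a y $ d"
proof -
  obtain d' m where dm: "diag_coords = {e, d', m}" "triad e d' m" "adj a m" "\<not> adj a d'"
    using diag_split[OF ae] .
  show ?thesis
  proof (cases "d = m")
    case False
    then have "d = d'" "d' \<noteq> e" using d dm by auto
    then show ?thesis using dm by (simp add: cone_retract_not_adj eq)
  next
    case True
    obtain c where t: "triad a m c" using dm by (auto simp: adj_def)
    have "\<not> adj c e"
    proof
      assume "adj c e"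
      moreover have "adj m e" using triad_adj[OF dm(2)] adj_sym by blast
      moreover have "triad m c a" using t triad_rotate triad_swap by blast
      ultimately show False
        using adj_triad_at_most[of m c a e] adj_sym ae by (auto simp: offdiag_coords_def)
    qed
    then show ?thesis unfolding True
      by (intro cone_retract_cong_at[OF t x]) (use not_adj_if_same_quad[OF t] eq in blast)
  qed
qed

text \<open>The first retraction supplies the values of the two other diagonal coordinates; they do not
  change when \<open>e\<close> is then adjusted such that the trace vanishes.\<close>

definition XO_retract :: "coord \<Rightarrow> coord \<Rightarrow> complex^coord \<Rightarrow> complex^coord" where
  "XO_retract a e x = cone_retract a
    (\<chi> b. if b = e then - (\<Sum>d\<in>diag_coords - {e}. cone_retract a x $ d) else x $ b)"

context
  fixes a e :: coord
  assumes ae: "a \<in> offdiag_coords" "e \<in> diag_coords" "\<not> adj a e"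
begin

lemma XO_retract_nth: "\<not> adj a b \<Longrightarrow> b \<noteq> e \<Longrightarrow> XO_retract a e x $ b = x $ b"
  by (simp add: XO_retract_def cone_retract_not_adj)

lemma quad_XO_retract: "x $ a \<noteq> 0 \<Longrightarrow> quad c (XO_retract a e x) = 0"
  unfolding XO_retract_def using ae by (intro quad_cone_retract) (auto simp: offdiag_coords_def)

lemma trace_XO_retract:
  assumes "x $ a \<noteq> 0" shows "trace3 (XO_retract a e x) = 0"
proof -
  define y where "y = (\<chi> b. if b = e then - (\<Sum>d\<in>diag_coords - {e}. cone_retract a x $ d) else x $ b)"
  have "cone_retract a y $ d = cone_retract a x $ d" if "d \<in> diag_coords - {e}" for d
    by (rule cone_retract_diag_cong[OF ae that]) (use assms ae in \<open>auto simp: y_def offdiag_coords_def\<close>)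
  moreover have "cone_retract a y $ e = - (\<Sum>d\<in>diag_coords - {e}. cone_retract a x $ d)"
    using ae by (simp add: cone_retract_not_adj) (simp add: y_def)
  ultimately show ?thesis
    unfolding trace3_def XO_retract_def y_def[symmetric]
    by (subst sum.remove[of _ e]) (use ae in auto)
qed

lemma XO_retract_id:
  assumes "\<And>c. quad c p = 0" "trace3 p = 0" shows "XO_retract a e p = p"
proof -
  have "p $ e + (\<Sum>d\<in>diag_coords - {e}. p $ d) = 0"
    using assms(2) ae sum.remove[of diag_coords e "\<lambda>d. p $ d"] by (simp add: trace3_def)
  then have "(\<chi> b. if b = e then - (\<Sum>d\<in>diag_coords - {e}. p $ d) else p $ b) = p"
    by (auto simp: vec_eq_iff eq_neg_iff_add_eq_0 add.commute intro: sym)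
  moreover have "cone_retract a p = p" by (rule cone_retract_id) (rule assms(1))
  ultimately show ?thesis by (simp only: XO_retract_def)
qed

lemma XO_retract_cong:
  assumes x: "x $ a \<noteq> 0" and eq: "\<And>g. \<not> adj a g \<Longrightarrow> g \<noteq> e \<Longrightarrow> x $ g = y $ g"
  shows "XO_retract a e x = XO_retract a e y"
  unfolding XO_retract_def
proof (rule cone_retract_cong)
  show "(\<chi> b. if b = e then - (\<Sum>d\<in>diag_coords - {e}. cone_retract a x $ d) else x $ b) $ a \<noteq> 0"
    using x ae by (auto simp: offdiag_coords_def)
  have "(\<Sum>d\<in>diag_coords - {e}. cone_retract a x $ d) = (\<Sum>d\<in>diag_coords - {e}. cone_retract a y $ d)"
    by (rule sum.cong) (use cone_retract_diag_cong[OF ae _ x eq] in auto)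
  then show "(\<chi> b. if b = e then - (\<Sum>d\<in>diag_coords - {e}. cone_retract a x $ d) else x $ b) $ g =
    (\<chi> b. if b = e then - (\<Sum>d\<in>diag_coords - {e}. cone_retract a y $ d) else y $ b) $ g"
    if "\<not> adj a g" for g using eq that by simp
qed

end

section \<open>Square-zero elements and the quadrics\<close>

lemma qmul_entries:
  "qmul (quat_of_entries p q r s) (quat_of_entries p' q' r' s') =
   quat_of_entries (p * p' + q * r') (p * q' + q * s') (r * p' + s * r') (r * q' + s * s')"
  (is "?l = ?r")
proof -
  have "quat_mat ?l = quat_mat ?r"
    by (simp add: quat_mat_mul quat_mat_of_entries vec_eq_iff forall_2 matrix_mul_nth_2)
  then show ?thesis by (metis quat_of_entries_mat)
qed

lemma qconj_entries: "qconj (quat_of_entries p q r s) = quat_of_entries s (- q) (- r) p"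
  by (simp add: quat_of_entries_def field_simps)

lemma entries_arith:
  "quat_of_entries p q r s + quat_of_entries p' q' r' s' = quat_of_entries (p + p') (q + q') (r + r') (s + s')"
  "quat_of_entries p q r s - quat_of_entries p' q' r' s' = quat_of_entries (p - p') (q - q') (r - r') (s - s')"
  "- quat_of_entries p q r s = quat_of_entries (- p) (- q) (- r) (- s)"
  "ocplx c = (quat_of_entries c 0 0 c, quat_of_entries 0 0 0 0)"
  by (simp_all add: quat_of_entries_def ocplx_def field_simps)

text \<open>The square of A minus \<open>tr(A) A\<close>, in coordinates. It is the adjoint of A up to a multiple of
  the identity matrix.\<close>

definition sharp :: "complex^coord \<Rightarrow> complex^coord" where
  "sharp p = (\<chi> c. case c of
      Xi1 \<Rightarrow> - quad Xi2 p - quad Xi3 p | Xi2 \<Rightarrow> - quad Xi1 p - quad Xi3 p | Xi3 \<Rightarrow> - quad Xi1 p - quad Xi2 p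
    | Z1 \<Rightarrow> quad Z4 p | Z2 \<Rightarrow> - quad Z3 p | Z3 \<Rightarrow> - quad Z2 p | Z4 \<Rightarrow> quad Z1 p
    | W1 \<Rightarrow> quad W4 p | W2 \<Rightarrow> - quad W3 p | W3 \<Rightarrow> - quad W2 p | W4 \<Rightarrow> quad W1 p
    | Y1 \<Rightarrow> quad Y4 p | Y2 \<Rightarrow> - quad Y3 p | Y3 \<Rightarrow> - quad Y2 p | Y4 \<Rightarrow> quad Y1 p
    | V1 \<Rightarrow> quad V4 p | V2 \<Rightarrow> - quad V3 p | V3 \<Rightarrow> - quad V2 p | V4 \<Rightarrow> quad V1 p
    | X1 \<Rightarrow> quad X4 p | X2 \<Rightarrow> - quad X3 p | X3 \<Rightarrow> - quad X2 p | X4 \<Rightarrow> quad X1 p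
    | U1 \<Rightarrow> quad U4 p | U2 \<Rightarrow> - quad U3 p | U3 \<Rightarrow> - quad U2 p | U4 \<Rightarrow> quad U1 p)"

lemma trace3_eq: "trace3 p = p $ Xi1 + p $ Xi2 + p $ Xi3"
  by (simp add: trace3_def diag_coords_def)

lemma jmat_nth:
  "jmat a b c x y z $ 1 $ 1 = ocplx a" "jmat a b c x y z $ 1 $ 2 = z" "jmat a b c x y z $ 1 $ 3 = oconj y"
  "jmat a b c x y z $ 2 $ 1 = oconj z" "jmat a b c x y z $ 2 $ 2 = ocplx b" "jmat a b c x y z $ 2 $ 3 = x"
  "jmat a b c x y z $ 3 $ 1 = y" "jmat a b c x y z $ 3 $ 2 = oconj x" "jmat a b c x y z $ 3 $ 3 = ocplx c"
  by (simp_all add: jmat_def)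

lemma jordan_square: "omat_mul (jordan p) (jordan p) = jordan (trace3 p *s p + sharp p)"
proof -
  have eqI: "A = B \<longleftrightarrow>
      (A $ 1 $ 1 = B $ 1 $ 1 \<and> A $ 1 $ 2 = B $ 1 $ 2 \<and> A $ 1 $ 3 = B $ 1 $ 3) \<and>
      (A $ 2 $ 1 = B $ 2 $ 1 \<and> A $ 2 $ 2 = B $ 2 $ 2 \<and> A $ 2 $ 3 = B $ 2 $ 3) \<and>
      (A $ 3 $ 1 = B $ 3 $ 1 \<and> A $ 3 $ 2 = B $ 3 $ 2 \<and> A $ 3 $ 3 = B $ 3 $ 3)" for A B :: "coct^3^3"
    by (simp only: vec_eq_iff forall_3)
  show ?thesis
    unfolding eqI
    apply (simp add: omat_mul_def jordan_def jmat_nth sum_3 entries_arith qmul_entries qconj_entries quat_of_entries_inject)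
    apply (simp add: sharp_def trace3_eq quad_def)
    apply (intro conjI; algebra)
    done
qed

lemma jordan_eq_0_iff: "jordan p = 0 \<longleftrightarrow> p = 0"
proof -
  have "jordan 0 = 0"
    unfolding vec_eq_iff[where x = "jordan 0"] vec_eq_iff[where ?'b = 3] forall_3
    by (simp add: jordan_def jmat_nth ocplx_def quat_of_entries_def zero_prod_def)
  moreover have "inj jordan" using bij_betw_jordan by (simp add: bij_betw_def)
  ultimately show ?thesis using inj_eq[of jordan p 0] by simp
qed

text \<open>The trace form pairs each off-diagonal coordinate with another one, up to sign; this is the
  polarization of the determinant of 2x2 matrices.\<close>

definition dual_coord :: "coord \<Rightarrow> coord" where
  "dual_coord a = (case a of Xi1 \<Rightarrow> Xi1 | Xi2 \<Rightarrow> Xi2 | Xi3 \<Rightarrow> Xi3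
    | Z1 \<Rightarrow> Z4 | Z2 \<Rightarrow> Z3 | Z3 \<Rightarrow> Z2 | Z4 \<Rightarrow> Z1 | W1 \<Rightarrow> W4 | W2 \<Rightarrow> W3 | W3 \<Rightarrow> W2 | W4 \<Rightarrow> W1
    | Y1 \<Rightarrow> Y4 | Y2 \<Rightarrow> Y3 | Y3 \<Rightarrow> Y2 | Y4 \<Rightarrow> Y1 | V1 \<Rightarrow> V4 | V2 \<Rightarrow> V3 | V3 \<Rightarrow> V2 | V4 \<Rightarrow> V1
    | X1 \<Rightarrow> X4 | X2 \<Rightarrow> X3 | X3 \<Rightarrow> X2 | X4 \<Rightarrow> X1 | U1 \<Rightarrow> U4 | U2 \<Rightarrow> U3 | U3 \<Rightarrow> U2 | U4 \<Rightarrow> U1)"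

definition dual_sign :: "coord \<Rightarrow> complex" where
  "dual_sign a = (if a \<in> {Z2, Z3, W2, W3, Y2, Y3, V2, V3, X2, X3, U2, U3} then - 1 else 1)"

lemma dual_coord_involution: "dual_coord (dual_coord a) = a"
  by (cases a) (simp_all add: dual_coord_def)

lemma dual_coord_offdiag: "a \<in> offdiag_coords \<Longrightarrow> dual_coord a \<in> offdiag_coords"
  by (cases a) (simp_all add: dual_coord_def offdiag_coords_def diag_coords_def)

lemma sharp_offdiag: "a \<in> offdiag_coords \<Longrightarrow> sharp p $ a = dual_sign a * quad (dual_coord a) p"
  by (cases a) (simp_all add: dual_coord_def dual_sign_def offdiag_coords_def diag_coords_def sharp_def)

text \<open>These are the off-diagonal entries of the Cayley-Hamilton identity: the Jordan product of A
  with its adjoint is a multiple of the identity matrix.\<close>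

lemma sharp_identity:
  assumes "a \<in> offdiag_coords"
  shows "trace3 p * sharp p $ a + dual_sign a * polar_form (dual_coord a) p (sharp p) = 0"
proof -
  have "a \<notin> {Xi1, Xi2, Xi3} \<longrightarrow>
      trace3 p * sharp p $ a + dual_sign a * polar_form (dual_coord a) p (sharp p) = 0"
    unfolding dual_sign_def dual_coord_def
    by (induct a; simp add: sharp_def polar_form_def cubic_terms_def trace3_eq quad_def; algebra)
  with assms show ?thesis by (simp add: offdiag_coords_def diag_coords_def)
qed

lemma polar_scale_right: "polar_form c p (k *s w) = k * polar_form c p w"
  by (simp add: polar_sum sum_distrib_left case_prod_unfold mult_ac)

text \<open>The point is that a square-zero element has trace 0. If the square vanishes then \<open>sharp p\<close> is
  \<open>- t p\<close> for the trace \<open>t\<close>. Inserting this into the preceding identity gives \<open>t\<^sup>2 p = 0\<close> in each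
  off-diagonal coordinate. If \<open>t\<close> were nonzero then A would be a diagonal matrix with square 0.\<close>

lemma XO_iff: "p \<in> XO \<longleftrightarrow> p \<noteq> 0 \<and> trace3 p = 0 \<and> (\<forall>c. quad c p = 0)"
proof -
  have "p \<in> XO \<longleftrightarrow> p \<noteq> 0 \<and> trace3 p *s p + sharp p = 0"
    using bij_betw_jordan by (auto simp: XO_def jordan_square jordan_eq_0_iff bij_betw_def)
  also have "\<dots> \<longleftrightarrow> p \<noteq> 0 \<and> trace3 p = 0 \<and> (\<forall>c. quad c p = 0)"
  proof (intro conj_cong refl iffI conjI allI)
    assume "p \<noteq> 0" and 0: "trace3 p *s p + sharp p = 0"
    define t where "t = trace3 p"
    have sharp: "sharp p $ c = - t * p $ c" for c
      using arg_cong[OF 0, of "\<lambda>v. v $ c"] by (simp add: t_def eq_neg_iff_add_eq_0 add.commute)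
    have qd: "t * p $ Xi1 = quad Xi2 p + quad Xi3 p" "t * p $ Xi2 = quad Xi1 p + quad Xi3 p"
      "t * p $ Xi3 = quad Xi1 p + quad Xi2 p"
      using sharp[of Xi1] sharp[of Xi2] sharp[of Xi3]
      by (simp_all add: sharp_def algebra_simps add_eq_0_iff2 neg_equal_iff_equal flip: minus_add_distrib)
    have t: "t = p $ Xi1 + p $ Xi2 + p $ Xi3" by (simp add: t_def trace3_eq)
    have off: "t * t * p $ a = 0" if a: "a \<in> offdiag_coords" for a
    proof -
      have "sharp p = (- t) *s p" using sharp by (simp add: vec_eq_iff)
      then have "polar_form (dual_coord a) p (sharp p) = - t * (2 * quad (dual_coord a) p)"
        by (simp only: polar_scale_right) (simp add: quad_polar)
      with sharp_offdiag[OF a, of p] sharp_identity[OF a, of p] sharp[of a] show ?thesis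
        unfolding t_def[symmetric] by algebra
    qed
    have "t = 0"
    proof (rule ccontr)
      assume "t \<noteq> 0"
      with off have z: "p $ a = 0" if "a \<notin> {Xi1, Xi2, Xi3}" for a
        using that by (simp add: offdiag_coords_def diag_coords_def)
      have "p $ Xi1 = 0" "p $ Xi2 = 0" "p $ Xi3 = 0"
        using qd t by (simp_all add: quad_def z) algebra+
      with t \<open>t \<noteq> 0\<close> show False by simp
    qed
    then show "trace3 p = 0" by (simp add: t_def)
    have "quad Xi1 p = 0 \<and> quad Xi2 p = 0 \<and> quad Xi3 p = 0"
      using qd \<open>t = 0\<close> by (simp add: add_eq_0_iff2)
    moreover have "quad c p = 0" if c: "c \<in> offdiag_coords" for c
      using sharp_offdiag[OF dual_coord_offdiag[OF c], of p] sharp[of "dual_coord c"] \<open>t = 0\<close>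
      by (auto simp: dual_coord_involution dual_sign_def split: if_splits)
    ultimately show "quad c p = 0" for c
      by (cases "c \<in> {Xi1, Xi2, Xi3}") (auto simp: offdiag_coords_def diag_coords_def)
  next
    assume "trace3 p = 0 \<and> (\<forall>c. quad c p = 0)"
    then have "(trace3 p *s p + sharp p) $ c = 0" for c
      by (cases c) (simp_all add: sharp_def)
    then show "trace3 p *s p + sharp p = 0" by (simp add: vec_eq_iff)
  qed
  finally show ?thesis .
qed

section \<open>Determinants\<close>

text \<open>This covers two kinds of changes: a base change that is triangular with respect to the rows
  outside \<open>I\<close>, and a single row operation.\<close>

lemma det_rows_replace:
  fixes F G :: "'k::finite \<Rightarrow> complex^'k"
  assumes inI: "\<And>i. i \<in> I \<Longrightarrow> G i - \<kappa> i *s F i \<in> vec.span (F ` (- I))"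
    and outI: "\<And>i. i \<notin> I \<Longrightarrow> G i = F i"
  shows "det (\<chi> i. G i) = (\<Prod>i\<in>I. \<kappa> i) * det (\<chi> i. F i)"
proof -
  have "det (\<chi> i. if i \<in> J then G i else F i) = (\<Prod>i\<in>J. \<kappa> i) * det (\<chi> i. F i)" if "J \<subseteq> I" for J
    using finite[of J] that
  proof (induction J rule: finite_induct)
    case empty
    then show ?case by simp
  next
    case (insert k J)
    define E where "E i = (if i \<in> J then G i else F i)" for i
    define m where "m = G k - \<kappa> k *s F k"
    have kI: "k \<in> I" using insert.prems by simp
    have EF: "E j = F j" if "j \<notin> I" for j using that outI by (simp add: E_def)
    define A where "A = (\<chi> i. if i = k then \<kappa> k *s F k else E i)"
    have "(\<chi> i. if i \<in> insert k J then G i else F i) =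
        (\<chi> i. if i = k then row k A + m else row i A)"
      by (auto simp: vec_eq_iff A_def E_def row_def m_def)
    moreover have "m \<in> vec.span {row j A | j. j \<noteq> k}"
    proof -
      have "F ` (- I) \<subseteq> {row j A | j. j \<noteq> k}"
      proof
        fix x assume "x \<in> F ` (- I)"
        then obtain j where "j \<notin> I" "x = F j" by blast
        then have "x = row j A" "j \<noteq> k" using EF kI by (auto simp: A_def row_def vec_eq_iff)
        then show "x \<in> {row j A | j. j \<noteq> k}" by blast
      qed
      moreover have "m \<in> vec.span (F ` (- I))" unfolding m_def using inI insert.prems by blast
      ultimately show ?thesis using vec.span_mono by blast
    qed
    ultimately have "det (\<chi> i. if i \<in> insert k J then G i else F i) = det A"
      by (simp add: det_row_span)
    also have "\<dots> = \<kappa> k * det (\<chi> i. if i = k then F k else E i)"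
      unfolding A_def by (rule det_row_mul)
    also have "(\<chi> i. if i = k then F k else E i) = (\<chi> i. if i \<in> J then G i else F i)"
      using insert.hyps by (auto simp: vec_eq_iff E_def)
    finally show ?case using insert by simp
  qed
  from this[of I] have "det (\<chi> i. if i \<in> I then G i else F i) = (\<Prod>i\<in>I. \<kappa> i) * det (\<chi> i. F i)" by simp
  moreover have "(\<chi> i. if i \<in> I then G i else F i) = (\<chi> i. G i)" using outI by (simp add: vec_eq_iff)
  ultimately show ?thesis by simp
qed

text \<open>Laplace expansion along a row with a single nonzero entry. The index type \<open>'k option\<close> serves to
  add one more coordinate to a chart.\<close>

lemma det_option:
  fixes A :: "complex^('k::finite option)^('k option)"
  assumes "\<And>j. A $ None $ Some j = 0"
  shows "det A = A $ None $ None * det (\<chi> i j. A $ Some i $ Some j)"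
proof -
  define \<Phi> where "\<Phi> p = map_option p" for p :: "'k \<Rightarrow> 'k"
  have perm_fix: "p None = None" if "p permutes UNIV" "(\<Prod>i\<in>UNIV. A $ i $ p i) \<noteq> 0" for p
  proof (rule ccontr)
    assume "p None \<noteq> None"
    then have "A $ None $ p None = 0" using assms by (cases "p None") auto
    then have "(\<Prod>i\<in>UNIV. A $ i $ p i) = 0" by (intro prod_zero) auto
    with that show False by simp
  qed
  have "det A = (\<Sum>p | p permutes UNIV. of_int (sign p) * (\<Prod>i\<in>UNIV. A $ i $ p i))"
    by (simp add: det_def)
  also have "\<dots> = (\<Sum>p | p permutes UNIV \<and> p None = None. of_int (sign p) * (\<Prod>i\<in>UNIV. A $ i $ p i))"
    by (rule sum.mono_neutral_right) (use perm_fix in \<open>auto simp: finite_permutations\<close>)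
  also have "\<dots> = (\<Sum>p | p permutes UNIV. of_int (sign (\<Phi> p)) * (\<Prod>i\<in>UNIV. A $ i $ \<Phi> p i))"
  proof (rule sum.reindex_bij_witness[of _ \<Phi> "\<lambda>p. the \<circ> p \<circ> Some"])
    fix q assume "q \<in> {p. p permutes (UNIV :: 'k option set) \<and> p None = None}"
    then have q: "bij q" "q None = None" by (auto simp: permutes_bij)
    have qs: "q (Some x) \<noteq> None" for x
      using q bij_is_inj[OF q(1)] by (metis injD option.distinct(1))
    show eq: "\<Phi> (the \<circ> q \<circ> Some) = q"
    proof
      fix x show "\<Phi> (the \<circ> q \<circ> Some) x = q x"
        using q qs by (cases x) (auto simp: \<Phi>_def)
    qed
    have "inj (the \<circ> q \<circ> Some)"
    proof (rule injI)
      fix x y assume "(the \<circ> q \<circ> Some) x = (the \<circ> q \<circ> Some) y"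
      then have "q (Some x) = q (Some y)"
        using qs[of x] qs[of y] by (cases "q (Some x)"; cases "q (Some y)") auto
      then show "x = y" using injD[OF bij_is_inj[OF q(1)]] by fastforce
    qed
    then show "the \<circ> q \<circ> Some \<in> {p. p permutes UNIV}"
      by (auto intro!: inj_imp_permutes)
    show "of_int (sign (\<Phi> (the \<circ> q \<circ> Some))) * (\<Prod>i\<in>UNIV. A $ i $ \<Phi> (the \<circ> q \<circ> Some) i) =
       of_int (sign q) * (\<Prod>i\<in>UNIV. A $ i $ q i)" by (simp only: eq)
  next
    fix p assume "p \<in> {p. p permutes (UNIV :: 'k set)}"
    then have "inj p" by (auto simp: permutes_bij bij_is_inj)
    then have "inj (\<Phi> p)" unfolding \<Phi>_def by (rule option.inj_map)
    then show "\<Phi> p \<in> {p. p permutes UNIV \<and> p None = None}"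
      by (auto intro!: inj_imp_permutes) (simp add: \<Phi>_def)
    show "the \<circ> \<Phi> p \<circ> Some = p" by (auto simp: \<Phi>_def)
  qed
  also have "\<dots> = (\<Sum>p | p permutes UNIV. A $ None $ None * (of_int (sign p) * (\<Prod>i\<in>UNIV. A $ Some i $ Some (p i))))"
  proof (rule sum.cong)
    fix p assume "p \<in> {p. p permutes (UNIV :: 'k set)}"
    then have p: "p permutes UNIV" by simp
    have "sign (\<Phi> p) = sign p"
    proof -
      have "\<Phi> p = map_permutation UNIV Some p"
      proof
        fix x show "\<Phi> p x = map_permutation UNIV Some p x"
          by (cases x) (auto simp: \<Phi>_def map_permutation_def restrict_id_def)
      qed
      then show ?thesis using p by (simp add: sign_map_permutation)
    qed
    moreover have "(\<Prod>i\<in>UNIV. A $ i $ \<Phi> p i) = A $ None $ None * (\<Prod>i\<in>UNIV. A $ Some i $ Some (p i))"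
      by (simp add: UNIV_option_conv prod.reindex \<Phi>_def)
    ultimately show "of_int (sign (\<Phi> p)) * (\<Prod>i\<in>UNIV. A $ i $ \<Phi> p i) =
        A $ None $ None * (of_int (sign p) * (\<Prod>i\<in>UNIV. A $ Some i $ Some (p i)))" by simp
  qed simp
  also have "\<dots> = A $ None $ None * det (\<chi> i j. A $ Some i $ Some j)"
    by (simp add: det_def sum_distrib_left)
  finally show ?thesis .
qed

lemma wedge_permute:
  fixes c :: "'k::finite \<Rightarrow> 'n::finite"
  assumes "\<pi> permutes UNIV"
  shows "wedge_differentials (c \<circ> \<pi>) v = of_int (sign \<pi>) * wedge_differentials c v"
  unfolding wedge_differentials_def
  using det_permute_rows[OF assms, of "\<chi> i j. v j $ c i"] by (simp add: o_def)

section \<open>Holomorphic functions of several variables\<close>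

text \<open>Complex differentiability at a single point, that is, the condition in \<^const>\<open>holo_on\<close>.\<close>

definition holo_at :: "(complex^'k \<Rightarrow> complex) \<Rightarrow> complex^'k \<Rightarrow> bool" where
  "holo_at f x \<longleftrightarrow> (\<exists>L. (f has_derivative L) (at x) \<and> (\<forall>c v. L (c *s v) = c * L v))"

lemma holo_on_iff: "holo_on f U \<longleftrightarrow> (\<forall>x\<in>U. holo_at f x)"
  by (simp add: holo_on_def holo_at_def)

lemma holo_at_frechet:
  assumes "holo_at f x"
  shows "(f has_derivative frechet_derivative f (at x)) (at x)"
    and "frechet_derivative f (at x) (c *s v) = c * frechet_derivative f (at x) v"
  using assms frechet_derivative_at unfolding holo_at_def by metis+

lemma holo_atI:
  "(f has_derivative L) (at x) \<Longrightarrow> (\<And>c v. L (c *s v) = c * L v) \<Longrightarrow> holo_at f x"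
  unfolding holo_at_def by blast

lemma holo_at_const: "holo_at (\<lambda>x. c) x"
  by (rule holo_atI[OF has_derivative_const]) simp

lemma holo_at_nth: "holo_at (\<lambda>x. x $ i) x"
  by (rule holo_atI[OF bounded_linear_imp_has_derivative[OF bounded_linear_vec_nth]]) simp

lemma holo_at_add: "holo_at f x \<Longrightarrow> holo_at g x \<Longrightarrow> holo_at (\<lambda>x. f x + g x) x"
  by (rule holo_atI[OF has_derivative_add[OF holo_at_frechet(1) holo_at_frechet(1)]])
     (auto simp: holo_at_frechet(2) algebra_simps)

lemma holo_at_minus: "holo_at f x \<Longrightarrow> holo_at (\<lambda>x. - f x) x"
  by (rule holo_atI[OF has_derivative_minus[OF holo_at_frechet(1)]]) (auto simp: holo_at_frechet(2))

lemma holo_at_diff: "holo_at f x \<Longrightarrow> holo_at g x \<Longrightarrow> holo_at (\<lambda>x. f x - g x) x"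
  using holo_at_add[of f x "\<lambda>x. - g x"] holo_at_minus[of g x] by simp

lemma holo_at_mult: "holo_at f x \<Longrightarrow> holo_at g x \<Longrightarrow> holo_at (\<lambda>x. f x * g x) x"
  by (rule holo_atI[OF has_derivative_mult[OF holo_at_frechet(1) holo_at_frechet(1)]])
     (auto simp: holo_at_frechet(2) algebra_simps)

lemma holo_at_inverse: "holo_at f x \<Longrightarrow> f x \<noteq> 0 \<Longrightarrow> holo_at (\<lambda>x. inverse (f x)) x"
  by (rule holo_atI[OF Deriv.has_derivative_inverse[OF _ holo_at_frechet(1)]])
     (auto simp: holo_at_frechet(2) algebra_simps)

lemma holo_at_divide: "holo_at f x \<Longrightarrow> holo_at g x \<Longrightarrow> g x \<noteq> 0 \<Longrightarrow> holo_at (\<lambda>x. f x / g x) x"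
  unfolding divide_inverse by (intro holo_at_mult holo_at_inverse)

lemma holo_at_sum: "(\<And>i. i \<in> I \<Longrightarrow> holo_at (f i) x) \<Longrightarrow> holo_at (\<lambda>x. \<Sum>i\<in>I. f i x) x"
  by (induction I rule: infinite_finite_induct) (simp_all add: holo_at_const holo_at_add)

lemma holo_at_prod: "(\<And>i. i \<in> I \<Longrightarrow> holo_at (f i) x) \<Longrightarrow> holo_at (\<lambda>x. \<Prod>i\<in>I. f i x) x"
  by (induction I rule: infinite_finite_induct) (simp_all add: holo_at_const holo_at_mult)

lemma holo_at_power: "holo_at f x \<Longrightarrow> holo_at (\<lambda>x. f x ^ n) x"
  by (induction n) (simp_all add: holo_at_const holo_at_mult)

lemma holo_at_det:
  fixes M :: "complex^'k \<Rightarrow> complex^'n^'n"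
  assumes "\<And>i j. holo_at (\<lambda>x. M x $ i $ j) x" shows "holo_at (\<lambda>x. det (M x)) x"
  unfolding det_def by (intro holo_at_sum holo_at_mult holo_at_const holo_at_prod assms)

lemma holo_at_transform_open:
  assumes "holo_at f x" "open U" "x \<in> U" "\<And>y. y \<in> U \<Longrightarrow> f y = g y" shows "holo_at g x"
  using assms unfolding holo_at_def by (meson has_derivative_transform_within_open)

lemma holo_at_has_derivative_vec:
  fixes F :: "complex^'k \<Rightarrow> complex^'n"
  assumes "\<And>i. holo_at (\<lambda>x. F x $ i) x"
  shows "(F has_derivative (\<lambda>h. \<chi> i. frechet_derivative (\<lambda>x. F x $ i) (at x) h)) (at x)"
proof -
  have "((\<lambda>x. \<Sum>i\<in>UNIV. axis i (F x $ i)) has_derivative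
     (\<lambda>h. \<Sum>i\<in>UNIV. axis i (frechet_derivative (\<lambda>x. F x $ i) (at x) h))) (at x)"
  proof (intro has_derivative_sum)
    fix i
    have "bounded_linear (axis i :: complex \<Rightarrow> complex^'n)"
      by (rule linear_conv_bounded_linear[THEN iffD1], rule linearI) (auto simp: axis_def vec_eq_iff)
    then show "((\<lambda>x. axis i (F x $ i)) has_derivative
        (\<lambda>h. axis i (frechet_derivative (\<lambda>x. F x $ i) (at x) h))) (at x)"
      using holo_at_frechet(1)[OF assms[of i]] by (rule bounded_linear.has_derivative)
  qed
  moreover have "(\<Sum>i\<in>UNIV. axis i (f i)) = (\<chi> i. f i)" for f :: "'n \<Rightarrow> complex"
    by (simp add: vec_eq_iff axis_def)
  ultimately show ?thesis by (simp add: vec_lambda_eta)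
qed

lemma norm_vector_smult: "norm (c *s (v :: complex^'k)) = cmod c * norm v"
  by (simp add: norm_vec_def norm_mult L2_set_right_distrib[symmetric])

lemma line_has_derivative: "((\<lambda>s. u + s *s (v :: complex^'k)) has_derivative (\<lambda>s. s *s v)) (at t)"
proof -
  have "bounded_linear (\<lambda>s. s *s v)"
    by (rule linear_conv_bounded_linear[THEN iffD1], rule linearI)
       (auto simp: vec_eq_iff algebra_simps)
  then have "((\<lambda>s. s *s v) has_derivative (\<lambda>s. s *s v)) (at t)"
    by (rule bounded_linear_imp_has_derivative)
  from has_derivative_add[OF has_derivative_const[of u] this] show ?thesis by simp
qed

lemma holo_at_line:
  fixes v :: "complex^'k"
  assumes "holo_at f (u + t *s v)"
  shows "((\<lambda>s. f (u + s *s v)) has_field_derivative frechet_derivative f (at (u + t *s v)) v) (at t)"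
proof -
  have "((\<lambda>s. f (u + s *s v)) has_derivative
      (\<lambda>s. frechet_derivative f (at (u + t *s v)) (s *s v))) (at t)"
    using diff_chain_at[OF line_has_derivative holo_at_frechet(1)[OF assms]] by (simp add: o_def)
  moreover have "(\<lambda>s. frechet_derivative f (at (u + t *s v)) (s *s v)) =
      (*) (frechet_derivative f (at (u + t *s v)) v)"
    by (rule ext) (metis holo_at_frechet(2)[OF assms] mult.commute)
  ultimately show ?thesis unfolding has_field_derivative_def by simp
qed

text \<open>Taylor's formula, with the second derivative bounded by Cauchy's inequality on discs of
  radius 1.\<close>

lemma second_order_bound_disc:
  assumes hol: "g holomorphic_on ball 0 2" and M: "\<And>t. t \<in> ball 0 2 \<Longrightarrow> cmod (g t) \<le> M"
    and s: "cmod s \<le> 1/2"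
  shows "cmod (g s - g 0 - deriv g 0 * s) \<le> 2 * M * cmod s ^ 2"
proof -
  have "cmod ((deriv ^^ 0) g s - (\<Sum>i\<le>1. (deriv ^^ i) g 0 * (s - 0) ^ i / fact i))
      \<le> (2 * M) * cmod (s - 0) ^ Suc 1 / fact 1"
  proof (rule complex_Taylor)
    show "convex (cball 0 (1/2) :: complex set)" by simp
    fix i x assume "x \<in> cball (0::complex) (1/2)"
    then have "x \<in> ball 0 2" by simp
    then show "((deriv ^^ i) g has_field_derivative (deriv ^^ Suc i) g x) (at x within cball 0 (1/2))"
      using holomorphic_derivI[OF holomorphic_higher_deriv[OF hol open_ball, of i] open_ball]
      by simp
  next
    fix x assume x: "x \<in> cball (0::complex) (1/2)"
    have sub: "cball x 1 \<subseteq> ball 0 2"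
    proof
      fix y assume "y \<in> cball x 1"
      with x show "y \<in> ball 0 2" using norm_triangle_ineq[of x "y - x"] by (simp add: dist_norm norm_minus_commute)
    qed
    have "cmod ((deriv ^^ 2) g x) \<le> fact 2 * M / 1 ^ 2"
    proof (rule Cauchy_inequality)
      show "g holomorphic_on ball x 1"
        using hol sub by (meson ball_subset_cball holomorphic_on_subset order_trans)
      show "continuous_on (cball x 1) g"
        using hol sub by (meson holomorphic_on_imp_continuous_on holomorphic_on_subset)
      show "cmod (g y) \<le> M" if "cmod (x - y) = 1" for y
        using sub that by (intro M) (auto simp: dist_norm subset_iff)
    qed simp
    then show "cmod ((deriv ^^ Suc 1) g x) \<le> 2 * M" by (simp add: numeral_2_eq_2)
  qed (use s in auto)
  then show ?thesis by (simp add: power2_eq_square algebra_simps)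
qed

text \<open>Cauchy estimates along the complex line through \<open>y\<close> in the direction of \<open>w\<close>, rescaled such
  that the disc of radius 2 is mapped into the ball of radius \<open>R\<close>.\<close>

lemma
  fixes f :: "complex^'k \<Rightarrow> complex"
  assumes R: "R > 0" and f: "\<And>x. x \<in> ball y R \<Longrightarrow> holo_at f x" "\<And>x. x \<in> ball y R \<Longrightarrow> cmod (f x) \<le> M"
  shows first_order_bound: "cmod (frechet_derivative f (at y) w) \<le> 2 * M / R * norm w"
    and second_order_bound: "norm w \<le> R / 4 \<Longrightarrow>
      cmod (f (y + w) - f y - frechet_derivative f (at y) w) \<le> 8 * M / R^2 * (norm w)^2"
proof -
  have fy: "holo_at f y" using f R by simp
  have D0: "frechet_derivative f (at y) 0 = 0"
    using holo_at_frechet(2)[OF fy, of 0 0] by simp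
  define w1 where "w1 = of_real (R / 2 / norm w) *s w"
  define g where "g t = f (y + t *s w1)" for t
  have w1: "norm w1 = R / 2" "w = of_real (2 * norm w / R) *s w1" if "w \<noteq> 0"
  proof -
    show "norm w1 = R / 2" using that R by (simp add: w1_def norm_vector_smult norm_divide norm_mult)
    have "of_real (2 * norm w / R) *s w1 = of_real (2 * norm w / R * (R / 2 / norm w)) *s w"
      unfolding w1_def vector_smult_assoc of_real_mult ..
    also have "2 * norm w / R * (R / 2 / norm w) = 1" using that R by simp
    finally show "w = of_real (2 * norm w / R) *s w1" by simp
  qed
  have in_ball: "y + t *s w1 \<in> ball y R" if "t \<in> ball 0 2" "w \<noteq> 0" for t
  proof -
    have "dist y (y + t *s w1) = cmod t * (R / 2)"
      using w1(1)[OF that(2)] by (simp add: dist_norm norm_vector_smult)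
    also have "\<dots> < 2 * (R / 2)" using that(1) R by (intro mult_strict_right_mono) auto
    finally show ?thesis by simp
  qed
  have dg: "(g has_field_derivative frechet_derivative f (at (y + t *s w1)) w1) (at t)"
    if "t \<in> ball 0 2" "w \<noteq> 0" for t
    unfolding g_def by (rule holo_at_line) (use f in_ball that in blast)
  have holg: "g holomorphic_on ball 0 2" if "w \<noteq> 0"
    unfolding holomorphic_on_open[OF open_ball] using dg that by blast
  have Mg: "cmod (g t) \<le> M" if "t \<in> ball 0 2" "w \<noteq> 0" for t
    unfolding g_def using f in_ball that by blast
  have g': "deriv g 0 = frechet_derivative f (at y) w1" if "w \<noteq> 0"
    using dg[of 0] that by (intro DERIV_imp_deriv) simp
  have Dw: "frechet_derivative f (at y) w = of_real (2 * norm w / R) * frechet_derivative f (at y) w1"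
    if "w \<noteq> 0"
    using holo_at_frechet(2)[OF fy, of "of_real (2 * norm w / R)" w1]
    by (simp only: w1(2)[OF that, symmetric])
  show "cmod (frechet_derivative f (at y) w) \<le> 2 * M / R * norm w"
  proof (cases "w = 0")
    case False
    have "cmod ((deriv ^^ 1) g 0) \<le> fact 1 * M / 1 ^ 1"
    proof (rule Cauchy_inequality)
      show "g holomorphic_on ball 0 1" using holg[OF False] by (rule holomorphic_on_subset) auto
      show "continuous_on (cball 0 1) g"
        by (rule holomorphic_on_imp_continuous_on, rule holomorphic_on_subset[OF holg[OF False]]) auto
    qed (use Mg False in auto)
    then have "cmod (frechet_derivative f (at y) w1) \<le> M" by (simp add: g'[OF False])
    then have "2 * norm w / R * cmod (frechet_derivative f (at y) w1) \<le> 2 * norm w / R * M"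
      by (rule mult_left_mono) (use R in simp)
    then show ?thesis unfolding Dw[OF False] norm_mult norm_of_real using R by (simp add: field_simps)
  qed (simp add: D0)
  show "cmod (f (y + w) - f y - frechet_derivative f (at y) w) \<le> 8 * M / R^2 * (norm w)^2"
    if w: "norm w \<le> R / 4"
  proof (cases "w = 0")
    case False
    have "cmod (of_real (2 * norm w / R)) \<le> 1/2"
      unfolding norm_of_real using w R by (simp add: field_simps)
    from second_order_bound_disc[OF holg[OF False] Mg[OF _ False] this]
    have "cmod (g (of_real (2 * norm w / R)) - g 0 - deriv g 0 * of_real (2 * norm w / R))
        \<le> 2 * M * (2 * norm w / R)^2"
      unfolding norm_of_real using R by simp
    moreover have "g (of_real (2 * norm w / R)) = f (y + w)" "g 0 = f y"
      by (simp_all only: g_def w1(2)[OF False, symmetric]) simp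
    moreover have "2 * M * (2 * norm w / R)^2 = 8 * M / R^2 * (norm w)^2"
      by (simp add: power_divide power_mult_distrib)
    ultimately show ?thesis by (simp add: g'[OF False] Dw[OF False] mult.commute)
  qed (simp add: D0)
qed

lemma ball_subset_ball_add:
  fixes x :: "'a::metric_space"
  assumes "x \<in> ball y s" shows "ball x t \<subseteq> ball y (s + t)"
proof
  fix z assume "z \<in> ball x t"
  with assms dist_triangle[of y z x] show "z \<in> ball y (s + t)" by simp
qed

text \<open>Locally, the difference quotients of \<open>f\<close> in the direction of \<open>v\<close> are complex differentiable and
  converge uniformly to the derivative, by the second-order bound. By the first-order bound
  applied to their differences, their derivatives converge uniformly too, and the limit is the
  derivative of the limit.\<close>

theorem holo_on_frechet_derivative:
  fixes f :: "complex^'k \<Rightarrow> complex"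
  assumes U: "open U" and f: "holo_on f U"
  shows "holo_on (\<lambda>x. frechet_derivative f (at x) v) U"
  unfolding holo_on_iff
proof
  fix x0 assume "x0 \<in> U"
  then obtain r' where r': "r' > 0" "cball x0 r' \<subseteq> U" using U open_contains_cball by blast
  define r where "r = r' / 4"
  have r: "r > 0" and sub: "cball x0 (4 * r) \<subseteq> U" using r' by (simp_all add: r_def)
  have cd: "holo_at f x" if "x \<in> ball x0 (4 * r)" for x
    using f sub that by (auto simp: holo_on_iff subset_iff)
  have "continuous_on U f"
    using f holo_at_frechet(1) unfolding holo_on_iff
    by (meson continuous_at_imp_continuous_on has_derivative_continuous)
  then have "compact (f ` cball x0 (4 * r))"
    using sub by (intro compact_continuous_image) (auto intro: continuous_on_subset)
  then obtain M where M: "\<And>x. x \<in> cball x0 (4 * r) \<Longrightarrow> cmod (f x) \<le> M"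
    by (metis bounded_iff compact_imp_bounded imageI)
  let ?D = "\<lambda>x. frechet_derivative f (at x) v"
  obtain N0 :: nat where N0: "norm v / (r / 2) < real N0" using reals_Archimedean2 by blast
  \<comment> \<open>The shift keeps all displacements \<open>w n\<close> within the range of the second-order bound.\<close>
  define m where "m n = n + N0 + 1" for n
  have m: "norm v / real (m n) \<le> r / 2" "real (m n) > 0" for n
  proof -
    have "norm v / (r / 2) \<le> real (m n)" using N0 by (simp add: m_def)
    then show "norm v / real (m n) \<le> r / 2" using r by (simp add: field_simps m_def)
  qed (simp add: m_def)
  define w where "w n = inverse (of_nat (m n)) *s v" for n
  have nw: "norm (w n) = norm v / real (m n)" for n
    by (simp add: w_def norm_vector_smult norm_inverse divide_inverse mult.commute)
  define h where "h n x = of_nat (m n) * (f (x + w n) - f x)" for n x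
  define C where "C = 8 * M / (2 * r)^2 * (norm v)^2"
  have close: "cmod (h n x - ?D x) \<le> C / real (m n)" if x: "x \<in> ball x0 (2 * r)" for n x
  proof -
    have b: "ball x (2 * r) \<subseteq> ball x0 (4 * r)"
      using ball_subset_ball_add[OF x, of "2 * r"] by simp
    have "cmod (f (x + w n) - f x - frechet_derivative f (at x) (w n)) \<le> 8 * M / (2 * r)^2 * (norm (w n))^2"
      by (rule second_order_bound) (use b cd M m nw r in \<open>auto simp: subset_iff\<close>)
    also have "\<dots> = C / real (m n) / real (m n)"
      by (simp add: nw C_def power_divide power2_eq_square)
    finally have "cmod (f (x + w n) - f x - frechet_derivative f (at x) (w n)) * real (m n) \<le> C / real (m n)"
      using m(2)[of n] by (simp add: pos_le_divide_eq)
    moreover have "holo_at f x" using cd b r x by auto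
    then have "h n x - ?D x = (f (x + w n) - f x - frechet_derivative f (at x) (w n)) * of_nat (m n)"
      using m(2)[of n] by (simp add: h_def w_def holo_at_frechet(2) algebra_simps)
    ultimately show ?thesis by (simp add: norm_mult)
  qed
  have hcd: "holo_at (h n) x" if x: "x \<in> ball x0 (2 * r)" for n x
  proof -
    have "x + w n \<in> ball x0 (4 * r)"
    proof -
      have "dist x0 (x + w n) \<le> dist x0 x + norm (w n)"
        using dist_triangle[of x0 "x + w n" x] by (simp add: dist_norm)
      moreover have "norm (w n) \<le> r / 2" using m(1)[of n] by (simp only: nw)
      ultimately show ?thesis using x r by simp
    qed
    from cd[OF this] have "(f has_derivative frechet_derivative f (at (x + w n))) (at (x + w n))"
      and lin: "\<And>c u. frechet_derivative f (at (x + w n)) (c *s u) = c * frechet_derivative f (at (x + w n)) u"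
      by (rule holo_at_frechet)+
    moreover have "((\<lambda>x. x + w n) has_derivative (\<lambda>h. h)) (at x)"
      by (auto intro!: derivative_eq_intros)
    ultimately have "((\<lambda>x. f (x + w n)) has_derivative frechet_derivative f (at (x + w n))) (at x)"
      using diff_chain_at[of "\<lambda>x. x + w n" "\<lambda>h. h" x f] by (simp add: o_def)
    with lin have "holo_at (\<lambda>x. f (x + w n)) x" unfolding holo_at_def by blast
    moreover have "holo_at f x" using cd x r by simp
    ultimately show ?thesis unfolding h_def by (intro holo_at_mult holo_at_const holo_at_diff)
  qed
  define h' where "h' n x u = frechet_derivative (h n) (at x) u" for n x u
  have cauchy: "cmod (h' i x u - h' j x u) \<le> 2 * (C / real (m i) + C / real (m j)) / r * norm u"
    if x: "x \<in> ball x0 r" for i j x u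
  proof -
    have b: "ball x r \<subseteq> ball x0 (2 * r)"
      using ball_subset_ball_add[OF x, of r] by simp
    have "cmod (frechet_derivative (\<lambda>x. h i x - h j x) (at x) u)
        \<le> 2 * (C / real (m i) + C / real (m j)) / r * norm u"
    proof (rule first_order_bound[OF r])
      fix y assume "y \<in> ball x r"
      then have y: "y \<in> ball x0 (2 * r)" using b by auto
      then show "holo_at (\<lambda>x. h i x - h j x) y" by (intro holo_at_diff hcd)
      show "cmod (h i y - h j y) \<le> C / real (m i) + C / real (m j)"
        using close[OF y, of i] close[OF y, of j] norm_triangle_ineq4[of "h i y - ?D y" "h j y - ?D y"]
        by simp
    qed
    moreover have "x \<in> ball x0 (2 * r)" using b r x by auto
    then have "((\<lambda>x. h i x - h j x) has_derivative (\<lambda>u. h' i x u - h' j x u)) (at x)"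
      unfolding h'_def by (intro has_derivative_diff holo_at_frechet(1) hcd)
    then have "frechet_derivative (\<lambda>x. h i x - h j x) (at x) u = h' i x u - h' j x u"
      by (metis frechet_derivative_at)
    ultimately show ?thesis by simp
  qed
  have mlim: "(\<lambda>n. C / real (m n)) \<longlonglongrightarrow> 0"
    using LIMSEQ_ignore_initial_segment[OF lim_const_over_n[of C], of "N0 + 1"]
    by (simp add: m_def add.assoc)
  have hlim: "(\<lambda>n. h n x) \<longlonglongrightarrow> ?D x" if "x \<in> ball x0 (2 * r)" for x
  proof (rule LIM_zero_cancel)
    show "(\<lambda>n. h n x - ?D x) \<longlonglongrightarrow> 0"
      by (rule Lim_null_comparison[OF _ mlim]) (use close[OF that] in auto)
  qed
  have conv: "convergent (\<lambda>n. h' n x u)" if x: "x \<in> ball x0 r" for x u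
    unfolding Cauchy_convergent_iff[symmetric]
  proof (rule metric_CauchyI)
    fix e :: real assume e: "e > 0"
    define K where "K = 2 / r * norm u"
    have K: "K \<ge> 0" using r by (simp add: K_def)
    have "(\<lambda>n. K * (C / real (m n))) \<longlonglongrightarrow> K * 0" by (intro tendsto_mult tendsto_const mlim)
    then have "\<forall>\<^sub>F n in sequentially. K * (C / real (m n)) < e / 2"
      using e by (intro order_tendstoD) auto
    then obtain N where N: "\<And>n. n \<ge> N \<Longrightarrow> K * (C / real (m n)) < e / 2"
      by (auto simp: eventually_sequentially)
    have "dist (h' i x u) (h' j x u) < e" if "i \<ge> N" "j \<ge> N" for i j
    proof -
      have "dist (h' i x u) (h' j x u) \<le> K * (C / real (m i)) + K * (C / real (m j))"
      proof -
        have eq: "2 * (a + b) / r * norm u = K * a + K * b" for a b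
          using r by (simp add: K_def field_simps)
        show ?thesis using cauchy[OF x, of i u j] by (simp only: dist_norm eq)
      qed
      with N[OF that(1)] N[OF that(2)] show ?thesis by linarith
    qed
    then show "\<exists>N. \<forall>i\<ge>N. \<forall>j\<ge>N. dist (h' i x u) (h' j x u) < e" by blast
  qed
  \<comment> \<open>The candidate for the derivative of the limit.\<close>
  define g' where "g' x u = lim (\<lambda>n. h' n x u)" for x u
  have lim: "(\<lambda>n. h' n x u) \<longlonglongrightarrow> g' x u" if "x \<in> ball x0 r" for x u
    using conv[OF that] by (simp add: g'_def convergent_LIMSEQ_iff)
  have unif: "cmod (h' n x u - g' x u) \<le> 2 * (C / real (m n)) / r * norm u"
    if x: "x \<in> ball x0 r" for n x u
  proof (rule LIMSEQ_le)
    show "(\<lambda>j. cmod (h' n x u - h' j x u)) \<longlonglongrightarrow> cmod (h' n x u - g' x u)"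
      by (intro tendsto_intros lim x)
    have "(\<lambda>j. 2 * (C / real (m n) + C / real (m j)) / r * norm u) \<longlonglongrightarrow> 2 * (C / real (m n) + 0) / r * norm u"
      using r by (intro tendsto_intros mlim) simp
    then show "(\<lambda>j. 2 * (C / real (m n) + C / real (m j)) / r * norm u) \<longlonglongrightarrow> 2 * (C / real (m n)) / r * norm u"
      by simp
  qed (use cauchy[OF x] in blast)
  have "\<exists>g. \<forall>x\<in>ball x0 r. (\<lambda>n. h n x) \<longlonglongrightarrow> g x \<and> (g has_derivative g' x) (at x within ball x0 r)"
  proof (rule has_derivative_sequence)
    show "(h n has_derivative h' n x) (at x within ball x0 r)" if "x \<in> ball x0 r" for n x
    proof -
      have "x \<in> ball x0 (2 * r)" using that r by simp
      from holo_at_frechet(1)[OF hcd[OF this]] show ?thesis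
        unfolding h'_def by (rule has_derivative_at_withinI)
    qed
    show "\<forall>\<^sub>F n in sequentially. \<forall>x\<in>ball x0 r. \<forall>u. norm (h' n x u - g' x u) \<le> e * norm u" if e: "e > 0" for e
    proof -
      have "(\<lambda>n. 2 * (C / real (m n)) / r) \<longlonglongrightarrow> 2 * 0 / r"
        using r by (intro tendsto_intros mlim) simp
      then have "\<forall>\<^sub>F n in sequentially. 2 * (C / real (m n)) / r < e"
        using e by (intro order_tendstoD) auto
      then show ?thesis
      proof eventually_elim
        case (elim n)
        show ?case
        proof (intro ballI allI)
          fix x u assume "x \<in> ball x0 r"
          from unif[OF this, of n u] show "norm (h' n x u - g' x u) \<le> e * norm u"
            using elim mult_right_mono[of "2 * (C / real (m n)) / r" e "norm u"] by simp
        qed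
      qed
    qed
    show "(\<lambda>n. h n x0) \<longlonglongrightarrow> ?D x0" by (rule hlim) (use r in simp)
  qed (use r in auto)
  then obtain g where g: "\<And>x. x \<in> ball x0 r \<Longrightarrow> (\<lambda>n. h n x) \<longlonglongrightarrow> g x"
      "\<And>x. x \<in> ball x0 r \<Longrightarrow> (g has_derivative g' x) (at x within ball x0 r)" by blast
  have gD: "g x = ?D x" if x: "x \<in> ball x0 r" for x
  proof -
    have x2: "x \<in> ball x0 (2 * r)" using x r by simp
    have "(\<lambda>n. h n x) \<longlonglongrightarrow> ?D x" by (rule hlim[OF x2])
    with g(1)[OF x] show ?thesis by (rule LIMSEQ_unique)
  qed
  have x0: "x0 \<in> ball x0 r" using r by simp
  have "(g has_derivative g' x0) (at x0)"
    using g(2)[OF x0] at_within_open[OF x0 open_ball] by simp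
  then have "(?D has_derivative g' x0) (at x0)"
    by (rule has_derivative_transform_within_open[OF _ open_ball x0]) (use gD in auto)
  moreover have "g' x0 (c *s u) = c * g' x0 u" for c u
  proof -
    have "h' n x0 (c *s u) = c * h' n x0 u" for n
      unfolding h'_def by (rule holo_at_frechet(2)) (use hcd[of x0 n] r in simp)
    then have "(\<lambda>n. c * h' n x0 u) \<longlonglongrightarrow> g' x0 (c *s u)" using lim[OF x0, of "c *s u"] by simp
    moreover have "(\<lambda>n. c * h' n x0 u) \<longlonglongrightarrow> c * g' x0 u"
      by (intro tendsto_intros lim x0)
    ultimately show ?thesis by (rule LIMSEQ_unique)
  qed
  ultimately show "holo_at ?D x0" unfolding holo_at_def by blast
qed

section \<open>Comparing the local forms on the cone\<close>

text \<open>The tangent space of the cone at \<open>p\<close>, as the kernel of the differentials of the 27 quadrics.\<close>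

definition cone_kernel :: "complex^coord \<Rightarrow> (complex^coord) set" where
  "cone_kernel p = {w. \<forall>c. polar_form c p w = 0}"

definition third :: "coord \<Rightarrow> coord \<Rightarrow> coord" where
  "third a b = (THE c. triad a b c)"

lemma third_eq: "triad a b c \<Longrightarrow> third a b = c"
  unfolding third_def using triad_unique by blast

lemma triad_third: "adj a b \<Longrightarrow> triad a b (third a b)"
  using third_eq unfolding adj_def by metis

lemma bij_betw_same_range:
  fixes f g :: "'k::finite \<Rightarrow> 'a"
  assumes f: "bij_betw f UNIV S" and g: "bij_betw g UNIV S"
  obtains \<pi> where "\<pi> permutes UNIV" "f = g \<circ> \<pi>"
proof
  have "bij_betw (inv_into UNIV g \<circ> f) UNIV UNIV"
    using bij_betw_trans[OF f bij_betw_inv_into[OF g]] .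
  then show "inv_into UNIV g \<circ> f permutes UNIV" by (rule bij_imp_permutes) simp
  show "f = g \<circ> (inv_into UNIV g \<circ> f)"
    using f g by (auto simp: fun_eq_iff bij_betw_def f_inv_into_f)
qed

text \<open>The differential of the coordinate \<open>c\<close>, evaluated on the family \<open>w\<close>. The determinants below have
  these vectors as rows, and relations between differentials become relations between rows.\<close>

definition coord_row :: "('k::finite \<Rightarrow> complex^coord) \<Rightarrow> coord \<Rightarrow> complex^'k" where
  "coord_row w c = (\<chi> j. w j $ c)"

lemma wedge_coord_row: "wedge_differentials f w = det (\<chi> i. coord_row w (f i))"
proof -
  have "(\<chi> i j. w j $ f i) = (\<chi> i. coord_row w (f i))" by (simp add: coord_row_def vec_eq_iff)
  then show ?thesis by (simp add: wedge_differentials_def)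
qed

lemma kernel_rows:
  fixes w :: "'k::finite \<Rightarrow> complex^coord"
  assumes "range w \<subseteq> cone_kernel p"
  shows "(\<Sum>(x, y) | triad c x y. (cubic_coeff c x y * p $ x) *s coord_row w y) = 0"
proof -
  have "(\<Sum>(x, y) | triad c x y. (cubic_coeff c x y * p $ x) *s coord_row w y) $ j = polar_form c p (w j)" for j
    by (simp add: polar_sum case_prod_unfold coord_row_def)
  moreover have "polar_form c p (w j) = 0" for j using assms by (auto simp: cone_kernel_def)
  ultimately show ?thesis by (simp add: vec_eq_iff)
qed

lemma cubic_coeff_last: "triad a b m \<Longrightarrow> cubic_coeff m a b = cubic_coeff a b m"
  using cubic_coeff_rotate[of a m b] cubic_coeff_swap[of a b m] triad_swap[of a b m] by simp

lemma solve_linear_relation: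
  fixes k a x l a' y s :: complex
  assumes "k * k = 1" "a \<noteq> 0" "k * a * x + (l * a' * y + s) = 0"
  shows "x - (- (k * l) * (a' / a)) * y = (- k / a) * s"
proof -
  define q r where "q = a' / a" and "r = k / a"
  have "a' = q * a" "k = r * a" using assms(2) by (simp_all add: q_def r_def)
  with assms(1,3) have "x + k * l * q * y = - r * s" by algebra
  then show ?thesis by (simp add: q_def r_def)
qed

text \<open>The differential of the quadric at \<open>m\<close> expresses the differential of \<open>b\<close> by the others; the
  coefficient of a second variable \<open>b'\<close> is singled out here. As the signs have square 1, dividing
  by a sign is the same as multiplying by it.\<close>

lemma kernel_row_pair:
  fixes w :: "'k::finite \<Rightarrow> complex^coord"
  assumes w: "range w \<subseteq> cone_kernel p" and t: "triad a b m" "triad a' b' m"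
    and d: "{a, b} \<noteq> {a', b'}" and pa: "p $ a \<noteq> 0"
  shows "coord_row w b - (- (cubic_coeff a b m * cubic_coeff a' b' m) * (p $ a' / p $ a)) *s coord_row w b'
    \<in> vec.span (coord_row w ` ({y. adj m y} - {b, b'}))"
proof -
  let ?f = "\<lambda>(x, y). (cubic_coeff m x y * p $ x) *s coord_row w y"
  define S where "S = {(x, y). triad m x y} - {(a, b), (a', b')}"
  have tm: "triad m a b" "triad m a' b'" using t triad_swap triad_rotate by blast+
  have cm: "cubic_coeff m a b = cubic_coeff a b m" "cubic_coeff m a' b' = cubic_coeff a' b' m"
    using t by (simp_all add: cubic_coeff_last)
  have ne: "(a, b) \<noteq> (a', b')" using d by auto
  have eq: "(cubic_coeff a b m * p $ a) *s coord_row w b + ((cubic_coeff a' b' m * p $ a') *s coord_row w b' + sum ?f S) = 0"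
    using kernel_rows[OF w, of m] sum_remove_pair[of "{(x, y). triad m x y}" "(a, b)" "(a', b')" ?f] tm ne
    by (simp add: S_def cm)
  have "cubic_coeff a b m * p $ a * coord_row w b $ j + (cubic_coeff a' b' m * p $ a' * coord_row w b' $ j + sum ?f S $ j) = 0" for j
    using arg_cong[OF eq, of "\<lambda>v. v $ j"]
    by (simp only: vector_add_component vector_smult_component zero_index)
  from solve_linear_relation[OF cubic_coeff_square[OF t(1)] pa this]
  have "coord_row w b - (- (cubic_coeff a b m * cubic_coeff a' b' m) * (p $ a' / p $ a)) *s coord_row w b' =
      (- cubic_coeff a b m / p $ a) *s sum ?f S"
    by (simp only: vec_eq_iff vector_minus_component vector_smult_component) blast
  moreover have "sum ?f S \<in> vec.span (coord_row w ` ({y. adj m y} - {b, b'}))"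
  proof (rule vec.span_sum)
    fix z assume "z \<in> S"
    then obtain x y where z: "z = (x, y)" "triad m x y" "(x, y) \<noteq> (a, b)" "(x, y) \<noteq> (a', b')"
      by (auto simp: S_def)
    then have "y \<noteq> b" "y \<noteq> b'" using tm triad_unique triad_swap by blast+
    with triad_adj(1)[OF triad_swap[OF z(2)]] have "coord_row w y \<in> coord_row w ` ({y. adj m y} - {b, b'})" by blast
    then have "coord_row w y \<in> vec.span (coord_row w ` ({y. adj m y} - {b, b'}))" by (rule vec.span_base)
    then show "?f z \<in> vec.span (coord_row w ` ({y. adj m y} - {b, b'}))"
      by (simp add: z(1) vec.span_scale)
  qed
  ultimately show ?thesis by (simp only: vec.span_scale)
qed

text \<open>Let \<open>c\<close> be adjacent to \<open>b\<close> but not to \<open>a\<close>, and let \<open>m\<close> be the third member of the triad of \<open>b\<close> and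
  \<open>c\<close>. Then \<open>m\<close> is adjacent to \<open>a\<close>, and the third member \<open>d\<close> of their triad is adjacent to \<open>a\<close> but
  not to \<open>b\<close>. The quadric at \<open>m\<close> contains \<open>a d\<close> and \<open>b c\<close>, and its other variables are adjacent to
  neither \<open>a\<close> nor \<open>b\<close>. So modulo the common differentials that of \<open>d\<close> is \<open>b / a\<close> times that of
  \<open>c\<close>, up to sign. There are five such \<open>c\<close>, one in each of the five triads containing \<open>b\<close>.\<close>

theorem wedge_transition:
  fixes f g :: "'k::finite \<Rightarrow> coord"
  assumes ab: "a \<noteq> b" "\<not> adj a b"
    and f: "bij_betw f UNIV {c. \<not> adj a c}" and g: "bij_betw g UNIV {c. \<not> adj b c}"
  obtains s :: complex where "s * s = 1"
    "\<And>p w. p $ a \<noteq> 0 \<Longrightarrow> p $ b \<noteq> 0 \<Longrightarrow> range w \<subseteq> cone_kernel p \<Longrightarrow>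
      wedge_differentials f w / p $ a ^ 5 = s * (wedge_differentials g w / p $ b ^ 5)"
proof -
  define I where "I = {c. \<not> adj a c \<and> adj b c}"
  define \<beta> where "\<beta> c = (if c \<in> I then third a (third b c) else c)" for c
  have nba: "\<not> adj b a" using ab adj_sym by blast
  have I: "triad b c (third b c)" "triad a (third b c) (\<beta> c)" "\<not> adj b (\<beta> c)" "adj a (\<beta> c)"
    if "c \<in> I" for c
  proof -
    show t: "triad b c (third b c)" using that triad_third by (simp add: I_def)
    have "adj a (third b c)"
      using adj_triad_at_least[OF t, of a] that ab nba t triad_adj(2)[OF t] by (auto simp: I_def)
    then show t2: "triad a (third b c) (\<beta> c)" using triad_third that by (simp add: \<beta>_def)
    then show "adj a (\<beta> c)" using triad_adj by blast
    show "\<not> adj b (\<beta> c)"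
    proof
      assume "adj b (\<beta> c)"
      moreover have "triad (third b c) (\<beta> c) a" using t2 triad_rotate triad_swap by blast
      ultimately show False
        using adj_triad_at_most[of "third b c" "\<beta> c" a b] triad_adj(2)[OF t] ab by auto
    qed
  qed
  have \<beta>_nonI: "\<beta> c = c" if "c \<notin> I" for c using that by (simp add: \<beta>_def)
  have inj: "inj_on \<beta> {c. \<not> adj a c}"
  proof (rule inj_onI)
    fix c d assume cd: "c \<in> {c. \<not> adj a c}" "d \<in> {c. \<not> adj a c}" "\<beta> c = \<beta> d"
    have "c \<in> I \<longleftrightarrow> d \<in> I" using cd I(4) \<beta>_nonI by (metis mem_Collect_eq)
    moreover have "c = d" if "c \<in> I" "d \<in> I"
    proof -
      have "third b c = third b d"
        using I(2)[OF that(1)] I(2)[OF that(2)] cd(3) triad_unique triad_swap by metis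
      then show ?thesis using I(1)[OF that(1)] I(1)[OF that(2)] triad_unique triad_swap by metis
    qed
    ultimately show "c = d" using cd(3) \<beta>_nonI by metis
  qed
  have sub: "\<beta> ` {c. \<not> adj a c} \<subseteq> {c. \<not> adj b c}"
  proof
    fix d assume "d \<in> \<beta> ` {c. \<not> adj a c}"
    then obtain c where c: "\<not> adj a c" "d = \<beta> c" by auto
    then show "d \<in> {c. \<not> adj b c}" using I(3) \<beta>_nonI by (cases "c \<in> I") (auto simp: I_def)
  qed
  have "bij_betw \<beta> {c. \<not> adj a c} {c. \<not> adj b c}"
    using inj sub card_not_adj card_image[OF inj] by (simp add: bij_betw_def card_subset_eq)
  then have "bij_betw (\<beta> \<circ> f) UNIV {c. \<not> adj b c}" using f by (rule bij_betw_trans[rotated])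
  from bij_betw_same_range[OF this g] obtain \<pi> where \<pi>: "\<pi> permutes UNIV" "\<beta> \<circ> f = g \<circ> \<pi>" .
  have cardI: "card I = 5"
  proof -
    \<comment> \<open>In each triad containing \<open>b\<close>, exactly one of the two other members is adjacent to \<open>a\<close>.\<close>
    have un: "I \<union> third b ` I = {c. adj b c}"
    proof (intro equalityI subsetI)
      fix c assume "c \<in> I \<union> third b ` I"
      then show "c \<in> {c. adj b c}" using triad_adj(2)[OF I(1)] by (auto simp: I_def)
    next
      fix c assume c: "c \<in> {c. adj b c}"
      show "c \<in> I \<union> third b ` I"
      proof (cases "adj a c")
        case True
        have t: "triad b c (third b c)" using c triad_third by simp
        have t': "triad b (third b c) c" using triad_swap[OF t] .
        have "\<not> adj a (third b c)"
          using adj_triad_at_most[of c "third b c" b a] t triad_rotate triad_swap True ab by blast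
        then have "third b c \<in> I" using triad_adj(2)[OF t] by (simp add: I_def)
        moreover have "c = third b (third b c)" using third_eq[OF t'] by simp
        ultimately show ?thesis by blast
      qed (use c in \<open>simp add: I_def\<close>)
    qed
    have "I \<inter> third b ` I = {}"
      using I(2) triad_adj(1) by (force simp: I_def)
    moreover have "inj_on (third b) I"
      using I(1) triad_unique triad_swap by (metis inj_onI)
    ultimately have "card (I \<union> third b ` I) = card I + card I"
      by (simp add: card_Un_disjoint card_image)
    then show ?thesis by (simp add: un card_adj)
  qed
  \<comment> \<open>The sign in front of \<open>b / a\<close> for the coordinate \<open>c\<close>; it does not depend on the point.\<close>
  define \<epsilon> where "\<epsilon> c = - (cubic_coeff a (\<beta> c) (third b c) * cubic_coeff b c (third b c))" for c
  define s :: complex where "s = of_int (sign \<pi>) * (\<Prod>c\<in>I. \<epsilon> c)"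
  have \<epsilon>: "\<epsilon> c * \<epsilon> c = 1" if "c \<in> I" for c
    using cubic_coeff_square[OF I(1)[OF that]] cubic_coeff_square[OF triad_swap[OF I(2)[OF that]]]
    unfolding \<epsilon>_def by algebra
  then have \<epsilon>2: "(\<Prod>c\<in>I. \<epsilon> c) * (\<Prod>c\<in>I. \<epsilon> c) = 1"
    by (simp flip: prod.distrib)
  have sg: "of_int (sign \<pi>) * of_int (sign \<pi>) = (1 :: complex)"
    by (simp flip: of_int_mult add: sign_def)
  show ?thesis
  proof (rule that)
    show "s * s = 1" using \<epsilon>2 sg unfolding s_def by algebra
    fix p :: "complex^coord" and w :: "'k \<Rightarrow> complex^coord"
    assume p: "p $ a \<noteq> 0" "p $ b \<noteq> 0" and w: "range w \<subseteq> cone_kernel p"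
    define J where "J = {i. f i \<in> I}"
    have "det (\<chi> i. coord_row w (\<beta> (f i))) = (\<Prod>i\<in>J. \<epsilon> (f i) * (p $ b / p $ a)) * det (\<chi> i. coord_row w (f i))"
    proof (rule det_rows_replace)
      fix i assume "i \<in> J"
      then have i: "f i \<in> I" by (simp add: J_def)
      let ?m = "third b (f i)"
      have t: "triad a (\<beta> (f i)) ?m" "triad b (f i) ?m" using I(1,2)[OF i] triad_swap by blast+
      have "{a, \<beta> (f i)} \<noteq> {b, f i}"
        using ab i I(3,4)[OF i] by (auto simp: I_def doubleton_eq_iff)
      from kernel_row_pair[OF w t this p(1)]
      have "coord_row w (\<beta> (f i)) - (\<epsilon> (f i) * (p $ b / p $ a)) *s coord_row w (f i)
          \<in> vec.span (coord_row w ` ({y. adj ?m y} - {\<beta> (f i), f i}))"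
        by (simp add: \<epsilon>_def)
      moreover have "coord_row w ` ({y. adj ?m y} - {\<beta> (f i), f i}) \<subseteq> (\<lambda>i. coord_row w (f i)) ` (- J)"
      proof
        fix x assume "x \<in> coord_row w ` ({y. adj ?m y} - {\<beta> (f i), f i})"
        then obtain y where y: "adj ?m y" "y \<noteq> \<beta> (f i)" "y \<noteq> f i" "x = coord_row w y" by auto
        have "\<not> adj a y" using not_adj_if_same_quad[OF t(1) y(1,2)] .
        then have "y \<in> range f" using f by (simp add: bij_betw_def)
        then obtain k where k: "y = f k" by blast
        moreover have "\<not> adj b y" using not_adj_if_same_quad[OF t(2) y(1,3)] .
        ultimately have "k \<in> - J" by (simp add: J_def I_def)
        with y k show "x \<in> (\<lambda>i. coord_row w (f i)) ` (- J)" by blast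
      qed
      ultimately show "coord_row w (\<beta> (f i)) - (\<epsilon> (f i) * (p $ b / p $ a)) *s coord_row w (f i)
          \<in> vec.span ((\<lambda>i. coord_row w (f i)) ` (- J))"
        using vec.span_mono by blast
    qed (simp add: J_def \<beta>_nonI)
    also have "det (\<chi> i. coord_row w (\<beta> (f i))) = of_int (sign \<pi>) * wedge_differentials g w"
      using wedge_permute[OF \<pi>(1), of g w] \<pi>(2) by (simp add: wedge_coord_row fun_eq_iff)
    also have "(\<Prod>i\<in>J. \<epsilon> (f i) * (p $ b / p $ a)) = (\<Prod>c\<in>I. \<epsilon> c * (p $ b / p $ a))"
    proof (rule prod.reindex_bij_betw)
      have "I \<subseteq> {c. \<not> adj a c}" by (auto simp: I_def)
      then have "I \<subseteq> range f" using f by (simp add: bij_betw_def)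
      then have "f ` J = I" by (auto simp: J_def)
      moreover have "inj_on f J" using f by (auto simp: bij_betw_def intro: inj_on_subset)
      ultimately show "bij_betw f J I" by (simp add: bij_betw_def)
    qed
    also have "\<dots> = (\<Prod>c\<in>I. \<epsilon> c) * (p $ b / p $ a) ^ 5"
      by (simp only: prod.distrib prod_constant cardI)
    finally have "of_int (sign \<pi>) * wedge_differentials g w =
        (\<Prod>c\<in>I. \<epsilon> c) * (p $ b / p $ a) ^ 5 * wedge_differentials f w"
      by (simp only: wedge_coord_row)
    then have "(\<Prod>c\<in>I. \<epsilon> c) * (of_int (sign \<pi>) * wedge_differentials g w) =
        ((\<Prod>c\<in>I. \<epsilon> c) * (\<Prod>c\<in>I. \<epsilon> c)) * ((p $ b / p $ a) ^ 5 * wedge_differentials f w)"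
      by (simp only: mult_ac)
    then have "s * wedge_differentials g w = (p $ b / p $ a) ^ 5 * wedge_differentials f w"
      by (simp add: \<epsilon>2 s_def mult_ac)
    then show "wedge_differentials f w / p $ a ^ 5 = s * (wedge_differentials g w / p $ b ^ 5)"
      using p by (simp add: field_simps power_divide)
  qed
qed

text \<open>In the quadric at the third member of the triad of \<open>a\<close> and \<open>b\<close>, the nonzero monomial \<open>a b\<close> has to
  be cancelled by other monomials, whose factors are adjacent to neither \<open>a\<close> nor \<open>b\<close>.\<close>

lemma skew_go_between:
  assumes q: "\<And>c. quad c p = 0" and ab: "adj a b" and p: "p $ a \<noteq> 0" "p $ b \<noteq> 0"
  obtains c where "p $ c \<noteq> 0" "\<not> adj a c" "\<not> adj b c" "c \<noteq> a" "c \<noteq> b"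
proof -
  obtain m where t: "triad a b m" using ab by (auto simp: adj_def)
  have tm: "triad m a b" "triad m b a" "triad b a m" using t triad_rotate triad_swap by blast+
  have ne: "a \<noteq> b" using triad_distinct[OF t] by simp
  let ?f = "\<lambda>(x, y). cubic_coeff m x y * p $ x * p $ y"
  have cm: "cubic_coeff m a b = cubic_coeff a b m" "cubic_coeff m b a = cubic_coeff a b m"
    using cubic_coeff_last[OF t] cubic_coeff_last[OF tm(3)] cubic_coeff_rotate[OF t] by simp_all
  have "?f (a, b) + (?f (b, a) + sum ?f ({(x, y). triad m x y} - {(a, b), (b, a)})) = 0"
  proof -
    have "sum ?f {(x, y). triad m x y} = 0" using q[of m] by (simp add: quad_sum)
    then show ?thesis
      using sum_remove_pair[of "{(x, y). triad m x y}" "(a, b)" "(b, a)" ?f] ne tm(1,2) by simp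
  qed
  then have "sum ?f ({(x, y). triad m x y} - {(a, b), (b, a)}) = - 2 * cubic_coeff a b m * p $ a * p $ b"
    unfolding case_prod_conv cm by algebra
  also have "\<dots> \<noteq> 0" using p cubic_coeff_square[OF t] by auto
  finally obtain z where z: "z \<in> {(x, y). triad m x y} - {(a, b), (b, a)}" "?f z \<noteq> 0"
    by (rule sum.not_neutral_contains_not_neutral)
  obtain x y where zxy: "z = (x, y)" by (cases z)
  with z have xy: "triad m x y" "(x, y) \<noteq> (a, b)" "(x, y) \<noteq> (b, a)" "p $ x \<noteq> 0" by auto
  have "x \<noteq> a" "x \<noteq> b" using xy tm triad_unique by blast+
  moreover have "adj m x" using triad_adj(1)[OF xy(1)] .
  ultimately show ?thesis
    using that xy(4) not_adj_if_same_quad[OF t, of x] not_adj_if_same_quad[OF tm(3), of x] by blast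
qed

text \<open>The form at \<open>a\<close>, normalized by its value at a reference point where no coordinate vanishes,
  does not depend on \<open>a\<close>. For non-adjacent coordinates this holds because the sign in the
  transition is the same at both points, and so the sign itself never has to be computed.\<close>

theorem wedge_consistent:
  fixes f :: "coord \<Rightarrow> 'k::finite \<Rightarrow> coord"
  defines "form \<equiv> \<lambda>a p w. wedge_differentials (f a) w / p $ a ^ 5"
  assumes f: "\<And>a. bij_betw (f a) UNIV {c. \<not> adj a c}"
    and p0: "\<And>c. quad c p0 = 0" "\<And>c. p0 $ c \<noteq> 0" "range w0 \<subseteq> cone_kernel p0" "form a0 p0 w0 \<noteq> 0"
  shows "form a p0 w0 = form b p0 w0 \<or> form a p0 w0 = - form b p0 w0"
    and "(\<And>c. quad c p = 0) \<Longrightarrow> range w \<subseteq> cone_kernel p \<Longrightarrow> p $ a \<noteq> 0 \<Longrightarrow> p $ b \<noteq> 0 \<Longrightarrow>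
      form a p w * form b p0 w0 = form b p w * form a p0 w0"
proof -
  have skew: "\<exists>s. s * s = 1 \<and> (\<forall>p w. p $ a \<noteq> 0 \<longrightarrow> p $ b \<noteq> 0 \<longrightarrow> range w \<subseteq> cone_kernel p \<longrightarrow>
      form a p w = s * form b p w)" if nab: "\<not> adj a b" for a b
  proof (cases "a = b")
    case True
    then show ?thesis by (intro exI[of _ 1]) simp
  next
    case False
    show ?thesis
    proof (rule wedge_transition[OF False nab f f])
      fix s :: complex
      assume "s * s = 1"
        "\<And>p w. p $ a \<noteq> 0 \<Longrightarrow> p $ b \<noteq> 0 \<Longrightarrow> range w \<subseteq> cone_kernel p \<Longrightarrow>
          wedge_differentials (f a) w / p $ a ^ 5 = s * (wedge_differentials (f b) w / p $ b ^ 5)"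
      then show ?thesis unfolding form_def by (intro exI[of _ s] conjI allI impI)
    qed
  qed
  have sq0: "(form a p0 w0)\<^sup>2 = (form b p0 w0)\<^sup>2" if nab: "\<not> adj a b" for a b
  proof -
    obtain s where s: "s * s = 1" and all: "\<forall>p w. p $ a \<noteq> 0 \<longrightarrow> p $ b \<noteq> 0 \<longrightarrow>
        range w \<subseteq> cone_kernel p \<longrightarrow> form a p w = s * form b p w"
      using skew[OF nab] by (elim exE conjE)
    have "form a p0 w0 = s * form b p0 w0"
      using all[rule_format, OF p0(2) p0(2) p0(3)] .
    with s show ?thesis by algebra
  qed
  have sq: "(form a p0 w0)\<^sup>2 = (form b p0 w0)\<^sup>2" for a b
  proof (cases "adj a b")
    case True
    obtain c where "\<not> adj a c" "\<not> adj b c"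
      by (rule skew_go_between[OF p0(1) True p0(2) p0(2)])
    then show ?thesis using sq0[of a c] sq0[of b c] by simp
  qed (rule sq0)
  then show "form a p0 w0 = form b p0 w0 \<or> form a p0 w0 = - form b p0 w0"
    by (simp add: power2_eq_iff)
  have nz: "form c p0 w0 \<noteq> 0" for c using sq[of a0 c] p0(4) by auto
  assume q: "\<And>c. quad c p = 0" and w: "range w \<subseteq> cone_kernel p" and p: "p $ a \<noteq> 0" "p $ b \<noteq> 0"
  have skew': "form x p w * form y p0 w0 = form y p w * form x p0 w0"
    if xy: "\<not> adj x y" "p $ x \<noteq> 0" "p $ y \<noteq> 0" for x y
  proof -
    obtain s where all: "\<forall>p w. p $ x \<noteq> 0 \<longrightarrow> p $ y \<noteq> 0 \<longrightarrow>
        range w \<subseteq> cone_kernel p \<longrightarrow> form x p w = s * form y p w"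
      using skew[OF xy(1)] by (elim exE conjE)
    have "form x p w = s * form y p w" "form x p0 w0 = s * form y p0 w0"
      using all[rule_format, OF xy(2,3) w] all[rule_format, OF p0(2) p0(2) p0(3)] .
    then show ?thesis by algebra
  qed
  show "form a p w * form b p0 w0 = form b p w * form a p0 w0"
  proof (cases "adj a b")
    case False
    then show ?thesis by (rule skew'[OF _ p])
  next
    case True
    obtain c where c: "p $ c \<noteq> 0" "\<not> adj a c" "\<not> adj b c"
      by (rule skew_go_between[OF q True p])
    have "form a p w * form c p0 w0 = form c p w * form a p0 w0"
      "form b p w * form c p0 w0 = form c p w * form b p0 w0"
      using skew'[OF c(2) p(1) c(1)] skew'[OF c(3) p(2) c(1)] .
    then have "form c p0 w0 * (form a p w * form b p0 w0) = form c p0 w0 * (form b p w * form a p0 w0)"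
      by algebra
    then show ?thesis using nz[of c] by simp
  qed
qed

section \<open>Holomorphy of the parametrizations\<close>

lemma holo_at_compose:
  fixes G :: "complex^'k \<Rightarrow> complex^'n"
  assumes f: "holo_at f (G x)" and G: "\<And>i. holo_at (\<lambda>x. G x $ i) x"
  shows "holo_at (\<lambda>x. f (G x)) x"
proof (rule holo_atI)
  let ?G' = "\<lambda>h. \<chi> i. frechet_derivative (\<lambda>x. G x $ i) (at x) h"
  show "((\<lambda>x. f (G x)) has_derivative (\<lambda>h. frechet_derivative f (at (G x)) (?G' h))) (at x)"
    using diff_chain_at[OF holo_at_has_derivative_vec[of G x] holo_at_frechet(1)[OF f]] G by (simp add: o_def)
  fix c v
  have "?G' (c *s v) = c *s ?G' v" by (simp add: vec_eq_iff holo_at_frechet(2)[OF G])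
  then show "frechet_derivative f (at (G x)) (?G' (c *s v)) = c * frechet_derivative f (at (G x)) (?G' v)"
    by (simp only: holo_at_frechet(2)[OF f])
qed

lemma holo_at_quad: "holo_at (quad c) x"
proof -
  have "holo_at (\<lambda>p. (\<Sum>z\<in>{(b, d). triad c b d}. cubic_coeff c (fst z) (snd z) * p $ fst z * p $ snd z) / 2) x"
    by (intro holo_at_divide holo_at_sum holo_at_mult holo_at_const holo_at_nth) simp
  moreover have "quad c = (\<lambda>p. (\<Sum>z\<in>{(b, d). triad c b d}. cubic_coeff c (fst z) (snd z) * p $ fst z * p $ snd z) / 2)"
    by (simp add: fun_eq_iff quad_sum case_prod_unfold)
  ultimately show ?thesis by simp
qed

lemma holo_at_cone_retract: "x $ a \<noteq> 0 \<Longrightarrow> holo_at (\<lambda>x. cone_retract a x $ b) x"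
  unfolding cone_retract_def vec_lambda_beta
  by (intro holo_at_diff holo_at_divide holo_at_sum holo_at_mult holo_at_const holo_at_nth holo_at_quad)

lemma holo_at_retract:
  assumes "x $ a \<noteq> 0" "a \<noteq> e" shows "holo_at (\<lambda>x. XO_retract a e x $ b) x"
  unfolding XO_retract_def
proof (rule holo_at_compose[where f = "\<lambda>y. cone_retract a y $ b"])
  show "holo_at (\<lambda>y. cone_retract a y $ b) (\<chi> b. if b = e then - (\<Sum>d\<in>diag_coords - {e}. cone_retract a x $ d) else x $ b)"
    using assms by (intro holo_at_cone_retract) simp
  have "holo_at (\<lambda>x. - (\<Sum>d\<in>diag_coords - {e}. cone_retract a x $ d)) x"
    by (intro holo_at_minus holo_at_sum holo_at_cone_retract assms)
  then show "holo_at (\<lambda>x. (\<chi> b. if b = e then - (\<Sum>d\<in>diag_coords - {e}. cone_retract a x $ d) else x $ b) $ i) x" for i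
    using holo_at_nth by (cases "i = e") auto
qed

section \<open>Tangent vectors\<close>

lemma quad_curve_derivative:
  assumes "\<And>i. ((\<lambda>t. \<gamma> t $ i) has_field_derivative w $ i) (at t0)"
  shows "((\<lambda>t. quad c (\<gamma> t)) has_field_derivative polar_form c (\<gamma> t0) w) (at t0)"
proof -
  have "((\<lambda>t. (\<Sum>z\<in>{(b, d). triad c b d}. cubic_coeff c (fst z) (snd z) * \<gamma> t $ fst z * \<gamma> t $ snd z) / 2)
     has_field_derivative
       (\<Sum>z\<in>{(b, d). triad c b d}. cubic_coeff c (fst z) (snd z) * w $ fst z * \<gamma> t0 $ snd z +
         cubic_coeff c (fst z) (snd z) * \<gamma> t0 $ fst z * w $ snd z) / 2) (at t0)"
    by (intro DERIV_cdivide DERIV_sum) (auto intro!: derivative_eq_intros assms)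
  moreover have "(\<Sum>z\<in>{(b, d). triad c b d}. cubic_coeff c (fst z) (snd z) * w $ fst z * \<gamma> t0 $ snd z +
         cubic_coeff c (fst z) (snd z) * \<gamma> t0 $ fst z * w $ snd z) / 2 = (polar_form c w (\<gamma> t0) + polar_form c (\<gamma> t0) w) / 2"
    by (simp add: sum.distrib polar_sum case_prod_unfold)
  ultimately show ?thesis
    by (simp add: quad_sum case_prod_unfold polar_sym[of c w])
qed

lemma cone_curve_kernel:
  assumes d: "\<And>i. ((\<lambda>t. \<gamma> t $ i) has_field_derivative w $ i) (at 0)" and r: "r > 0"
    and q: "\<And>t c. t \<in> ball 0 r \<Longrightarrow> quad c (\<gamma> t) = 0"
  shows "w \<in> cone_kernel (\<gamma> 0)"
proof -
  have "polar_form c (\<gamma> 0) w = 0" for c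
  proof -
    have "((\<lambda>t. 0) has_field_derivative polar_form c (\<gamma> 0) w) (at (0::complex))"
      by (rule has_field_derivative_transform_within_open[OF quad_curve_derivative[OF d] open_ball[of 0 r]])
         (use q r in auto)
    then show ?thesis using DERIV_unique DERIV_const by blast
  qed
  then show ?thesis by (simp add: cone_kernel_def)
qed

text \<open>The tangent vectors of the cone are parametrized by their components at the coordinates not
  adjacent to \<open>a\<close>: take the velocity of the retraction of a straight line.\<close>

lemma cone_kernel_lift:
  assumes q: "\<And>c. quad c p = 0" and pa: "p $ a \<noteq> 0"
  obtains w where "w \<in> cone_kernel p" "\<And>c. \<not> adj a c \<Longrightarrow> w $ c = u $ c"
proof -
  define \<gamma> where "\<gamma> t = cone_retract a (p + t *s u)" for t
  define w where "w = (\<chi> i. frechet_derivative (\<lambda>x. cone_retract a x $ i) (at (p + 0 *s u)) u)"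
  have \<gamma>0: "\<gamma> 0 = p" using cone_retract_id[OF q] by (simp add: \<gamma>_def)
  have d: "((\<lambda>t. \<gamma> t $ i) has_field_derivative w $ i) (at 0)" for i
    unfolding \<gamma>_def w_def vec_lambda_beta
    by (rule holo_at_line[where f = "\<lambda>x. cone_retract a x $ i"]) (simp add: holo_at_cone_retract pa)
  have "continuous_on UNIV (\<lambda>t. p $ a + t * u $ a)" by (intro continuous_intros)
  then have "open ((\<lambda>t. p $ a + t * u $ a) -` (- {0}))" by (intro open_vimage) auto
  moreover have "0 \<in> (\<lambda>t. p $ a + t * u $ a) -` (- {0})" using pa by simp
  ultimately obtain r where r: "r > 0" "ball 0 r \<subseteq> (\<lambda>t. p $ a + t * u $ a) -` (- {0})"
    by (rule openE)
  have "w \<in> cone_kernel (\<gamma> 0)"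
  proof (rule cone_curve_kernel[OF d r(1)])
    fix t c assume "t \<in> ball (0::complex) r"
    then have "(p + t *s u) $ a \<noteq> 0" using r(2) by auto
    then show "quad c (\<gamma> t) = 0" unfolding \<gamma>_def by (rule quad_cone_retract)
  qed
  moreover have "w $ c = u $ c" if "\<not> adj a c" for c
  proof -
    have "((\<lambda>t. p $ c + t * u $ c) has_field_derivative w $ c) (at 0)"
      using d[of c] that by (simp add: \<gamma>_def cone_retract_not_adj)
    moreover have "((\<lambda>t. p $ c + t * u $ c) has_field_derivative u $ c) (at 0)"
      by (auto intro!: derivative_eq_intros)
    ultimately show ?thesis by (rule DERIV_unique)
  qed
  ultimately show ?thesis using that \<gamma>0 by simp
qed

text \<open>Differentiation of the equations along a curve.\<close>

lemma tangent_space_subset: "tangent_space XO p \<subseteq> {w \<in> cone_kernel p. trace3 w = 0}"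
proof
  fix w assume "w \<in> tangent_space XO p"
  then obtain r \<gamma> where r: "r > 0" "\<gamma> 0 = p" "\<And>t. t \<in> ball 0 r \<Longrightarrow> \<gamma> t \<in> XO"
    "\<And>i. (\<lambda>t. \<gamma> t $ i) holomorphic_on ball 0 r" "\<And>i. deriv (\<lambda>t. \<gamma> t $ i) 0 = w $ i"
    unfolding tangent_space_def by auto
  have d: "((\<lambda>t. \<gamma> t $ i) has_field_derivative w $ i) (at 0)" for i
    using holomorphic_derivI[OF r(4) open_ball, of 0] r(1,5) by simp
  have "w \<in> cone_kernel (\<gamma> 0)"
    by (rule cone_curve_kernel[OF d r(1)]) (use r(3) XO_iff in blast)
  moreover have "trace3 w = 0"
  proof -
    have "((\<lambda>t. trace3 (\<gamma> t)) has_field_derivative trace3 w) (at 0)"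
      unfolding trace3_def by (intro DERIV_sum d)
    then have "((\<lambda>t. 0) has_field_derivative trace3 w) (at (0::complex))"
      by (rule has_field_derivative_transform_within_open[OF _ open_ball[of 0 r]]) (use r(1,3) XO_iff in auto)
    then show ?thesis using DERIV_unique DERIV_const by blast
  qed
  ultimately show "w \<in> {w \<in> cone_kernel p. trace3 w = 0}" using r(2) by simp
qed

lemma holo_param_holo_at:
  assumes "holo_param M U \<phi>" "u \<in> U" shows "holo_at (\<lambda>u. \<phi> u $ i) u"
  using assms by (simp add: holo_param_def holo_on_iff)

lemma holo_param_frechet:
  assumes "holo_param M U \<phi>" "u \<in> U"
  shows "frechet_derivative \<phi> (at u) h $ i = frechet_derivative (\<lambda>u. \<phi> u $ i) (at u) h"
  using frechet_derivative_at[OF holo_at_has_derivative_vec[OF holo_param_holo_at[OF assms]]]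
  by (metis vec_lambda_beta)

lemma holo_param_tangent:
  fixes \<phi> :: "complex^'k \<Rightarrow> complex^'n"
  assumes \<phi>: "holo_param M U \<phi>" and u: "u \<in> U"
  shows "frechet_derivative \<phi> (at u) h \<in> tangent_space M (\<phi> u)"
proof -
  have "open U" using \<phi> by (simp add: holo_param_def)
  moreover have "continuous_on UNIV (\<lambda>t. u + t *s h)"
    by (rule continuous_at_imp_continuous_on) (auto intro: has_derivative_continuous[OF line_has_derivative])
  ultimately have "open ((\<lambda>t. u + t *s h) -` U)" by (intro open_vimage)
  moreover have "0 \<in> (\<lambda>t. u + t *s h) -` U" using u by simp
  ultimately obtain r where r: "r > 0" "ball 0 r \<subseteq> (\<lambda>t. u + t *s h) -` U" by (rule openE)
  have d: "((\<lambda>t. \<phi> (u + t *s h) $ i) has_field_derivative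
      frechet_derivative \<phi> (at (u + t *s h)) h $ i) (at t)" if "t \<in> ball 0 r" for t i
  proof -
    have tU: "u + t *s h \<in> U" using that r(2) by auto
    show ?thesis
      unfolding holo_param_frechet[OF \<phi> tU]
      by (rule holo_at_line[where f = "\<lambda>u. \<phi> u $ i"]) (rule holo_param_holo_at[OF \<phi> tU])
  qed
  have "(\<lambda>t. \<phi> (u + t *s h) $ i) holomorphic_on ball 0 r" for i
    unfolding holomorphic_on_open[OF open_ball] using d by blast
  moreover have "deriv (\<lambda>t. \<phi> (u + t *s h) $ i) 0 = frechet_derivative \<phi> (at u) h $ i" for i
    using DERIV_imp_deriv[OF d[of 0 i]] r(1) by simp
  moreover have "\<phi> (u + t *s h) \<in> M" if "t \<in> ball 0 r" for t
  proof -
    have "openin (top_of_set M) (\<phi> ` U)" using \<phi> by (simp add: holo_param_def)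
    then have "\<phi> ` U \<subseteq> M" by (rule openin_imp_subset)
    moreover have "u + t *s h \<in> U" using that r(2) by auto
    ultimately show ?thesis by blast
  qed
  ultimately show ?thesis
    unfolding tangent_space_def using r(1)
    by (intro CollectI exI[of _ r] conjI exI[of _ "\<lambda>t. \<phi> (u + t *s h)"]) auto
qed

section \<open>From the cone to the trace-free part\<close>

lemma kernel_row_span:
  fixes w :: "'k::finite \<Rightarrow> complex^coord"
  assumes w: "range w \<subseteq> cone_kernel p" and t: "triad a b c" and pa: "p $ a \<noteq> 0"
  shows "coord_row w b \<in> vec.span (coord_row w ` {y. adj c y \<and> y \<noteq> b})"
proof -
  have tc: "triad c a b" using t triad_rotate triad_swap by blast
  let ?f = "\<lambda>(x, y). (cubic_coeff c x y * p $ x) *s coord_row w y"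
  let ?S = "{(x, y). triad c x y}"
  have "?f (a, b) + sum ?f (?S - {(a, b)}) = 0"
    using kernel_rows[OF w, of c] sum.remove[of ?S "(a, b)" ?f] tc by simp
  then have "(cubic_coeff c a b * p $ a) *s coord_row w b = - sum ?f (?S - {(a, b)})"
    by (simp add: eq_neg_iff_add_eq_0)
  then have "(1 / (cubic_coeff c a b * p $ a)) *s ((cubic_coeff c a b * p $ a) *s coord_row w b) =
      (1 / (cubic_coeff c a b * p $ a)) *s (- sum ?f (?S - {(a, b)}))" by (rule arg_cong)
  moreover have "cubic_coeff c a b * p $ a \<noteq> 0" using pa cubic_coeff_square[OF tc] by auto
  ultimately have "coord_row w b = (1 / (cubic_coeff c a b * p $ a)) *s (- sum ?f (?S - {(a, b)}))"
    by (simp add: vector_smult_assoc)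
  moreover have "sum ?f (?S - {(a, b)}) \<in> vec.span (coord_row w ` {y. adj c y \<and> y \<noteq> b})"
  proof (rule vec.span_sum)
    fix z assume z: "z \<in> ?S - {(a, b)}"
    obtain x y where zxy: "z = (x, y)" by (cases z)
    with z have xy: "triad c x y" "(x, y) \<noteq> (a, b)" by auto
    then have "y \<noteq> b" using tc triad_unique triad_swap by blast
    then have "coord_row w y \<in> coord_row w ` {y. adj c y \<and> y \<noteq> b}" using triad_adj(2)[OF xy(1)] by blast
    then have "coord_row w y \<in> vec.span (coord_row w ` {y. adj c y \<and> y \<noteq> b})" by (rule vec.span_base)
    then show "?f z \<in> vec.span (coord_row w ` {y. adj c y \<and> y \<noteq> b})"
      by (simp add: zxy vec.span_scale)
  qed
  ultimately show ?thesis by (simp only: vec.span_scale vec.span_neg)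
qed

text \<open>The diagonal coordinate \<open>m\<close> adjacent to \<open>a\<close> is a function of the chart coordinates other than
  \<open>e\<close>, because the quadric that determines it does not involve \<open>e\<close>.\<close>

lemma diag_partner_row:
  fixes w :: "'k::finite \<Rightarrow> complex^coord"
  assumes w: "range w \<subseteq> cone_kernel p" and pa: "p $ a \<noteq> 0"
    and a: "a \<in> offdiag_coords" and e: "e \<in> diag_coords" "\<not> adj a e"
    and m: "adj a m" "adj e m"
  shows "coord_row w m \<in> vec.span (coord_row w ` {y. \<not> adj a y \<and> y \<noteq> e})"
proof -
  obtain c where t: "triad a m c" using m(1) by (auto simp: adj_def)
  have "{y. adj c y \<and> y \<noteq> m} \<subseteq> {y. \<not> adj a y \<and> y \<noteq> e}"
  proof safe
    fix y assume "adj c y" "y \<noteq> m" "adj a y"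
    then show False using not_adj_if_same_quad[OF t] by blast
  next
    assume "adj c e"
    then have "adj e c" by (rule adj_sym)
    moreover have "triad m c a" using t triad_rotate triad_swap by blast
    ultimately show False
      using adj_triad_at_most[of m c a e] m(2) e(1) a by (auto simp: offdiag_coords_def)
  qed
  then show ?thesis
    using kernel_row_span[OF w t pa] vec.span_mono[OF image_mono] by blast
qed

text \<open>The differential of the trace is that of the eliminated coordinate \<open>Q None\<close> plus a
  combination of the differentials of the 16 others. After this row operation the first row has
  a single nonzero entry, the trace of \<open>n\<close>.\<close>

lemma wedge_trace:
  fixes Q :: "'k::finite option \<Rightarrow> coord"
  assumes a: "a \<in> offdiag_coords" and e: "Q None \<in> diag_coords"
    and Q: "bij_betw Q UNIV {c. \<not> adj a c}"
    and pa: "p $ a \<noteq> 0" and n: "n \<in> cone_kernel p"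
    and v: "\<And>j. v j \<in> cone_kernel p" "\<And>j. trace3 (v j) = 0"
  shows "wedge_differentials Q (case_option n v) = trace3 n * wedge_differentials (\<lambda>i. Q (Some i)) v"
proof -
  define w where "w = case_option n v"
  have w: "range w \<subseteq> cone_kernel p" using n v(1) by (auto simp: w_def split: option.split)
  have ae: "\<not> adj a (Q None)" using Q by (auto simp: bij_betw_def)
  obtain d m where dm: "diag_coords = {Q None, d, m}" "triad (Q None) d m" "adj a m" "\<not> adj a d"
    using diag_split[OF a e ae] .
  have neq: "Q None \<noteq> d" "Q None \<noteq> m" "d \<noteq> m" using triad_distinct[OF dm(2)] by auto
  define F where "F i = coord_row w (Q i)" for i
  define G where "G i = (case i of None \<Rightarrow> (\<chi> j. trace3 (w j)) | Some k \<Rightarrow> F (Some k))" for i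
  have span: "coord_row w y \<in> vec.span (F ` (- {None}))" if "\<not> adj a y" "y \<noteq> Q None" for y
  proof -
    have "y \<in> range Q" using Q that(1) by (simp add: bij_betw_def)
    then obtain i where i: "y = Q i" by blast
    with that(2) have "i \<noteq> None" by metis
    then have "i \<in> - {None}" by simp
    then have "coord_row w y \<in> F ` (- {None})" by (simp add: F_def i)
    then show ?thesis by (rule vec.span_base)
  qed
  have "det (\<chi> i. G i) = (\<Prod>i\<in>{None :: 'k option}. 1) * det (\<chi> i. F i)"
  proof (rule det_rows_replace[where \<kappa> = "\<lambda>_. 1"])
    fix i :: "'k option" assume "i \<in> {None}"
    then have "G i - 1 *s F i = coord_row w d + coord_row w m"
      using neq by (auto simp: G_def F_def coord_row_def trace3_def dm(1) vec_eq_iff)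
    moreover have "coord_row w d \<in> vec.span (F ` (- {None}))"
      by (rule span) (use dm neq in auto)
    moreover have "coord_row w m \<in> vec.span (F ` (- {None}))"
    proof -
      have "coord_row w ` {y. \<not> adj a y \<and> y \<noteq> Q None} \<subseteq> vec.span (F ` (- {None}))"
        using span by blast
      then have "vec.span (coord_row w ` {y. \<not> adj a y \<and> y \<noteq> Q None}) \<subseteq> vec.span (F ` (- {None}))"
        by (rule vec.span_minimal) (rule vec.subspace_span)
      then show ?thesis
        using diag_partner_row[OF w pa a e ae dm(3) triad_adj(2)[OF dm(2)]] by blast
    qed
    ultimately show "G i - 1 *s F i \<in> vec.span (F ` (- {None}))" by (simp only: vec.span_add)
  qed (auto simp: G_def split: option.split)
  then have "wedge_differentials Q w = det (\<chi> i. G i)" by (simp add: wedge_coord_row F_def)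
  also have "\<dots> = trace3 n * det (\<chi> i j. (\<chi> i. G i) $ Some i $ Some j)"
    by (subst det_option) (simp_all add: G_def w_def v(2))
  also have "det (\<chi> i j. (\<chi> i. G i) $ Some i $ Some j) = wedge_differentials (\<lambda>i. Q (Some i)) v"
    by (simp add: wedge_differentials_def G_def F_def coord_row_def w_def)
  finally show ?thesis by (simp add: w_def)
qed

text \<open>Lift the basis vector of the eliminated coordinate: the components of the lift at the two other
  diagonal coordinates vanish.\<close>

lemma kernel_trace_vector:
  assumes a: "a \<in> offdiag_coords" and q: "\<And>c. quad c p = 0" and pa: "p $ a \<noteq> 0"
    and e: "e \<in> diag_coords" "\<not> adj a e"
  obtains n where "n \<in> cone_kernel p" "trace3 n = 1"
proof -
  obtain n where n: "n \<in> cone_kernel p" "\<And>c. \<not> adj a c \<Longrightarrow> n $ c = (axis e 1 :: complex^coord) $ c"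
    using cone_kernel_lift[OF q pa] by blast
  obtain d m where dm: "diag_coords = {e, d, m}" "triad e d m" "adj a m" "\<not> adj a d"
    using diag_split[OF a e] .
  have neq: "e \<noteq> d" "e \<noteq> m" "d \<noteq> m" using triad_distinct[OF dm(2)] by auto
  \<comment> \<open>The relation between the differentials is applied to the family that consists of \<open>n\<close> alone.\<close>
  have "coord_row (\<lambda>_::1. n) ` {y. \<not> adj a y \<and> y \<noteq> e} \<subseteq> {0}"
    using n(2) by (auto simp: coord_row_def axis_nth vec_eq_iff)
  then have "vec.span (coord_row (\<lambda>_::1. n) ` {y. \<not> adj a y \<and> y \<noteq> e}) \<subseteq> {0}"
    by (rule vec.span_minimal) (rule vec.subspace_single_0)
  moreover have "range (\<lambda>_::1. n) \<subseteq> cone_kernel p" using n(1) by auto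
  ultimately have "coord_row (\<lambda>_::1. n) m = 0"
    using diag_partner_row[OF _ pa a e dm(3) triad_adj(2)[OF dm(2)]] by blast
  then have "n $ m = 0" by (simp add: coord_row_def vec_eq_iff)
  moreover have "n $ e = 1" "n $ d = 0" using n(2) e(2) dm(4) neq by (auto simp: axis_nth)
  ultimately have "trace3 n = 1" using neq by (simp add: trace3_def dm(1))
  then show ?thesis using that n(1) by blast
qed

section \<open>Charts of the manifold\<close>

text \<open>The coordinates outside the chart are filled up by 0; the retraction overwrites them.\<close>

definition chart_embed :: "('k::finite \<Rightarrow> coord) \<Rightarrow> complex^'k \<Rightarrow> complex^coord" where
  "chart_embed P u = (\<chi> c. if c \<in> range P then u $ inv_into UNIV P c else 0)"

lemma chart_embed_nth: "inj P \<Longrightarrow> chart_embed P u $ P i = u $ i"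
  by (simp add: chart_embed_def)

text \<open>The inverse of the chart retracts the point with the given chart coordinates to the manifold.\<close>

theorem chart_parametrization:
  fixes P :: "'k::finite \<Rightarrow> coord"
  assumes ae: "a \<in> offdiag_coords" "e \<in> diag_coords" "\<not> adj a e"
    and P: "bij_betw P UNIV {c. \<not> adj a c \<and> c \<noteq> e}"
  obtains U \<phi> where "holo_param XO U \<phi>" "\<phi> ` U = O_nbhd a" "\<And>u. u \<in> U \<Longrightarrow> (\<chi> i. \<phi> u $ P i) = u"
proof -
  have injP: "inj P" and ranP: "range P = {c. \<not> adj a c \<and> c \<noteq> e}" using P by (auto simp: bij_betw_def)
  have "a \<noteq> e" using ae by (auto simp: offdiag_coords_def)
  then have "a \<in> range P" using ranP not_adj_self by simp
  then obtain i0 where i0: "P i0 = a" by blast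
  define U where "U = {u :: complex^'k. u $ i0 \<noteq> 0}"
  define \<phi> where "\<phi> u = XO_retract a e (chart_embed P u)" for u
  define \<psi> :: "complex^coord \<Rightarrow> complex^'k" where "\<psi> p = (\<chi> i. p $ P i)" for p
  have U: "open U"
  proof -
    have "U = (\<lambda>u. u $ i0) -` (- {0})" by (auto simp: U_def)
    moreover have "open ((\<lambda>u :: complex^'k. u $ i0) -` (- {0}))"
      by (auto intro!: open_vimage continuous_intros)
    ultimately show ?thesis by simp
  qed
  have emb: "chart_embed P u $ a \<noteq> 0" if "u \<in> U" for u
    using that chart_embed_nth[OF injP, of u i0] by (simp add: U_def i0)
  have \<phi>P: "\<phi> u $ P i = u $ i" for u i
  proof -
    have "P i \<in> {c. \<not> adj a c \<and> c \<noteq> e}" using ranP by blast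
    then show ?thesis by (simp add: \<phi>_def XO_retract_nth[OF ae] chart_embed_nth[OF injP])
  qed
  have \<psi>\<phi>: "\<psi> (\<phi> u) = u" for u by (simp add: \<psi>_def \<phi>P vec_eq_iff)
  have cd: "holo_at (\<lambda>u. \<phi> u $ i) u" if "u \<in> U" for u i
    unfolding \<phi>_def
  proof (rule holo_at_compose[where f = "\<lambda>x. XO_retract a e x $ i"])
    show "holo_at (\<lambda>x. XO_retract a e x $ i) (chart_embed P u)"
      using emb[OF that] \<open>a \<noteq> e\<close> by (rule holo_at_retract)
    show "holo_at (\<lambda>x. chart_embed P x $ c) u" for c
      by (cases "c \<in> range P") (simp_all add: chart_embed_def holo_at_nth holo_at_const)
  qed
  have \<phi>_in: "\<phi> u \<in> O_nbhd a" if "u \<in> U" for u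
  proof -
    have "\<phi> u $ a \<noteq> 0" using \<phi>P[of u i0] that by (simp add: i0 U_def)
    moreover have "\<phi> u \<noteq> 0" using calculation by auto
    ultimately show ?thesis
      using emb[OF that] by (simp add: O_nbhd_def XO_iff \<phi>_def quad_XO_retract[OF ae] trace_XO_retract[OF ae])
  qed
  have \<phi>\<psi>: "\<phi> (\<psi> p) = p" and \<psi>_in: "\<psi> p \<in> U" if "p \<in> O_nbhd a" for p
  proof -
    have p: "p $ a \<noteq> 0" "trace3 p = 0" "\<And>c. quad c p = 0" using that by (auto simp: O_nbhd_def XO_iff)
    show "\<psi> p \<in> U" using p by (simp add: U_def \<psi>_def i0)
    have "XO_retract a e (chart_embed P (\<psi> p)) = XO_retract a e p"
    proof (rule XO_retract_cong[OF ae emb[OF \<open>\<psi> p \<in> U\<close>]])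
      fix g assume "\<not> adj a g" "g \<noteq> e"
      then have "g \<in> range P" by (simp add: ranP)
      then obtain i where "g = P i" by blast
      then show "chart_embed P (\<psi> p) $ g = p $ g" by (simp add: chart_embed_nth[OF injP] \<psi>_def)
    qed
    then show "\<phi> (\<psi> p) = p" by (simp add: \<phi>_def XO_retract_id[OF ae p(3,2)])
  qed
  have img: "\<phi> ` U = O_nbhd a"
    using \<phi>_in \<phi>\<psi> \<psi>_in by (metis (no_types, lifting) image_eqI image_subsetI subsetI subset_antisym)
  have deriv: "(\<phi> has_derivative frechet_derivative \<phi> (at u)) (at u)" if "u \<in> U" for u
    using holo_at_has_derivative_vec[OF cd[OF that]] frechet_derivative_at by metis
  have "inj (frechet_derivative \<phi> (at u))" if u: "u \<in> U" for u
  proof -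
    have "frechet_derivative \<phi> (at u) h $ P i = h $ i" for h i
    proof -
      have "((\<lambda>u. \<phi> u $ P i) has_derivative (\<lambda>h. frechet_derivative \<phi> (at u) h $ P i)) (at u)"
        by (rule bounded_linear.has_derivative[OF bounded_linear_vec_nth deriv[OF u]])
      then have "((\<lambda>u. u $ i) has_derivative (\<lambda>h. frechet_derivative \<phi> (at u) h $ P i)) (at u)"
        by (simp only: \<phi>P)
      moreover have "((\<lambda>u. u $ i) has_derivative (\<lambda>h. h $ i)) (at u)"
        by (rule bounded_linear_imp_has_derivative[OF bounded_linear_vec_nth])
      ultimately show ?thesis using has_derivative_unique by (metis (no_types))
    qed
    then show ?thesis by (metis injI vec_eq_iff)
  qed
  moreover have "homeomorphism U (\<phi> ` U) \<phi> \<psi>"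
  proof (rule homeomorphismI)
    show "continuous_on U \<phi>"
      using deriv by (meson continuous_at_imp_continuous_on has_derivative_continuous)
    show "continuous_on (\<phi> ` U) \<psi>"
      unfolding \<psi>_def by (intro continuous_intros)
  qed (use \<psi>\<phi> in auto)
  moreover have "openin (top_of_set XO) (\<phi> ` U)"
  proof -
    have "open ((\<lambda>p :: complex^coord. p $ a) -` (- {0}))"
      by (auto intro!: open_vimage continuous_intros)
    moreover have "O_nbhd a = XO \<inter> (\<lambda>p. p $ a) -` (- {0})" by (auto simp: O_nbhd_def)
    ultimately show ?thesis by (auto simp: img openin_open)
  qed
  ultimately have "holo_param XO U \<phi>"
    unfolding holo_param_def using U cd by (auto simp: holo_on_iff)
  moreover have "(\<chi> i. \<phi> u $ P i) = u" for u using \<psi>\<phi> by (simp add: \<psi>_def)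
  ultimately show ?thesis using that img by blast
qed

text \<open>A diagonal matrix on the cone has at most one nonzero entry, so its trace vanishes only if it
  is 0.\<close>

lemma XO_covered:
  assumes "p \<in> XO" shows "\<exists>a\<in>offdiag_coords. p \<in> O_nbhd a"
proof (rule ccontr)
  assume "\<not> ?thesis"
  then have z: "p $ a = 0" if "a \<notin> {Xi1, Xi2, Xi3}" for a
    using that assms by (auto simp: O_nbhd_def offdiag_coords_def diag_coords_def)
  have p: "p \<noteq> 0" "trace3 p = 0" "quad Xi1 p = 0" "quad Xi2 p = 0" "quad Xi3 p = 0"
    using assms by (auto simp: XO_iff)
  then have "p $ Xi1 = 0" "p $ Xi2 = 0" "p $ Xi3 = 0"
    by (auto simp: quad_def z trace3_eq)
  with z have "p $ c = 0" for c by (cases "c \<in> {Xi1, Xi2, Xi3}") auto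
  with p(1) show False by (simp add: vec_eq_iff)
qed

section \<open>A coherent choice of orientations\<close>

text \<open>A point of the cone with all coordinates nonzero, used to compare orientations. It is
  obtained from nonzero integers at the coordinates not adjacent to \<open>Z1\<close>, with the value 1 at
  \<open>Z1\<close>, by solving for the ten others.\<close>

definition base_point :: "complex^coord" where
  "base_point = (\<chi> c. case c of Xi1 \<Rightarrow> -1 | Xi2 \<Rightarrow> -1 | Xi3 \<Rightarrow> -2
    | Z1 \<Rightarrow> 1 | Z2 \<Rightarrow> -2 | Z3 \<Rightarrow> -1 | Z4 \<Rightarrow> 1 | W1 \<Rightarrow> 1 | W2 \<Rightarrow> 1 | W3 \<Rightarrow> -1 | W4 \<Rightarrow> 1
    | Y1 \<Rightarrow> -2 | Y2 \<Rightarrow> -1 | Y3 \<Rightarrow> -1 | Y4 \<Rightarrow> -1 | V1 \<Rightarrow> -1 | V2 \<Rightarrow> 2 | V3 \<Rightarrow> -1 | V4 \<Rightarrow> 1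
    | X1 \<Rightarrow> 2 | X2 \<Rightarrow> 2 | X3 \<Rightarrow> 2 | X4 \<Rightarrow> 1 | U1 \<Rightarrow> -2 | U2 \<Rightarrow> -2 | U3 \<Rightarrow> 1 | U4 \<Rightarrow> -1)"

lemma quad_base_point: "quad c base_point = 0"
  by (cases c) (simp_all add: quad_def base_point_def)

lemma base_point_nonzero: "base_point $ c \<noteq> 0"
  by (cases c) (simp_all add: base_point_def)

lemma kernel_dual_family:
  fixes f :: "'k::finite \<Rightarrow> coord"
  assumes q: "\<And>c. quad c p = 0" and pa: "p $ a \<noteq> 0" and f: "bij_betw f UNIV {c. \<not> adj a c}"
  obtains w where "range w \<subseteq> cone_kernel p" "wedge_differentials f w = 1"
proof -
  have "\<exists>w. w \<in> cone_kernel p \<and> (\<forall>c. \<not> adj a c \<longrightarrow> w $ c = (axis (f j) 1 :: complex^coord) $ c)" for j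
    using cone_kernel_lift[OF q pa] by blast
  then obtain w where w: "\<And>j. w j \<in> cone_kernel p"
      "\<And>j c. \<not> adj a c \<Longrightarrow> w j $ c = (axis (f j) 1 :: complex^coord) $ c" by metis
  have "\<not> adj a (f i)" "inj f" for i using f by (auto simp: bij_betw_def)
  then have "(\<chi> i j. w j $ f i) = (mat 1 :: complex^'k^'k)"
    by (simp add: w(2) axis_nth vec_eq_iff mat_def inj_eq)
  then have "wedge_differentials f w = 1" by (simp add: wedge_differentials_def)
  with w(1) show ?thesis using that by blast
qed

text \<open>At the base point the forms at different coordinates agree up to sign. Exchanging two
  coordinates in the enumeration at \<open>a\<close>, if necessary, makes them agree there and hence
  everywhere. The coordinate at \<open>None\<close> stays in place, since it is to be removed by the trace
  relation.\<close>

theorem coherent_orientations: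
  fixes h :: "coord \<Rightarrow> 'k::finite option \<Rightarrow> coord"
  assumes h: "\<And>a. bij_betw (h a) UNIV {c. \<not> adj a c}" and k: "CARD('k) \<ge> 2"
  obtains Q :: "coord \<Rightarrow> 'k option \<Rightarrow> coord"
  where "\<And>a. bij_betw (Q a) UNIV {c. \<not> adj a c}" "\<And>a. Q a None = h a None" "Q a0 = h a0"
    "\<And>a b p w. (\<And>c. quad c p = 0) \<Longrightarrow> range w \<subseteq> cone_kernel p \<Longrightarrow> p $ a \<noteq> 0 \<Longrightarrow> p $ b \<noteq> 0 \<Longrightarrow>
      wedge_differentials (Q a) w / p $ a ^ 5 = wedge_differentials (Q b) w / p $ b ^ 5"
proof -
  obtain w0 where w0: "range w0 \<subseteq> cone_kernel base_point" "wedge_differentials (h a0) w0 = 1"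
    using kernel_dual_family[OF quad_base_point base_point_nonzero h] by blast
  define form where "form f a p w = wedge_differentials (f a) w / p $ a ^ 5"
    for f :: "coord \<Rightarrow> 'k option \<Rightarrow> coord" and a :: coord and p :: "complex^coord" and w
  have nz: "form h a0 base_point w0 \<noteq> 0"
    using w0(2) base_point_nonzero by (simp add: form_def)
  obtain i j :: 'k where ij: "i \<noteq> j"
    using k by (metis (full_types) UNIV_I card_1_singleton_iff card_le_Suc0_iff_eq finite not_less_eq_eq numeral_2_eq_2)
  define \<tau> where "\<tau> = Transposition.transpose (Some i) (Some j)"
  have \<tau>: "\<tau> permutes UNIV" "sign \<tau> = -1" "\<tau> None = None"
    using ij by (simp_all add: \<tau>_def permutes_swap_id sign_swap_id transpose_def)
  define Q where "Q a = (if form h a base_point w0 = form h a0 base_point w0 then h a else h a \<circ> \<tau>)" for a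
  have Q: "bij_betw (Q a) UNIV {c. \<not> adj a c}" for a
    using h[of a] bij_betw_trans[OF permutes_imp_bij[OF \<tau>(1)] h[of a]] by (simp add: Q_def)
  have Qa0: "Q a0 = h a0" by (simp add: Q_def)
  have same: "form Q a base_point w0 = form h a0 base_point w0" for a
    using wedge_consistent(1)[OF h quad_base_point base_point_nonzero w0(1), of a0 a a0] nz
    by (auto simp: Q_def form_def wedge_permute[OF \<tau>(1)] \<tau>(2))
  show ?thesis
  proof (rule that[OF Q])
    show "Q a None = h a None" for a by (simp add: Q_def \<tau>(3))
    show "Q a0 = h a0" by (rule Qa0)
    fix a b p and w :: "'k option \<Rightarrow> complex^coord"
    assume "\<And>c. quad c p = 0" "range w \<subseteq> cone_kernel p" "p $ a \<noteq> 0" "p $ b \<noteq> 0"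
    moreover have "wedge_differentials (Q a0) w0 / base_point $ a0 ^ 5 \<noteq> 0"
      using nz by (simp add: form_def Qa0)
    ultimately have "form Q a p w * form Q b base_point w0 = form Q b p w * form Q a base_point w0"
      unfolding form_def by (intro wedge_consistent(2)[OF Q quad_base_point base_point_nonzero w0(1)])
    then have "form Q a p w = form Q b p w"
      unfolding same mult_right_cancel[OF nz] .
    then show "wedge_differentials (Q a) w / p $ a ^ 5 = wedge_differentials (Q b) w / p $ b ^ 5"
      by (simp only: form_def)
  qed
qed

section \<open>The canonical section\<close>

lemma alternating_wedge:
  fixes c :: "'k::finite \<Rightarrow> 'n::finite"
  shows "alternating_form T (\<lambda>v. k * wedge_differentials c v)"
proof -
  have t: "wedge_differentials c v = det (\<chi> j. (\<chi> i. v j $ c i))" for v :: "'k \<Rightarrow> complex^'n"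
  proof -
    have "transpose (\<chi> i j. v j $ c i) = (\<chi> j. (\<chi> i. v j $ c i))" by (simp add: transpose_def)
    with det_transpose[of "\<chi> i j. v j $ c i"] show ?thesis by (simp add: wedge_differentials_def)
  qed
  have row: "(\<chi> j. (\<chi> l. (v(i := x)) j $ c l)) = (\<chi> j. if j = i then (\<chi> l. x $ c l) else (\<chi> l. v j $ c l))"
    for v :: "'k \<Rightarrow> complex^'n" and i x by (auto simp: vec_eq_iff)
  have add: "wedge_differentials c (v(i := x + y)) =
      wedge_differentials c (v(i := x)) + wedge_differentials c (v(i := y))" for v i x y
  proof -
    have eq: "(\<chi> l. (x + y) $ c l) = (\<chi> l. x $ c l) + (\<chi> l. y $ c l)" by (simp add: vec_eq_iff)
    show ?thesis unfolding t row eq by (rule det_row_add)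
  qed
  have smult: "wedge_differentials c (v(i := r *s x)) = r * wedge_differentials c (v(i := x))" for v i r x
  proof -
    have eq: "(\<chi> l. (r *s x) $ c l) = r *s (\<chi> l. x $ c l)" by (simp add: vec_eq_iff)
    show ?thesis unfolding t row eq by (rule det_row_mul)
  qed
  have alt: "wedge_differentials c v = 0" if "i \<noteq> j" "v i = v j" for v i j
    unfolding t by (rule det_identical_rows[OF that(1)]) (simp only: row_def vec_lambda_beta that(2))
  show ?thesis
    unfolding alternating_form_def
  proof (intro conjI allI impI)
    show "k * wedge_differentials c (v(i := x + y)) =
        k * wedge_differentials c (v(i := x)) + k * wedge_differentials c (v(i := y))" for v i x y
      unfolding add by (rule distrib_left)
    show "k * wedge_differentials c (v(i := r *s x)) = r * (k * wedge_differentials c (v(i := x)))" for v i x r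
      unfolding smult by (rule mult.left_commute)
    show "k * wedge_differentials c v = 0" if "i \<noteq> j" "v i = v j" for v i j
      using alt[OF that] by simp
  qed
qed

lemma bij_of_nat_16: "bij_betw (of_nat :: nat \<Rightarrow> 16) {..<16} UNIV"
proof -
  have "surj_on": "(of_nat :: nat \<Rightarrow> 16) ` {..<16} = UNIV"
  proof (intro equalityI subsetI)
    fix x :: 16
    obtain z where z: "x = of_int z" "0 \<le> z" "z < 16"
      by (rule bit0.cases[of x]) auto
    have "of_nat (nat z) = (of_int (int (nat z)) :: 16)" by (rule of_int_of_nat_eq[symmetric])
    with z have "x = of_nat (nat z)" "nat z < 16" by simp_all
    then show "x \<in> of_nat ` {..<16}" by blast
  qed simp
  moreover have "inj_on (of_nat :: nat \<Rightarrow> 16) {..<16}"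
    by (rule eq_card_imp_inj_on) (simp_all add: surj_on)
  ultimately show ?thesis by (simp add: bij_betw_def)
qed

definition chart_list_Z1 :: "coord list" where
  "chart_list_Z1 = [Xi2, Z1, Z2, Z3, W1, W2, W3, W4, Y2, Y4, V1, V3, X3, X4, U2, U4]"

definition chart_order_Z1 :: "16 \<Rightarrow> coord" where
  "chart_order_Z1 i = chart_list_Z1 ! inv_into {..<16} of_nat i"

lemma chart_order_Z1_of_nat: "k < 16 \<Longrightarrow> chart_order_Z1 (of_nat k) = chart_list_Z1 ! k"
  using bij_of_nat_16 by (simp add: chart_order_Z1_def bij_betw_def inv_into_f_f)

lemma map_chart_order_Z1: "map (\<lambda>k. chart_order_Z1 (of_nat k)) [0..<16] = chart_list_Z1"
  by (rule nth_equalityI) (simp_all add: chart_order_Z1_of_nat, simp_all add: chart_list_Z1_def)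

lemma bij_chart_order_Z1: "bij_betw chart_order_Z1 UNIV (set chart_list_Z1)"
proof -
  have "bij_betw (\<lambda>k. chart_list_Z1 ! k) {..<16} (set chart_list_Z1)"
    by (rule bij_betw_nth) (simp_all add: chart_list_Z1_def)
  from bij_betw_trans[OF bij_betw_inv_into[OF bij_of_nat_16] this]
  show ?thesis by (simp add: chart_order_Z1_def[abs_def] o_def)
qed

theorem theorem4p7:
  fixes elim :: "coord \<Rightarrow> coord"
  assumes elim: "\<forall>a\<in>offdiag_coords. elim a \<in> diag_coords - partners a"
    and elim_Z1: "elim Z1 = Xi1"
  shows "complex_submanifold TYPE(16) XO \<and>
    (\<exists>(P :: coord \<Rightarrow> 16 \<Rightarrow> coord) (\<Omega> :: complex^coord \<Rightarrow> (16 \<Rightarrow> complex^coord) \<Rightarrow> complex).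
       (\<forall>a\<in>offdiag_coords.
          bij_betw (P a) UNIV (chart_coords (elim a) a) \<and>
          holo_chart XO (O_nbhd a) (\<lambda>p. \<chi> i. p $ P a i)) \<and>
       map (\<lambda>k. P Z1 (of_nat k)) [0..<16] =
         [Xi2, Z1, Z2, Z3, W1, W2, W3, W4, Y2, Y4, V1, V3, X3, X4, U2, U4] \<and>
       holo_canonical_section XO \<Omega> \<and>
       nowhere_vanishing XO \<Omega> \<and>
       (\<forall>a\<in>offdiag_coords. \<forall>p\<in>O_nbhd a. \<forall>v. range v \<subseteq> tangent_space XO p \<longrightarrow>
          \<Omega> p v = 1 / (p $ a) ^ 5 * wedge_differentials (P a) v))"
proof -
  \<comment> \<open>The forms on the cone are also used at the diagonal coordinates, as go-betweens. There no
    coordinate is eliminated, and any coordinate of the system may be listed first.\<close>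
  define e where "e a = (if a \<in> offdiag_coords then elim a else a)" for a
  have e_off: "e a \<in> diag_coords" "\<not> adj a (e a)" if "a \<in> offdiag_coords" for a
    using elim that partners_eq[OF that] by (auto simp: e_def)
  have e: "\<not> adj a (e a)" for a
  proof (cases "a \<in> offdiag_coords")
    case True
    then show ?thesis by (rule e_off(2))
  qed (simp add: e_def not_adj_self)
  have Z1: "Z1 \<in> offdiag_coords" by (simp add: offdiag_coords_def diag_coords_def)
  have e_Z1: "e Z1 = Xi1" using Z1 elim_Z1 by (simp add: e_def)
  have set_Z1: "set chart_list_Z1 = {c. \<not> adj Z1 c} - {e Z1}"
  proof -
    have "set chart_list_Z1 = chart_coords Xi1 Z1"
      by (simp only: chart_coords_Z1 chart_list_Z1_def list.set)
    also have "\<dots> = {c. \<not> adj Z1 c} - {e Z1}"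
      unfolding chart_coords_def partners_eq[OF Z1] e_Z1 by blast
    finally show ?thesis .
  qed
  have "\<exists>f :: 16 \<Rightarrow> coord. bij_betw f UNIV ({c. \<not> adj a c} - {e a})" for a
  proof (rule finite_same_card_bij)
    show "card (UNIV :: 16 set) = card ({c. \<not> adj a c} - {e a})"
      using card_not_adj[of a] e[of a] by simp
  qed simp_all
  then obtain f0 :: "coord \<Rightarrow> 16 \<Rightarrow> coord"
    where f0: "\<And>a. bij_betw (f0 a) UNIV ({c. \<not> adj a c} - {e a})" by metis
  define f where "f a = (if a = Z1 then chart_order_Z1 else f0 a)" for a
  have f: "bij_betw (f a) UNIV ({c. \<not> adj a c} - {e a})" for a
    using f0 bij_chart_order_Z1 by (simp add: f_def set_Z1)
  define h where "h a = case_option (e a) (f a)" for a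
  have h: "bij_betw (h a) UNIV {c. \<not> adj a c}" for a
  proof -
    have "range (h a) = insert (e a) (range (f a))"
      by (simp add: h_def UNIV_option_conv image_image)
    then have "range (h a) = {c. \<not> adj a c}" using f[of a] e[of a] by (auto simp: bij_betw_def)
    moreover have "inj (h a)"
    proof (rule injI)
      fix x y assume xy: "h a x = h a y"
      have "f a i \<noteq> e a" "e a \<noteq> f a i" for i using f[of a] by (auto simp: bij_betw_def)
      moreover have "inj (f a)" using f[of a] by (simp add: bij_betw_def)
      ultimately show "x = y" using xy
        by (cases x; cases y) (auto simp: h_def inj_eq)
    qed
    ultimately show ?thesis by (simp add: bij_betw_def)
  qed
  obtain Q :: "coord \<Rightarrow> 16 option \<Rightarrow> coord" where
    Q: "\<And>a. bij_betw (Q a) UNIV {c. \<not> adj a c}" "\<And>a. Q a None = e a" "Q Z1 = h Z1"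
    and coherent: "\<And>a b p w. (\<And>c. quad c p = 0) \<Longrightarrow> range w \<subseteq> cone_kernel p \<Longrightarrow>
        p $ a \<noteq> 0 \<Longrightarrow> p $ b \<noteq> 0 \<Longrightarrow>
        wedge_differentials (Q a) w / p $ a ^ 5 = wedge_differentials (Q b) w / p $ b ^ 5"
  proof (rule coherent_orientations[OF h, of Z1])
    fix Q :: "coord \<Rightarrow> 16 option \<Rightarrow> coord"
    assume Q: "\<And>a. bij_betw (Q a) UNIV {c. \<not> adj a c}" "\<And>a. Q a None = h a None" "Q Z1 = h Z1"
      "\<And>a b p w. (\<And>c. quad c p = 0) \<Longrightarrow> range w \<subseteq> cone_kernel p \<Longrightarrow>
        p $ a \<noteq> 0 \<Longrightarrow> p $ b \<noteq> 0 \<Longrightarrow>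
        wedge_differentials (Q a) w / p $ a ^ 5 = wedge_differentials (Q b) w / p $ b ^ 5"
    have "Q a None = e a" for a by (simp add: Q(2) h_def)
    then show thesis by (rule that[OF Q(1) _ Q(3,4)])
  qed simp_all
  define P where "P a i = Q a (Some i)" for a i
  have P: "bij_betw (P a) UNIV ({c. \<not> adj a c} - {e a})" for a
  proof -
    have Qa: "inj (Q a)" "range (Q a) = {c. \<not> adj a c}" using Q(1)[of a] by (simp_all add: bij_betw_def)
    have "range (Q a) = insert (e a) (range (P a))"
      by (simp add: P_def[abs_def] UNIV_option_conv Q(2) image_image)
    moreover have "e a \<notin> range (P a)"
    proof
      assume "e a \<in> range (P a)"
      then obtain i where "e a = P a i" by blast
      then have "Q a None = Q a (Some i)" by (simp only: P_def Q(2))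
      then have "None = Some i" by (rule injD[OF Qa(1)])
      then show False by simp
    qed
    ultimately have "range (P a) = {c. \<not> adj a c} - {e a}"
      by (simp only: Qa(2)) (metis Diff_insert_absorb)
    moreover have "inj (P a)"
    proof (rule injI)
      fix x y assume "P a x = P a y"
      then have "Some x = Some y" by (intro injD[OF Qa(1)]) (simp add: P_def)
      then show "x = y" by simp
    qed
    ultimately show ?thesis by (simp add: bij_betw_def)
  qed
  have P': "bij_betw (P a) UNIV {c. \<not> adj a c \<and> c \<noteq> e a}" for a
  proof -
    have "{c. \<not> adj a c} - {e a} = {c. \<not> adj a c \<and> c \<noteq> e a}" by auto
    with P[of a] show ?thesis by simp
  qed
  have PZ1: "P Z1 = chart_order_Z1" by (simp add: P_def[abs_def] Q(3) h_def f_def)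
  have param: "\<exists>U \<phi>. holo_param XO U \<phi> \<and> \<phi> ` U = O_nbhd a \<and> (\<forall>u\<in>U. (\<chi> i. \<phi> u $ P a i) = u)"
    if "a \<in> offdiag_coords" for a
  proof (rule chart_parametrization[OF that e_off[OF that] P'])
    fix U \<phi> assume "holo_param XO U \<phi>" "\<phi> ` U = O_nbhd a" "\<And>u. u \<in> U \<Longrightarrow> (\<chi> i. \<phi> u $ P a i) = u"
    then show ?thesis by (intro exI[of _ U] exI[of _ \<phi>] conjI ballI)
  qed
  have overlap: "wedge_differentials (P a) v / p $ a ^ 5 = wedge_differentials (P b) v / p $ b ^ 5"
    if ab: "a \<in> offdiag_coords" "b \<in> offdiag_coords" and p: "p \<in> O_nbhd a" "p \<in> O_nbhd b"
      and v: "range v \<subseteq> tangent_space XO p" for a b p and v :: "16 \<Rightarrow> complex^coord"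
  proof -
    have q: "quad c p = 0" for c using p by (auto simp: O_nbhd_def XO_iff)
    have nz: "p $ a \<noteq> 0" "p $ b \<noteq> 0" using p by (auto simp: O_nbhd_def)
    have v': "v j \<in> cone_kernel p" "trace3 (v j) = 0" for j
      using v tangent_space_subset[of p] by auto
    obtain n where n: "n \<in> cone_kernel p" "trace3 n = 1"
      using kernel_trace_vector[OF ab(1) q nz(1) e_off[OF ab(1)]] by blast
    have "wedge_differentials (Q x) (case_option n v) = wedge_differentials (P x) v"
      if "x \<in> offdiag_coords" "p $ x \<noteq> 0" for x
      using wedge_trace[OF that(1) _ Q(1) that(2) n(1) v'] e_off(1)[OF that(1)] n(2)
      by (simp add: Q(2) P_def[abs_def])
    moreover have "range (case_option n v) \<subseteq> cone_kernel p"
      using n(1) v'(1) by (auto split: option.splits)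
    ultimately show ?thesis using coherent[OF q _ nz, of "case_option n v"] ab nz by simp
  qed
  define pick where "pick p = (SOME a. a \<in> offdiag_coords \<and> p \<in> O_nbhd a)" for p
  have pick: "pick p \<in> offdiag_coords" "p \<in> O_nbhd (pick p)" if "p \<in> XO" for p
  proof -
    have "\<exists>a. a \<in> offdiag_coords \<and> p \<in> O_nbhd a" using XO_covered[OF that] by blast
    from someI_ex[OF this] show "pick p \<in> offdiag_coords" "p \<in> O_nbhd (pick p)"
      by (simp_all add: pick_def)
  qed
  \<comment> \<open>On tangent vectors the value does not depend on the choice of a nonzero coordinate.\<close>
  define \<Omega> where "\<Omega> p v = 1 / (p $ pick p) ^ 5 * wedge_differentials (P (pick p)) v"
    for p and v :: "16 \<Rightarrow> complex^coord"
  have \<Omega>: "\<Omega> p v = 1 / (p $ a) ^ 5 * wedge_differentials (P a) v"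
    if "a \<in> offdiag_coords" "p \<in> O_nbhd a" "range v \<subseteq> tangent_space XO p" for a p v
  proof -
    have "p \<in> XO" using that(2) by (simp add: O_nbhd_def)
    from overlap[OF pick(1)[OF this] that(1) pick(2)[OF this] that(2,3)]
    show ?thesis by (simp add: \<Omega>_def)
  qed
  have "complex_submanifold TYPE(16) XO"
    unfolding complex_submanifold_def
  proof
    fix p assume "p \<in> XO"
    then obtain a where "a \<in> offdiag_coords" "p \<in> O_nbhd a" using XO_covered by blast
    then show "\<exists>(U :: (complex^16) set) \<phi>. holo_param XO U \<phi> \<and> p \<in> \<phi> ` U"
      using param[of a] by metis
  qed
  moreover have "\<forall>a\<in>offdiag_coords. bij_betw (P a) UNIV (chart_coords (elim a) a) \<and>
      holo_chart XO (O_nbhd a) (\<lambda>p. \<chi> i. p $ P a i)"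
  proof (intro ballI conjI)
    fix a assume aoff: "a \<in> offdiag_coords"
    have "chart_coords (elim a) a = {c. \<not> adj a c} - {e a}"
      using aoff by (auto simp: chart_coords_def partners_eq e_def)
    then show "bij_betw (P a) UNIV (chart_coords (elim a) a)" using P by simp
    show "holo_chart XO (O_nbhd a) (\<lambda>p. \<chi> i. p $ P a i)"
      unfolding holo_chart_def
    proof -
      obtain U \<phi> where "holo_param XO U \<phi>" "\<phi> ` U = O_nbhd a" "\<forall>u\<in>U. (\<chi> i. \<phi> u $ P a i) = u"
        using param[OF aoff] by (elim exE conjE)
      then show "\<exists>U \<phi>. holo_param XO U \<phi> \<and> \<phi> ` U = O_nbhd a \<and> (\<forall>u\<in>U. (\<chi> i. \<phi> u $ P a i) = u)"
        by (intro exI conjI)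
    qed
  qed
  moreover have "map (\<lambda>k. P Z1 (of_nat k)) [0..<16] =
         [Xi2, Z1, Z2, Z3, W1, W2, W3, W4, Y2, Y4, V1, V3, X3, X4, U2, U4]"
    using map_chart_order_Z1 by (simp only: PZ1 chart_list_Z1_def)
  moreover have "holo_canonical_section XO \<Omega>"
    unfolding holo_canonical_section_def
  proof (intro conjI ballI allI impI)
    show "alternating_form (tangent_space XO p) (\<Omega> p)" for p
      unfolding \<Omega>_def by (rule alternating_wedge)
    fix U :: "(complex^16) set" and \<phi> assume \<phi>: "holo_param XO U \<phi>"
    have U: "open U" using \<phi> by (simp add: holo_param_def)
    have img: "\<phi> u \<in> XO" if "u \<in> U" for u
    proof -
      have "openin (top_of_set XO) (\<phi> ` U)" using \<phi> by (simp add: holo_param_def)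
      from openin_imp_subset[OF this] that show ?thesis by blast
    qed
    show "holo_on (\<lambda>u. \<Omega> (\<phi> u) (\<lambda>j. frechet_derivative \<phi> (at u) (axis j 1))) U"
      unfolding holo_on_iff
    proof
      fix u0 assume u0: "u0 \<in> U"
      obtain a where a: "a \<in> offdiag_coords" "\<phi> u0 \<in> O_nbhd a" using XO_covered[OF img[OF u0]] by blast
      define V where "V = {u \<in> U. \<phi> u $ a \<noteq> 0}"
      have "continuous_on U (\<lambda>u. \<phi> u $ a)"
        using holo_param_holo_at[OF \<phi>] holo_at_frechet(1)
        by (meson continuous_at_imp_continuous_on has_derivative_continuous)
      then have "open (U \<inter> (\<lambda>u. \<phi> u $ a) -` (- {0}))"
        using U by (intro continuous_open_preimage) auto
      moreover have "V = U \<inter> (\<lambda>u. \<phi> u $ a) -` (- {0})" by (auto simp: V_def)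
      ultimately have V: "open V" "u0 \<in> V" using a(2) u0 by (auto simp: V_def O_nbhd_def)
      \<comment> \<open>The coefficient of the section near \<open>u0\<close>, written in terms of the fixed coordinate \<open>a\<close>.\<close>
      have "holo_at (\<lambda>u. 1 / (\<phi> u $ a) ^ 5 *
          det ((\<chi> i j. frechet_derivative (\<lambda>u. \<phi> u $ P a i) (at u) (axis j 1)) :: complex^16^16)) u0"
      proof (intro holo_at_mult holo_at_divide holo_at_const holo_at_power holo_at_det)
        show "holo_at (\<lambda>u. \<phi> u $ a) u0" using holo_param_holo_at[OF \<phi> u0] .
        show "(\<phi> u0 $ a) ^ 5 \<noteq> 0" using V(2) by (simp add: V_def)
        fix i j
        have "holo_on (\<lambda>u. \<phi> u $ P a i) U" using \<phi> by (simp add: holo_param_def)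
        from holo_on_frechet_derivative[OF U this, of "axis j 1"] u0
        show "holo_at (\<lambda>u. (\<chi> i j. frechet_derivative (\<lambda>u. \<phi> u $ P a i) (at u) (axis j 1)) $ i $ j) u0"
          by (simp add: holo_on_iff)
      qed
      then show "holo_at (\<lambda>u. \<Omega> (\<phi> u) (\<lambda>j. frechet_derivative \<phi> (at u) (axis j 1))) u0"
      proof (rule holo_at_transform_open[OF _ V])
        fix u assume "u \<in> V"
        then have u: "u \<in> U" "\<phi> u \<in> O_nbhd a" using img by (auto simp: V_def O_nbhd_def)
        have "range (\<lambda>j. frechet_derivative \<phi> (at u) (axis j 1)) \<subseteq> tangent_space XO (\<phi> u)"
          using holo_param_tangent[OF \<phi> u(1)] by blast
        from \<Omega>[OF a(1) u(2) this]
        show "1 / (\<phi> u $ a) ^ 5 *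
          det ((\<chi> i j. frechet_derivative (\<lambda>u. \<phi> u $ P a i) (at u) (axis j 1)) :: complex^16^16) =
          \<Omega> (\<phi> u) (\<lambda>j. frechet_derivative \<phi> (at u) (axis j 1))"
          by (simp add: wedge_differentials_def holo_param_frechet[OF \<phi> u(1)])
      qed
    qed
  qed
  moreover have "nowhere_vanishing XO \<Omega>"
    unfolding nowhere_vanishing_def
  proof
    fix p assume "p \<in> XO"
    then obtain a where a: "a \<in> offdiag_coords" "p \<in> O_nbhd a" using XO_covered by blast
    obtain U \<phi> where \<phi>: "holo_param XO U \<phi>" "\<phi> ` U = O_nbhd a"
      and \<phi>P: "\<forall>u\<in>U. (\<chi> i. \<phi> u $ P a i) = u"
      using param[OF a(1)] by (elim exE conjE)
    obtain u where u: "u \<in> U" "p = \<phi> u" using a(2) \<phi>(2) by blast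
    define v where "v j = frechet_derivative \<phi> (at u) (axis j 1)" for j :: 16
    have v: "range v \<subseteq> tangent_space XO p"
      using holo_param_tangent[OF \<phi>(1) u(1)] by (auto simp: v_def u(2))
    have "v j $ P a i = axis j 1 $ i" for i j
    proof -
      have U: "open U" using \<phi>(1) by (simp add: holo_param_def)
      have "((\<lambda>u. u $ i) has_derivative frechet_derivative (\<lambda>u. \<phi> u $ P a i) (at u)) (at u)"
      proof (rule has_derivative_transform_within_open[OF _ U u(1)])
        show "((\<lambda>u. \<phi> u $ P a i) has_derivative frechet_derivative (\<lambda>u. \<phi> u $ P a i) (at u)) (at u)"
          by (rule holo_at_frechet(1)[OF holo_param_holo_at[OF \<phi>(1) u(1)]])
        show "\<phi> x $ P a i = x $ i" if "x \<in> U" for x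
          using arg_cong[OF bspec[OF \<phi>P that], of "\<lambda>v. v $ i"] by simp
      qed
      moreover have "((\<lambda>u. u $ i) has_derivative (\<lambda>h. h $ i)) (at u)"
        by (rule bounded_linear_imp_has_derivative[OF bounded_linear_vec_nth])
      ultimately have "frechet_derivative (\<lambda>u. \<phi> u $ P a i) (at u) = (\<lambda>h. h $ i)"
        by (rule has_derivative_unique)
      then show ?thesis by (simp add: v_def holo_param_frechet[OF \<phi>(1) u(1)])
    qed
    then have "(\<chi> i j. v j $ P a i) = (mat 1 :: complex^16^16)"
      by (simp add: vec_eq_iff mat_def axis_def)
    then have "wedge_differentials (P a) v = 1" by (simp add: wedge_differentials_def)
    then have "\<Omega> p v \<noteq> 0" using \<Omega>[OF a v] a(2) by (simp add: O_nbhd_def)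
    with v show "\<exists>v. range v \<subseteq> tangent_space XO p \<and> \<Omega> p v \<noteq> 0" by blast
  qed
  moreover have "\<forall>a\<in>offdiag_coords. \<forall>p\<in>O_nbhd a. \<forall>v. range v \<subseteq> tangent_space XO p \<longrightarrow>
          \<Omega> p v = 1 / (p $ a) ^ 5 * wedge_differentials (P a) v"
    by (intro ballI allI impI) (rule \<Omega>)
  ultimately show ?thesis by (intro conjI exI[of _ P] exI[of _ \<Omega>])
qed

end
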